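(* Let $\pi_0$ be a probability density on $\mathbb{R}^d$ with finite mean, and let $W$ be the Wiener path measure on continuous paths $[0,1]\to\mathbb{R}^d$ (started at $\mathbf{0}$). Let $P^\star$ be the optimal solution of the static Schrödinger bridge problem $$\inf_{P}\ \mathrm{KL}(P\,\|\,W)\quad\text{such that}\quad P_0=\delta_{\mathbf{0}},\ P_1=\pi_0,$$ where $P$ ranges over probability measures on the space of continuous paths $[0,1]\to\mathbb{R}^d$. Let $\{\mathbf{v}_\tau\}_{\tau\in[0,1]}\sim P^\star$, and let $\{\mathbf{c}_t\}_{t\ge0}$ be the stochastic localization tilt process of $\pi_0$ with induced random measures $\{\pi_t\}_{t\ge0}$ (defined in the context). Then, under the time change $t=\frac{\tau}{1-\tau}$, $\tau\in[0,1)$, the processes satisfy $$\mathbf{c}_t=\frac{1}{1-\tau}\mathbf{v}_\tau$$ (as an equality in law of processes), and under this reparameterization the induced measure $\pi_t$ and the conditional law $P^\star_{1\mid\tau}(\cdot\mid\mathbf{v}_\tau)$ are identical.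
   Context: Probability measures on $\mathbb{R}^d$ are identified with their Lebesgue densities (Dirac measures excepted). For a path measure $P$ and a random path $\mathbf{p}_{[0,1]}\sim P$, $P_s$ denotes the law of $\mathbf{p}_s$ and $P_{1\mid\tau}(\cdot\mid\mathbf{z})$ denotes the conditional law of $\mathbf{p}_1$ given $\mathbf{p}_\tau=\mathbf{z}$. Stochastic localization: with $\{\mathbf{W}_t\}_{t\ge0}$ a Wiener process in $\mathbb{R}^d$, $$\mathbf{c}_0=\mathbf{0},\qquad d\mathbf{c}_t=\mathbf{m}_t\,dt+d\mathbf{W}_t,\qquad \mathbf{m}_t=\mathbb{E}_{\mathbf{x}\sim\pi_t}[\mathbf{x}],\qquad \pi_t(\mathbf{x})\propto\exp\left(\langle\mathbf{c}_t,\mathbf{x}\rangle-\tfrac t2\|\mathbf{x}\|_2^2\right)\pi_0(\mathbf{x}).$$ Standing assumption: this SDE is well posed (a solution exists and is unique in law). *)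

theory Defs
  imports "HOL-Probability.Probability"
begin

section \<open>Path spaces and Wiener processes\<close>

text \<open>Continuous paths on the time set \<open>T\<close> (extended by \<open>undefined\<close> outside \<open>T\<close>) with the
  \<open>\<sigma>\<close>-algebra generated by the evaluations, i.e. the Borel \<open>\<sigma>\<close>-algebra of locally uniform
  convergence when \<open>T\<close> is an interval.\<close>

definition path_space :: "real set \<Rightarrow> (real \<Rightarrow> 'a::euclidean_space) measure" where
  "path_space T = restrict_space (\<Pi>\<^sub>M t\<in>T. borel) {w. continuous_on T w}"

definition natural_filtration ::
    "'w set \<Rightarrow> real set \<Rightarrow> (real \<Rightarrow> 'w \<Rightarrow> 'a::euclidean_space) \<Rightarrow> real \<Rightarrow> 'w measure" where
  "natural_filtration \<Omega> T X t =
     vimage_algebra \<Omega> (\<lambda>\<omega>. \<lambda>s\<in>T \<inter> {..t}. X s \<omega>) (\<Pi>\<^sub>M s\<in>T \<inter> {..t}. borel)"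

text \<open>The density of \<open>N(0, \<sigma>\<^sup>2 I)\<close>.\<close>

definition gaussian_density :: "real \<Rightarrow> 'a::euclidean_space \<Rightarrow> real" where
  "gaussian_density \<sigma> x = (\<Prod>b\<in>Basis. normal_density 0 \<sigma> (x \<bullet> b))"

text \<open>\<open>B\<close> is a Wiener process, started at \<open>0\<close>, relative to the filtration \<open>F\<close>, with time set
  \<open>T\<close>. Filtrations are indexed by all reals; only the indices in \<open>T\<close> matter.\<close>

definition wiener_process ::
    "'w measure \<Rightarrow> (real \<Rightarrow> 'w measure) \<Rightarrow> real set \<Rightarrow> (real \<Rightarrow> 'w \<Rightarrow> 'a::euclidean_space) \<Rightarrow> bool" where
  "wiener_process M F T B \<longleftrightarrow>
     prob_space M \<and>
     filtration (space M) F \<and> (\<forall>t. subalgebra M (F t)) \<and>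
     (\<forall>t\<in>T. B t \<in> F t \<rightarrow>\<^sub>M borel) \<and>
     (AE \<omega> in M. B 0 \<omega> = 0) \<and>
     (AE \<omega> in M. continuous_on T (\<lambda>t. B t \<omega>)) \<and>
     (\<forall>s\<in>T. \<forall>t\<in>T. s < t \<longrightarrow>
        distributed M lborel (\<lambda>\<omega>. B t \<omega> - B s \<omega>) (\<lambda>x. ennreal (gaussian_density (sqrt (t - s)) x)) \<and>
        prob_space.indep_set M (sets (F s))
          (sets (vimage_algebra (space M) (\<lambda>\<omega>. B t \<omega> - B s \<omega>) borel)))"

definition wiener_measure :: "(real \<Rightarrow> 'a::euclidean_space) measure \<Rightarrow> bool" where
  "wiener_measure W \<longleftrightarrow>
     sets W = sets (path_space {0..1}) \<and>
     wiener_process W (natural_filtration (space W) {0..1} (\<lambda>t w. w t)) {0..1} (\<lambda>t w. w t)"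


section \<open>The Schroedinger bridge problem\<close>

text \<open>Relative entropy \<open>KL(P \<parallel> W)\<close> with values in the extended reals. The library's
  \<open>KL_divergence\<close> takes the reference measure first and is real valued, so the infinite cases
  have to be split off. For probability measures with \<open>P\<close> absolutely continuous w.r.t. \<open>W\<close> the
  negative part of the log-density is always \<open>P\<close>-integrable, hence non-integrability means
  that the integral is \<open>\<infinity>\<close>.\<close>

definition KL :: "'b measure \<Rightarrow> 'b measure \<Rightarrow> ereal" where
  "KL P W =
     (if absolutely_continuous W P \<and> integrable P (entropy_density (exp 1) W P)
      then ereal (KL_divergence (exp 1) W P) else \<infinity>)"

definition bridge_feasible ::
    "('a::euclidean_space \<Rightarrow> real) \<Rightarrow> (real \<Rightarrow> 'a) measure \<Rightarrow> bool" where
  "bridge_feasible \<pi>0 P \<longleftrightarrow>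
     prob_space P \<and> sets P = sets (path_space {0..1}) \<and>
     distr P borel (\<lambda>w. w 0) = return borel 0 \<and>
     distr P borel (\<lambda>w. w 1) = density lborel (\<lambda>x. ennreal (\<pi>0 x))"

text \<open>\<open>P\<close> is \<^emph>\<open>the\<close> optimal solution, i.e. the unique minimizer. By strict convexity of \<open>KL\<close>,
  uniqueness says precisely that the infimum is finite; if it is \<open>\<infinity>\<close>, then every feasible path
  measure is a minimizer.\<close>

definition bridge_optimal ::
    "(real \<Rightarrow> 'a::euclidean_space) measure \<Rightarrow> ('a \<Rightarrow> real) \<Rightarrow> (real \<Rightarrow> 'a) measure \<Rightarrow> bool" where
  "bridge_optimal W \<pi>0 P \<longleftrightarrow>
     is_arg_min (\<lambda>Q. KL Q W) (bridge_feasible \<pi>0) P \<and>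
     (\<forall>Q. is_arg_min (\<lambda>Q. KL Q W) (bridge_feasible \<pi>0) Q \<longrightarrow> Q = P)"

text \<open>\<open>\<kappa>\<close> is a version of the regular conditional law of \<open>Y\<close> given \<open>X\<close> under \<open>P\<close>. Sub-probability
  values are admitted on the kernel; for almost every value \<open>z\<close> of \<open>X\<close>, the identity makes
  \<open>\<kappa> z\<close> a probability measure.\<close>

definition cond_law ::
    "'w measure \<Rightarrow> ('w \<Rightarrow> 'a::euclidean_space) \<Rightarrow> ('w \<Rightarrow> 'a) \<Rightarrow> ('a \<Rightarrow> 'a measure) \<Rightarrow> bool" where
  "cond_law P Y X \<kappa> \<longleftrightarrow>
     \<kappa> \<in> borel \<rightarrow>\<^sub>M subprob_algebra borel \<and>
     (\<forall>A\<in>sets borel. \<forall>B\<in>sets borel.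
        emeasure P {w \<in> space P. Y w \<in> A \<and> X w \<in> B} =
        (\<integral>\<^sup>+z\<in>B. emeasure (\<kappa> z) A \<partial>distr P borel X))"


section \<open>Stochastic localization\<close>

text \<open>The measure \<open>\<pi>\<^sub>t\<close> as a function of the time \<open>t\<close> and the tilt \<open>c\<close>.\<close>

definition tilted_measure ::
    "('a::euclidean_space \<Rightarrow> real) \<Rightarrow> real \<Rightarrow> 'a \<Rightarrow> 'a measure" where
  "tilted_measure \<pi>0 t c =
     density lborel (\<lambda>x. ennreal
       (exp (c \<bullet> x - t / 2 * (norm x)\<^sup>2) * \<pi>0 x /
        (\<integral>y. exp (c \<bullet> y - t / 2 * (norm y)\<^sup>2) * \<pi>0 y \<partial>lborel)))"

definition tilted_mean ::
    "('a::euclidean_space \<Rightarrow> real) \<Rightarrow> real \<Rightarrow> 'a \<Rightarrow> 'a" where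
  "tilted_mean \<pi>0 t c = (\<integral>x. x \<partial>tilted_measure \<pi>0 t c)"

text \<open>\<open>c\<close> is a (weak) solution of the stochastic localization equation, driven by the
  \<open>F\<close>-Wiener process \<open>B\<close>. The noise is additive, so the integrated form of the equation involves
  no stochastic integral.\<close>

definition tilt_process ::
    "('a::euclidean_space \<Rightarrow> real) \<Rightarrow> 'w measure \<Rightarrow> (real \<Rightarrow> 'w measure) \<Rightarrow>
     (real \<Rightarrow> 'w \<Rightarrow> 'a) \<Rightarrow> (real \<Rightarrow> 'w \<Rightarrow> 'a) \<Rightarrow> bool" where
  "tilt_process \<pi>0 M F B c \<longleftrightarrow>
     wiener_process M F {0..} B \<and>
     (\<forall>t\<ge>0. c t \<in> F t \<rightarrow>\<^sub>M borel) \<and>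
     (\<forall>\<omega>\<in>space M. continuous_on {0..} (\<lambda>t. c t \<omega>)) \<and>
     (AE \<omega> in M. c 0 \<omega> = 0) \<and>
     (AE \<omega> in M. \<forall>t\<ge>0.
        set_integrable lborel {0..t} (\<lambda>s. tilted_mean \<pi>0 s (c s \<omega>)) \<and>
        c t \<omega> = (LINT s:{0..t}|lborel. tilted_mean \<pi>0 s (c s \<omega>)) + B t \<omega>)"

text \<open>Existence and uniqueness in law. Quantifying over laws on the canonical path space only is
  no restriction: the driving Wiener process is a functional of \<open>c\<close>, so the law of a solution
  on an arbitrary probability space makes the coordinate process a solution.\<close>

definition tilt_law ::
    "('a::euclidean_space \<Rightarrow> real) \<Rightarrow> (real \<Rightarrow> 'a) measure \<Rightarrow> bool" where
  "tilt_law \<pi>0 Q \<longleftrightarrow>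
     sets Q = sets (path_space {0..}) \<and> (\<exists>F B. tilt_process \<pi>0 Q F B (\<lambda>t w. w t))"

definition tilt_well_posed :: "('a::euclidean_space \<Rightarrow> real) \<Rightarrow> bool" where
  "tilt_well_posed \<pi>0 \<longleftrightarrow> (\<exists>!Q. tilt_law \<pi>0 Q)"

end

theory Submission
  imports Defs
begin

text \<open>
  By Gibbs' inequality the optimal bridge is the Wiener measure reweighted by the density of
  \<open>\<pi>0\<close> relative to \<open>N(0, I)\<close> at the terminal point; uniqueness of the minimizer is all that is
  used, so the case of infinite relative entropy needs no separate treatment. Since Wiener
  increments are independent of the past, the conditional law of the terminal value given the path
  up to time \<open>\<tau>\<close> is an explicit Gaussian reweighting of \<open>\<pi>0\<close>, which after the time change is the
  tilted measure.

  Let \<open>c\<close> be the time-changed bridge and \<open>X\<close> its terminal value. Given the past of \<open>c\<close> and \<open>X\<close>, the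
  increment of \<open>c\<close> over a time span \<open>h\<close> is \<open>N(h X, h I)\<close>, and the conditional mean of \<open>X\<close> is the
  tilted mean \<open>m\<close>. Hence \<open>c\<close> minus the integral of \<open>m\<close> is a Wiener process: conditional characteristic
  functions of its increments are computed along fine partitions, the error being \<open>o(h)\<close> per step
  because the conditional means are uniformly integrable. So \<open>c\<close> solves the
  stochastic localization equation, and uniqueness in law identifies it with the tilt process.
\<close>

section \<open>Gaussian densities\<close>

text \<open>Only a first moment of \<open>\<pi>0\<close> is at hand, so the conditional mean
  \<open>m\<close> may fail to be square integrable, and its time integral cannot simply be squared
  in a Taylor expansion. Over a step of length h, let \<Gamma> be bounded and measurable with
  respect to the past. To first order in h, the increment of \<open>c\<close> contributes i h
  E(\<Gamma> (\<theta> \<bullet> X)) besides the Gaussian factor, and the drift contributes the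
  negative of this, because every \<open>m s\<close> with s in the step has the same expectation
  against \<Gamma> as X. What is left is a second-order remainder in the drift and a cross term
  between drift and increment. For these, \<open>m\<close> is split at a level K: the bounded part
  has size h K and is expanded to second order, the part above K is estimated to first order only
  and has mean at most h \<epsilon>. K is fixed before h tends to 0.\<close>

lemma power2_norm_eq_sum_Basis: "(norm x)\<^sup>2 = (\<Sum>b\<in>Basis. (x \<bullet> b)\<^sup>2)"
  by (subst power2_norm_eq_inner, subst euclidean_inner) (simp add: power2_eq_square)

lemma gaussian_density_norm:
  fixes x :: "'a::euclidean_space"
  shows "gaussian_density s x = (1 / sqrt (2 * pi * s\<^sup>2)) ^ DIM('a) * exp (- (norm x)\<^sup>2 / (2 * s\<^sup>2))"
proof -
  have "gaussian_density s x = (\<Prod>b\<in>Basis. 1 / sqrt (2 * pi * s\<^sup>2) * exp (- (x \<bullet> b)\<^sup>2 / (2 * s\<^sup>2)))"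
    by (simp only: gaussian_density_def normal_density_def diff_zero)
  also have "\<dots> = (\<Prod>b\<in>(Basis::'a set). 1 / sqrt (2 * pi * s\<^sup>2)) * (\<Prod>b\<in>Basis. exp (- (x \<bullet> b)\<^sup>2 / (2 * s\<^sup>2)))"
    by (rule prod.distrib)
  also have "(\<Prod>b\<in>(Basis::'a set). 1 / sqrt (2 * pi * s\<^sup>2)) = (1 / sqrt (2 * pi * s\<^sup>2)) ^ DIM('a)"
    by simp
  also have "(\<Prod>b\<in>Basis. exp (- (x \<bullet> b)\<^sup>2 / (2 * s\<^sup>2))) = exp (\<Sum>b\<in>Basis. - (x \<bullet> b)\<^sup>2 / (2 * s\<^sup>2))"
    by (simp add: exp_sum)
  also have "(\<Sum>b\<in>Basis. - (x \<bullet> b)\<^sup>2 / (2 * s\<^sup>2)) = - (norm x)\<^sup>2 / (2 * s\<^sup>2)"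
    unfolding power2_norm_eq_sum_Basis by (simp add: sum_divide_distrib sum_negf)
  finally show ?thesis .
qed

lemma gaussian_density_nonneg: "0 \<le> gaussian_density s x"
  by (simp add: gaussian_density_norm)

lemma gaussian_density_pos: "0 < s \<Longrightarrow> 0 < gaussian_density s x"
  by (simp add: gaussian_density_norm)

lemma gaussian_density_measurable [measurable]:
  "gaussian_density s \<in> borel_measurable borel"
  unfolding gaussian_density_norm[abs_def] by measurable

text \<open>\<open>lborel\<close> is the image of the product of one-dimensional Lebesgue measures
  under the map that assembles coordinates, so this is Fubini for finite products. The values lie in
  a general normed field because both real densities and complex Fourier integrands are factored in
  this way.\<close>

lemma
  fixes f :: "'a::euclidean_space \<Rightarrow> real \<Rightarrow> 'b::{real_normed_field,banach,second_countable_topology}"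
  assumes f: "\<And>b. b \<in> Basis \<Longrightarrow> integrable lborel (f b)"
  shows integrable_lborel_prod: "integrable lborel (\<lambda>x. \<Prod>b\<in>Basis. f b (x \<bullet> b))"
    and integral_lborel_prod:
      "(\<integral>x. (\<Prod>b\<in>Basis. f b (x \<bullet> b)) \<partial>lborel) = (\<Prod>b\<in>Basis. \<integral>x. f b x \<partial>lborel)"
proof -
  interpret product_sigma_finite "\<lambda>_::'a. lborel :: real measure" ..
  have m: "(\<lambda>x. \<Prod>b\<in>Basis. f b (x \<bullet> b)) \<in> borel_measurable borel"
    using borel_measurable_integrable[OF f] by (intro borel_measurable_prod) simp
  have m': "(\<lambda>g. \<Sum>b\<in>Basis. g b *\<^sub>R b) \<in> (\<Pi>\<^sub>M b\<in>(Basis::'a set). (lborel::real measure)) \<rightarrow>\<^sub>M borel"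
    by measurable
  have eq: "(\<Prod>b\<in>Basis. f b ((\<Sum>b'\<in>Basis. g b' *\<^sub>R b') \<bullet> b)) = (\<Prod>b\<in>Basis. f b (g b))" for g
    by (intro prod.cong refl) (simp add: inner_sum_left inner_Basis if_distrib cong: if_cong)
  show "integrable lborel (\<lambda>x. \<Prod>b\<in>Basis. f b (x \<bullet> b))"
    apply (subst lborel_eq, subst integrable_distr_eq[OF m' m])
    unfolding eq by (intro product_integrable_prod f) auto
  show "(\<integral>x. (\<Prod>b\<in>Basis. f b (x \<bullet> b)) \<partial>lborel) = (\<Prod>b\<in>Basis. \<integral>x. f b x \<partial>lborel)"
    apply (subst lborel_eq, subst integral_distr[OF m' m])
    unfolding eq by (intro product_integral_prod f) auto
qed

lemma integrable_gaussian_density: "0 < s \<Longrightarrow> integrable lborel (gaussian_density s)"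
  unfolding gaussian_density_def[abs_def] by (intro integrable_lborel_prod) auto

lemma integral_gaussian_density: "0 < s \<Longrightarrow> (\<integral>x. gaussian_density s x \<partial>lborel) = 1"
  unfolding gaussian_density_def by (subst integral_lborel_prod) auto

lemma nn_integral_gaussian_density:
  "0 < s \<Longrightarrow> (\<integral>\<^sup>+x. ennreal (gaussian_density s x) \<partial>lborel) = 1"
  by (subst nn_integral_eq_integral)
     (auto simp: integrable_gaussian_density integral_gaussian_density gaussian_density_nonneg)

lemma prob_space_gaussian:
  "0 < s \<Longrightarrow> prob_space (density lborel (\<lambda>x::'a::euclidean_space. ennreal (gaussian_density s x)))"
  by (intro prob_spaceI) (simp add: emeasure_density nn_integral_gaussian_density)

text \<open>The substitution of \<open>s * x\<close> for \<open>x\<close> reduces this to the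
  characteristic function of the standard normal distribution.\<close>

lemma normal_density_fourier:
  fixes t s :: real assumes s: "0 < s"
  shows "(\<integral>x. iexp (t * x) * complex_of_real (normal_density 0 s x) \<partial>lborel)
      = complex_of_real (exp (- (s\<^sup>2 * t\<^sup>2) / 2))"
proof -
  have "complex_of_real (exp (- (s * t)\<^sup>2 / 2)) = char std_normal_distribution (s * t)"
    by (simp add: char_std_normal_distribution)
  also have "\<dots> = (CLINT x|lborel. std_normal_density x *\<^sub>R iexp (s * t * x))"
    unfolding char_def by (subst integral_density) auto
  finally have 1: "(CLINT x|lborel. std_normal_density x *\<^sub>R iexp (s * t * x))
      = complex_of_real (exp (- (s * t)\<^sup>2 / 2))" by simp
  have "(\<integral>x. iexp (t * x) * complex_of_real (normal_density 0 s x) \<partial>lborel)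
     = \<bar>s\<bar> *\<^sub>R (\<integral>x. iexp (t * (0 + s * x)) * complex_of_real (normal_density 0 s (0 + s * x)) \<partial>lborel)"
    using s by (intro lborel_integral_real_affine) auto
  also have "\<dots> = (CLINT x|lborel. std_normal_density x *\<^sub>R iexp (s * t * x))"
    apply (subst integral_scaleR_right[symmetric])
    using s by (intro Bochner_Integration.integral_cong refl)
      (auto simp: normal_density_def scaleR_conv_of_real real_sqrt_mult field_simps power2_eq_square simp flip: of_real_mult)
  finally show ?thesis using 1 by (simp add: power_mult_distrib)
qed

lemma gaussian_fourier:
  fixes t :: "'a::euclidean_space" assumes s: "0 < s"
  shows "(\<integral>x. iexp (t \<bullet> x) * complex_of_real (gaussian_density s x) \<partial>lborel)
      = complex_of_real (exp (- (s\<^sup>2 * (norm t)\<^sup>2) / 2))"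
proof -
  have *: "iexp (t \<bullet> x) * complex_of_real (gaussian_density s x)
     = (\<Prod>b\<in>Basis. iexp ((t \<bullet> b) * (x \<bullet> b)) * complex_of_real (normal_density 0 s (x \<bullet> b)))" for x
    by (subst euclidean_inner)
       (simp add: gaussian_density_def prod.distrib exp_sum sum_distrib_left flip: of_real_prod)
  have int: "integrable lborel (\<lambda>x. iexp (r * x) * complex_of_real (normal_density 0 s x))" for r
    by (rule Bochner_Integration.integrable_bound[OF integrable_normal_density[OF s, of 0]])
       (simp_all add: norm_mult)
  have "(\<integral>x. iexp (t \<bullet> x) * complex_of_real (gaussian_density s x) \<partial>lborel)
     = (\<Prod>b\<in>Basis. \<integral>x. iexp ((t \<bullet> b) * x) * complex_of_real (normal_density 0 s x) \<partial>lborel)"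
    unfolding * by (intro integral_lborel_prod int)
  also have "\<dots> = (\<Prod>b\<in>Basis. complex_of_real (exp (- (s\<^sup>2 * (t \<bullet> b)\<^sup>2) / 2)))"
    by (simp only: normal_density_fourier[OF s])
  also have "\<dots> = complex_of_real (exp (\<Sum>b\<in>Basis. - (s\<^sup>2 * (t \<bullet> b)\<^sup>2) / 2))"
    by (simp add: exp_sum)
  also have "(\<Sum>b\<in>Basis. - (s\<^sup>2 * (t \<bullet> b)\<^sup>2) / 2) = - (s\<^sup>2 * (norm t)\<^sup>2) / 2"
    unfolding power2_norm_eq_sum_Basis by (simp add: sum_distrib_left sum_divide_distrib sum_negf)
  finally show ?thesis .
qed

text \<open>The last factor is the conditional (bridge) density of the first summand given the sum.\<close>

lemma gaussian_density_bridge: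
  fixes a y :: "'a::euclidean_space"
  assumes pos: "0 < p" "0 < q"
  shows "gaussian_density (sqrt p) a * gaussian_density (sqrt q) (y - a)
    = gaussian_density (sqrt (p + q)) y
      * gaussian_density (sqrt (p * q / (p + q))) (a - (p / (p + q)) *\<^sub>R y)"
proof -
  have 1: "normal_density 0 (sqrt p) a * normal_density 0 (sqrt q) (y - a)
    = normal_density 0 (sqrt (p + q)) y
      * normal_density 0 (sqrt (p * q / (p + q))) (a - (p / (p + q)) * y)" for a y :: real
  proof -
    \<comment> \<open>Completing the square in \<open>a\<close>: the sum of the two quadratic terms
      is minimal at \<open>p / (p + q) * y\<close>.\<close>
    have e: "-(a\<^sup>2 / (2 * p)) - (y - a)\<^sup>2 / (2 * q)
        = - (y\<^sup>2 / (2 * (p + q))) - (a - (p / (p + q)) * y)\<^sup>2 / (2 * (p * q / (p + q)))"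
    proof -
      have pq: "p + q \<noteq> 0" using pos by simp
      have "(a - (p / (p + q)) * y)\<^sup>2 / (2 * (p * q / (p + q))) = (a * (p + q) - p * y)\<^sup>2 / (2 * p * q * (p + q))"
      proof -
        have "a - (p / (p + q)) * y = (a * (p + q) - p * y) / (p + q)"
          using pq by (simp add: field_simps)
        then show ?thesis using pos pq by (simp add: power_divide power2_eq_square)
      qed
      moreover have "a\<^sup>2 / (2 * p) + (y - a)\<^sup>2 / (2 * q)
          = y\<^sup>2 / (2 * (p + q)) + (a * (p + q) - p * y)\<^sup>2 / (2 * p * q * (p + q))"
      proof -
        have "a\<^sup>2 / (2 * p) + (y - a)\<^sup>2 / (2 * q)
          = (a\<^sup>2 * q * (p + q) + (y - a)\<^sup>2 * p * (p + q)) / (2 * p * q * (p + q))"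
          using pos pq by (simp add: add_divide_distrib)
        also have "a\<^sup>2 * q * (p + q) + (y - a)\<^sup>2 * p * (p + q) = y\<^sup>2 * p * q + (a * (p + q) - p * y)\<^sup>2"
          by (simp add: power2_eq_square algebra_simps)
        also have "(y\<^sup>2 * p * q + (a * (p + q) - p * y)\<^sup>2) / (2 * p * q * (p + q))
           = y\<^sup>2 / (2 * (p + q)) + (a * (p + q) - p * y)\<^sup>2 / (2 * p * q * (p + q))"
          using pos pq by (simp add: add_divide_distrib)
        finally show ?thesis .
      qed
      ultimately show ?thesis by simp
    qed
    \<comment> \<open>The variances \<open>p + q\<close> and \<open>p * q / (p + q)\<close> have
      product \<open>p * q\<close>, so the normalising constants match.\<close>
    have s: "sqrt (2 * pi * p) * sqrt (2 * pi * q) = sqrt (2 * pi * (p + q)) * sqrt (2 * pi * (p * q / (p + q)))"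
      using pos by (simp add: real_sqrt_mult[symmetric])
    have nd: "normal_density 0 (sqrt r) z = 1 / sqrt (2 * pi * r) * exp (- (z\<^sup>2 / (2 * r)))"
      if "0 < r" for r z :: real
      using that by (simp add: normal_density_def)
    have mul: "1 / c * exp u * (1 / d * exp v) = 1 / (c * d) * exp (u + v)" for c d u v :: real
      by (simp add: exp_add)
    have "0 < p * q / (p + q)" "0 < p + q" using pos by auto
    then show ?thesis
      unfolding nd[OF pos(1)] nd[OF pos(2)] nd[OF \<open>0 < p + q\<close>] nd[OF \<open>0 < p * q / (p + q)\<close>] mul s
      using e by (simp only: minus_diff_eq diff_conv_add_uminus)
  qed
  show ?thesis
    unfolding gaussian_density_def prod.distrib[symmetric]
    by (intro prod.cong refl) (use 1 in \<open>simp add: inner_diff_left\<close>)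
qed

section \<open>Characteristic functions determine finite measures\<close>

text \<open>The substitution x = y + s z moves the width \<open>s\<close> from the measure into the
  argument of \<open>f\<close>, so that a limit in \<open>s\<close> can be taken under a fixed
  measure.\<close>

lemma nn_integral_gaussian_shift:
  fixes f :: "'a::euclidean_space \<Rightarrow> ennreal"
  assumes s: "0 < s" and [measurable]: "f \<in> borel_measurable borel"
  shows "(\<integral>\<^sup>+x. f x * ennreal (gaussian_density s (x - y)) \<partial>lborel)
    = (\<integral>\<^sup>+z. f (y + s *\<^sub>R z) \<partial>density lborel (\<lambda>z. ennreal (gaussian_density 1 z)))"
proof -
  have g: "s ^ DIM('a) * gaussian_density s (s *\<^sub>R z) = gaussian_density 1 z" for z :: 'a
    using s by (simp add: gaussian_density_norm real_sqrt_mult power_divide power_mult_distrib)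
  have "(\<integral>\<^sup>+x. f x * ennreal (gaussian_density s (x - y)) \<partial>lborel)
     = (\<integral>\<^sup>+z. ennreal (s ^ DIM('a)) * (f (y + s *\<^sub>R z) * ennreal (gaussian_density s (s *\<^sub>R z))) \<partial>lborel)"
    using s by (subst lborel_affine[of s y])
      (auto simp: nn_integral_density nn_integral_distr nn_integral_cmult)
  also have "\<dots> = (\<integral>\<^sup>+z. ennreal (gaussian_density 1 z) * f (y + s *\<^sub>R z) \<partial>lborel)"
    unfolding g[symmetric] using s
    by (intro nn_integral_cong) (simp add: ennreal_mult gaussian_density_nonneg ac_simps)
  finally show ?thesis by (simp add: nn_integral_density)
qed

text \<open>Fourier inversion in disguise: up to the constant \<open>C\<close>, the Gaussian kernel
  is the Fourier transform of an integrable Gaussian, so by Fubini smoothing a measure with it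
  involves only the characteristic function of the measure.\<close>

lemma gaussian_smoothing_eq:
  fixes M N :: "'a::euclidean_space measure"
  assumes "finite_measure M" "finite_measure N"
    and [measurable_cong]: "sets M = sets borel" "sets N = sets borel"
    and char: "\<And>t. (\<integral>x. iexp (t \<bullet> x) \<partial>M) = (\<integral>x. iexp (t \<bullet> x) \<partial>N)"
    and s: "0 < s"
  shows "(\<integral>\<^sup>+y. ennreal (gaussian_density s (x - y)) \<partial>M) = (\<integral>\<^sup>+y. ennreal (gaussian_density s (x - y)) \<partial>N)"
proof -
  define C where "C = (1 / sqrt (2 * pi * s\<^sup>2)) ^ DIM('a)"
  \<comment> \<open>Widths are inverted by the Fourier transform: the density of width
    \<open>1 / s\<close> produces the kernel of width \<open>s\<close>, without its normalising
    constant.\<close>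
  have F: "complex_of_real (exp (- (norm z)\<^sup>2 / (2 * s\<^sup>2)))
    = (\<integral>t. iexp (z \<bullet> t) * complex_of_real (gaussian_density (1 / s) t) \<partial>lborel)" for z :: 'a
    using gaussian_fourier[of "1 / s" z] s by (simp add: power_divide)
  have *: "complex_of_real (\<integral>y. exp (- (norm (x - y))\<^sup>2 / (2 * s\<^sup>2)) \<partial>K)
      = (\<integral>t. iexp (t \<bullet> x) * complex_of_real (gaussian_density (1 / s) t) * (\<integral>y. iexp (- t \<bullet> y) \<partial>K) \<partial>lborel)"
    if K: "finite_measure K" and sK[measurable_cong]: "sets K = sets borel" for K :: "'a measure"
  proof -
    interpret K: finite_measure K by fact
    interpret pair_sigma_finite K "lborel :: 'a measure" ..
    have "integrable (K \<Otimes>\<^sub>M lborel) (\<lambda>(y,t). gaussian_density (1 / s) t :: real)"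
      using integrable_gaussian_density[of "1 / s", where ?'a='a] s
      by (subst integrable_iff_bounded) (auto simp: split_beta' K.emeasure_eq_measure lborel.nn_integral_fst[symmetric] nn_integral_gaussian_density gaussian_density_nonneg)
    then have int: "integrable (K \<Otimes>\<^sub>M lborel)
        (\<lambda>(y,t). iexp ((x - y) \<bullet> t) * complex_of_real (gaussian_density (1 / s) t))"
      by (rule Bochner_Integration.integrable_bound) (auto simp: norm_mult split_beta')
    have "complex_of_real (\<integral>y. exp (- (norm (x - y))\<^sup>2 / (2 * s\<^sup>2)) \<partial>K)
      = (\<integral>y. (\<integral>t. iexp ((x - y) \<bullet> t) * complex_of_real (gaussian_density (1 / s) t) \<partial>lborel) \<partial>K)"
      unfolding F[symmetric] by (rule integral_complex_of_real[symmetric])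
    also have "\<dots> = (\<integral>t. (\<integral>y. iexp ((x - y) \<bullet> t) * complex_of_real (gaussian_density (1 / s) t) \<partial>K) \<partial>lborel)"
      using Fubini_integral[OF int] by simp
    also have "\<dots> = (\<integral>t. (\<integral>y. (iexp (t \<bullet> x) * complex_of_real (gaussian_density (1 / s) t)) * iexp (- t \<bullet> y) \<partial>K) \<partial>lborel)"
    proof -
      have "iexp ((x - y) \<bullet> t) = iexp (t \<bullet> x) * iexp (- t \<bullet> y)" for y t
        unfolding exp_add[symmetric] by (simp add: inner_diff_left inner_commute algebra_simps)
      then show ?thesis by (simp add: ac_simps)
    qed
    finally show ?thesis by simp
  qed
  have "complex_of_real (\<integral>y. exp (- (norm (x - y))\<^sup>2 / (2 * s\<^sup>2)) \<partial>M)
     = complex_of_real (\<integral>y. exp (- (norm (x - y))\<^sup>2 / (2 * s\<^sup>2)) \<partial>N)"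
    by (simp only: *[OF assms(1,3)] *[OF assms(2,4)] char)
  then have eq: "(\<integral>y. exp (- (norm (x - y))\<^sup>2 / (2 * s\<^sup>2)) \<partial>M) = (\<integral>y. exp (- (norm (x - y))\<^sup>2 / (2 * s\<^sup>2)) \<partial>N)"
    by (simp only: of_real_eq_iff)
  have **: "(\<integral>\<^sup>+y. ennreal (gaussian_density s (x - y)) \<partial>K)
      = ennreal (C * (\<integral>y. exp (- (norm (x - y))\<^sup>2 / (2 * s\<^sup>2)) \<partial>K))"
    if K: "finite_measure K" and sK[measurable_cong]: "sets K = sets borel" for K :: "'a measure"
  proof -
    interpret K: finite_measure K by fact
    have "integrable K (\<lambda>y. exp (- (norm (x - y))\<^sup>2 / (2 * s\<^sup>2)))"
      by (rule K.integrable_const_bound[of _ 1]) auto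
    then show ?thesis
      unfolding gaussian_density_norm C_def[symmetric]
      by (subst nn_integral_eq_integral) (auto simp: C_def)
  qed
  show ?thesis
    by (simp only: **[OF assms(1,3)] **[OF assms(2,4)] eq)
qed

text \<open>With z standard Gaussian, the smoothed integral is that of
  \<open>f (y + s *\<^sub>R z)\<close> over a fixed product measure, where bounded convergence
  applies as s tends to 0.\<close>

lemma gaussian_smoothing_tendsto:
  fixes M :: "'a::euclidean_space measure" and f :: "'a \<Rightarrow> real"
  assumes "finite_measure M" and [measurable_cong]: "sets M = sets borel"
    and f: "continuous_on UNIV f" "\<And>x. f x \<in> {0..1}"
  shows "(\<lambda>n. \<integral>\<^sup>+x. ennreal (f x) * (\<integral>\<^sup>+y. ennreal (gaussian_density (1 / Suc n) (x - y)) \<partial>M) \<partial>lborel)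
    \<longlonglongrightarrow> (\<integral>\<^sup>+y. ennreal (f y) \<partial>M)"
proof -
  interpret finite_measure M by fact
  define G where "G = density lborel (\<lambda>z::'a. ennreal (gaussian_density 1 z))"
  interpret G: prob_space G unfolding G_def by (rule prob_space_gaussian) simp
  interpret pair_sigma_finite M G ..
  interpret L: pair_sigma_finite M "lborel :: 'a measure" ..
  have [measurable_cong]: "sets G = sets borel" by (simp add: G_def)
  have fm[measurable]: "f \<in> borel_measurable borel" using f(1) by (rule borel_measurable_continuous_onI)
  have eq: "(\<integral>\<^sup>+x. ennreal (f x) * (\<integral>\<^sup>+y. ennreal (gaussian_density s (x - y)) \<partial>M) \<partial>lborel)
    = (\<integral>\<^sup>+(y,z). ennreal (f (y + s *\<^sub>R z)) \<partial>(M \<Otimes>\<^sub>M G))" if s: "0 < s" for s :: real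
  proof -
    have "(\<integral>\<^sup>+x. ennreal (f x) * (\<integral>\<^sup>+y. ennreal (gaussian_density s (x - y)) \<partial>M) \<partial>lborel)
      = (\<integral>\<^sup>+x. (\<integral>\<^sup>+y. ennreal (f x) * ennreal (gaussian_density s (x - y)) \<partial>M) \<partial>lborel)"
      by (intro nn_integral_cong nn_integral_cmult[symmetric]) measurable
    also have "\<dots> = (\<integral>\<^sup>+y. (\<integral>\<^sup>+x. ennreal (f x) * ennreal (gaussian_density s (x - y)) \<partial>lborel) \<partial>M)"
      by (rule L.Fubini') measurable
    also have "\<dots> = (\<integral>\<^sup>+y. (\<integral>\<^sup>+z. ennreal (f (y + s *\<^sub>R z)) \<partial>G) \<partial>M)"
      unfolding G_def using s by (subst nn_integral_gaussian_shift) auto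
    also have "\<dots> = (\<integral>\<^sup>+(y,z). ennreal (f (y + s *\<^sub>R z)) \<partial>(M \<Otimes>\<^sub>M G))"
      by (subst G.nn_integral_fst[symmetric]) auto
    finally show ?thesis .
  qed
  have "(\<lambda>n. \<integral>\<^sup>+p. ennreal (f (fst p + (1 / Suc n) *\<^sub>R snd p)) \<partial>(M \<Otimes>\<^sub>M G)) \<longlonglongrightarrow> (\<integral>\<^sup>+p. ennreal (f (fst p)) \<partial>(M \<Otimes>\<^sub>M G))"
  proof (rule nn_integral_dominated_convergence[where w="\<lambda>_. 1"])
    have "emeasure (M \<Otimes>\<^sub>M G) (space (M \<Otimes>\<^sub>M G)) = emeasure M (space M) * emeasure G (space G)"
      by (simp add: space_pair_measure G.emeasure_pair_measure_Times)
    then show "(\<integral>\<^sup>+p. 1 \<partial>(M \<Otimes>\<^sub>M G)) < \<infinity>"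
      by (simp add: G.emeasure_space_1 emeasure_eq_measure)
    have "(\<lambda>n. f (fst p + (1 / Suc n) *\<^sub>R snd p)) \<longlonglongrightarrow> f (fst p)" for p :: "'a \<times> 'a"
    proof -
      have "(\<lambda>n. fst p + (1 / Suc n) *\<^sub>R snd p) \<longlonglongrightarrow> fst p + 0 *\<^sub>R snd p"
        by (intro tendsto_intros LIMSEQ_Suc[OF lim_1_over_n])
      then have "(\<lambda>n. fst p + (1 / Suc n) *\<^sub>R snd p) \<longlonglongrightarrow> fst p" by simp
      from continuous_on_tendsto_compose[OF f(1) this] show ?thesis by simp
    qed
    then show "AE p in M \<Otimes>\<^sub>M G. (\<lambda>n. ennreal (f (fst p + (1 / Suc n) *\<^sub>R snd p))) \<longlonglongrightarrow> ennreal (f (fst p))"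
      by (intro always_eventually allI tendsto_ennrealI)
  qed (use f(2) in \<open>auto simp: ennreal_le_1\<close>)
  moreover have "(\<integral>\<^sup>+p. ennreal (f (fst p)) \<partial>(M \<Otimes>\<^sub>M G)) = (\<integral>\<^sup>+y. ennreal (f y) \<partial>M)"
    by (subst G.nn_integral_fst[symmetric]) (auto simp: G.emeasure_space_1)
  ultimately show ?thesis
    by (simp add: eq split_beta')
qed

text \<open>Equal characteristic functions give equal Gaussian smoothings, hence in the limit equal
  integrals of continuous functions with values in \<open>{0..1}\<close>, hence equal values on
  closed sets, which generate the Borel sets and are stable under intersection.\<close>

theorem measure_eqI_char:
  fixes M N :: "'a::euclidean_space measure"
  assumes M: "finite_measure M" and N: "finite_measure N"
    and sM: "sets M = sets borel" and sN: "sets N = sets borel"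
    and char: "\<And>t. (\<integral>x. iexp (t \<bullet> x) \<partial>M) = (\<integral>x. iexp (t \<bullet> x) \<partial>N)"
  shows "M = N"
proof -
  interpret M: finite_measure M by fact
  interpret N: finite_measure N by fact
  note [measurable_cong] = sM sN
  have cont: "(\<integral>\<^sup>+y. ennreal (f y) \<partial>M) = (\<integral>\<^sup>+y. ennreal (f y) \<partial>N)"
    if f: "continuous_on UNIV f" "\<And>x. f x \<in> {0..1}" for f :: "'a \<Rightarrow> real"
  proof -
    have "(\<integral>\<^sup>+y. ennreal (gaussian_density (1 / Suc n) (x - y)) \<partial>M)
        = (\<integral>\<^sup>+y. ennreal (gaussian_density (1 / Suc n) (x - y)) \<partial>N)" for x n
      by (rule gaussian_smoothing_eq[OF M N sM sN char]) simp
    with gaussian_smoothing_tendsto[OF M sM f] gaussian_smoothing_tendsto[OF N sN f]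
    show ?thesis by (simp add: LIMSEQ_unique)
  qed
  have closed_eq: "emeasure M C = emeasure N C" if C: "closed C" for C
  \<comment> \<open>\<open>infdist\<close> to the empty set is 0, so for empty \<open>C\<close> the
    functions below would be constantly 1; that case is trivial and is split off.\<close>
  proof (cases "C = {}")
    case False
    \<comment> \<open>These functions decrease to the indicator of \<open>C\<close> as k grows:
      points outside a closed set have positive distance from it.\<close>
    define f where "f k x = max 0 (1 - real k * infdist x C)" for k x
    have f: "continuous_on UNIV (f k)" "f k x \<in> {0..1}" for k x
      unfolding f_def by (auto intro!: continuous_intros simp: infdist_nonneg)
    have lim: "(\<lambda>k. \<integral>\<^sup>+y. ennreal (f k y) \<partial>K) \<longlonglongrightarrow> emeasure K C"
      if K: "finite_measure K" and sK[measurable_cong]: "sets K = sets borel" for K :: "'a measure"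
    proof -
      interpret K: finite_measure K by fact
      have [measurable]: "f k \<in> borel_measurable borel" for k
        using f(1) by (rule borel_measurable_continuous_onI)
      have [measurable]: "C \<in> sets borel" using C by simp
      have "(\<lambda>k. f k y) \<longlonglongrightarrow> indicator C y" for y
      proof (cases "y \<in> C")
        case True then show ?thesis by (simp add: f_def)
      next
        case nC: False
        then have pos: "0 < infdist y C"
          using in_closed_iff_infdist_zero[OF C False] infdist_nonneg[of y C] by force
        obtain n where n: "1 / infdist y C < real n" using reals_Archimedean2 by blast
        have "f k y = 0" if "n \<le> k" for k
        proof -
          have "1 < real n * infdist y C" using n pos by (simp add: field_simps)
          also have "\<dots> \<le> real k * infdist y C" using that pos by (simp add: mult_right_mono)
          finally show ?thesis by (simp add: f_def)
        qed
        then have "\<forall>\<^sub>F k in sequentially. f k y = 0" by (auto simp: eventually_sequentially)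
        then show ?thesis using nC by (simp add: tendsto_eventually)
      qed
      then have "(\<lambda>k. \<integral>\<^sup>+y. ennreal (f k y) \<partial>K) \<longlonglongrightarrow> (\<integral>\<^sup>+y. ennreal (indicator C y) \<partial>K)"
        using f(2)
        by (intro nn_integral_dominated_convergence[where w="\<lambda>_. 1"])
           (auto intro!: tendsto_ennrealI simp: ennreal_le_1 K.emeasure_eq_measure)
      then show ?thesis by (simp add: ennreal_indicator)
    qed
    show ?thesis
      using lim[OF M sM] unfolding cont[OF f] by (rule LIMSEQ_unique[OF _ lim[OF N sN]])
  qed simp
  show ?thesis
  proof (rule measure_eqI_generator_eq[where E="Collect closed" and \<Omega>=UNIV and A="\<lambda>_. UNIV"])
    show "Int_stable (Collect closed :: 'a set set)" by (auto simp: Int_stable_def)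
    show "sets M = sigma_sets UNIV (Collect closed)" "sets N = sigma_sets UNIV (Collect closed)"
      using sM sN by (simp_all add: borel_eq_closed)
  qed (use closed_eq M.emeasure_finite in auto)
qed

section \<open>Gaussian increments independent of the past\<close>

definition gaussian_measure :: "real \<Rightarrow> 'a::euclidean_space measure" where
  "gaussian_measure s = density lborel (\<lambda>x. ennreal (gaussian_density s x))"

lemma sets_gaussian_measure [measurable_cong, simp]: "sets (gaussian_measure s) = sets borel"
  and space_gaussian_measure [simp]: "space (gaussian_measure s) = UNIV"
  by (simp_all add: gaussian_measure_def)

lemma prob_space_gaussian_measure: "0 < s \<Longrightarrow> prob_space (gaussian_measure s)"
  unfolding gaussian_measure_def by (rule prob_space_gaussian)

lemma nn_integral_gaussian_measure:
  "f \<in> borel_measurable borel \<Longrightarrow>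
    (\<integral>\<^sup>+x. f x \<partial>gaussian_measure s) = (\<integral>\<^sup>+x. ennreal (gaussian_density s x) * f x \<partial>lborel)"
  unfolding gaussian_measure_def by (rule nn_integral_density) auto

lemma integral_gaussian_measure:
  fixes f :: "_ \<Rightarrow> 'b::{banach, second_countable_topology}"
  shows "f \<in> borel_measurable borel \<Longrightarrow>
    (\<integral>x. f x \<partial>gaussian_measure s) = (\<integral>x. gaussian_density s x *\<^sub>R f x \<partial>lborel)"
  unfolding gaussian_measure_def by (rule integral_density) (auto simp: gaussian_density_nonneg)

lemma char_gaussian_measure:
  "0 < s \<Longrightarrow> (\<integral>x. iexp (t \<bullet> x) \<partial>gaussian_measure s) = complex_of_real (exp (- (s\<^sup>2 * (norm t)\<^sup>2) / 2))"
  using gaussian_fourier[of s t]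
  by (subst integral_gaussian_measure) (simp_all add: scaleR_conv_of_real mult.commute)

text \<open>One product formula in place of two clauses of \<open>wiener_process\<close>, the
  Gaussian law of an increment and its independence of the past. In this form it is both ready for
  Fubini and what an equality of finite measures in \<open>D\<close> delivers.\<close>

definition gaussian_indep ::
    "'w measure \<Rightarrow> 'w measure \<Rightarrow> ('w \<Rightarrow> 'a::euclidean_space) \<Rightarrow> real \<Rightarrow> bool" where
  "gaussian_indep M F Y s \<longleftrightarrow> Y \<in> M \<rightarrow>\<^sub>M borel \<and>
     (\<forall>A\<in>sets F. \<forall>D\<in>sets borel.
        emeasure M (A \<inter> (Y -` D \<inter> space M)) = emeasure M A * emeasure (gaussian_measure s) D)"

text \<open>Taking the whole space for \<open>A\<close> recovers the law of \<open>Y\<close>; once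
  that is known, the product formula is independence, since the sets generated by \<open>Y\<close>
  are exactly its preimages of Borel sets.\<close>

lemma gaussian_indep_iff:
  fixes Y :: "'w \<Rightarrow> 'a::euclidean_space"
  assumes "prob_space M" and sub: "subalgebra M F" and s: "0 < s"
  shows "gaussian_indep M F Y s \<longleftrightarrow>
     distributed M lborel Y (\<lambda>x. ennreal (gaussian_density s x)) \<and>
     prob_space.indep_set M (sets F) (sets (vimage_algebra (space M) Y borel))" (is "_ \<longleftrightarrow> ?R")
proof -
  interpret prob_space M by fact
  interpret G: prob_space "gaussian_measure s :: 'a measure" using s by (rule prob_space_gaussian_measure)
  have subs: "sets F \<subseteq> sets M" "space F = space M" using sub by (auto simp: subalgebra_def)
  have sv: "sets (vimage_algebra (space M) Y borel) = {Y -` D \<inter> space M | D. D \<in> sets borel}"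
    by (rule sets_vimage_algebra2) auto
  show ?thesis
  proof
    assume *: "gaussian_indep M F Y s"
    then have [measurable]: "Y \<in> M \<rightarrow>\<^sub>M borel" by (simp add: gaussian_indep_def)
    have ind: "emeasure M (A \<inter> (Y -` D \<inter> space M)) = emeasure M A * emeasure (gaussian_measure s) D"
      if "A \<in> sets F" "D \<in> sets borel" for A D using * that by (auto simp: gaussian_indep_def)
    have d: "emeasure M (Y -` D \<inter> space M) = emeasure (gaussian_measure s) D" if "D \<in> sets borel" for D
      using ind[of "space M" D] that subs sets.top[of F] by (simp add: emeasure_space_1 Int_absorb1)
    have "distr M lborel Y = gaussian_measure s"
      by (rule measure_eqI) (auto simp: emeasure_distr d)
    then have "distributed M lborel Y (\<lambda>x. ennreal (gaussian_density s x))"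
      by (auto simp: distributed_def gaussian_measure_def)
    moreover have "indep_set (sets F) (sets (vimage_algebra (space M) Y borel))"
      unfolding indep_sets2_eq sv
    proof safe
      fix A D assume "A \<in> sets F" and D: "D \<in> sets (borel :: 'a measure)"
      then show "prob (A \<inter> (Y -` D \<inter> space M)) = prob A * prob (Y -` D \<inter> space M)"
        using ind[of A D] d[of D] by (simp add: emeasure_eq_measure G.emeasure_eq_measure flip: ennreal_mult)
    qed (use subs in auto)
    ultimately show ?R by simp
  next
    assume R: ?R
    then have [measurable]: "Y \<in> M \<rightarrow>\<^sub>M borel" by (auto simp: distributed_def)
    have "emeasure M (A \<inter> (Y -` D \<inter> space M)) = emeasure M A * emeasure (gaussian_measure s) D"
      if A: "A \<in> sets F" and D: "D \<in> sets borel" for A D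
    proof -
      have "emeasure (gaussian_measure s) D = emeasure (distr M lborel Y) D"
        using R by (simp add: distributed_def gaussian_measure_def)
      also have "\<dots> = emeasure M (Y -` D \<inter> space M)" using D by (simp add: emeasure_distr)
      finally have "emeasure (gaussian_measure s) D = emeasure M (Y -` D \<inter> space M)" .
      moreover have "prob (A \<inter> (Y -` D \<inter> space M)) = prob A * prob (Y -` D \<inter> space M)"
        using R[THEN conjunct2] A D unfolding indep_sets2_eq sv by blast
      ultimately show ?thesis
        by (simp add: emeasure_eq_measure flip: ennreal_mult)
    qed
    then show "gaussian_indep M F Y s" by (auto simp: gaussian_indep_def)
  qed
qed

text \<open>The product formula on rectangles determines the joint law of \<open>Y\<close> and of
  the sample point as seen by \<open>F\<close>.\<close>

lemma gaussian_indep_distr: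
  fixes Y :: "'w \<Rightarrow> 'a::euclidean_space"
  assumes "prob_space M" and sub: "subalgebra M F" and s: "0 < s" and Y: "gaussian_indep M F Y s"
  shows "distr M (F \<Otimes>\<^sub>M borel) (\<lambda>w. (w, Y w)) = restr_to_subalg M F \<Otimes>\<^sub>M gaussian_measure s"
proof -
  interpret prob_space M by fact
  interpret G: prob_space "gaussian_measure s :: 'a measure" using s by (rule prob_space_gaussian_measure)
  interpret R: prob_space "restr_to_subalg M F" by (rule prob_space_restr_to_subalg[OF sub prob_space_axioms])
  have subs: "sets F \<subseteq> sets M" "space F = space M" using sub by (auto simp: subalgebra_def)
  have [measurable]: "Y \<in> M \<rightarrow>\<^sub>M borel" using Y by (simp add: gaussian_indep_def)
  have [measurable]: "(\<lambda>w. w) \<in> M \<rightarrow>\<^sub>M F" by (rule measurable_from_subalg[OF sub]) simp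
  show ?thesis
  proof (rule sym, rule pair_measure_eqI)
    show "sets (restr_to_subalg M F \<Otimes>\<^sub>M gaussian_measure s) = sets (distr M (F \<Otimes>\<^sub>M borel) (\<lambda>w. (w, Y w)))"
      by (simp add: sets_restr_to_subalg[OF sub] cong: sets_pair_measure_cong)
    fix A D assume "A \<in> sets (restr_to_subalg M F)" "D \<in> sets (gaussian_measure s :: 'a measure)"
    then have AD: "A \<in> sets F" "D \<in> sets borel" by (auto simp: sets_restr_to_subalg[OF sub])
    then have "(\<lambda>w. (w, Y w)) -` (A \<times> D) \<inter> space M = A \<inter> (Y -` D \<inter> space M)"
      using subs sets.sets_into_space[of A F] by auto
    then show "emeasure (restr_to_subalg M F) A * emeasure (gaussian_measure s) D
        = emeasure (distr M (F \<Otimes>\<^sub>M borel) (\<lambda>w. (w, Y w))) (A \<times> D)"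
      using AD Y by (simp add: emeasure_distr emeasure_restr_to_subalg[OF sub] gaussian_indep_def)
  qed unfold_locales
qed

text \<open>Fubini for the joint law: the \<open>F\<close>-measurable argument is frozen while the
  increment is integrated out.\<close>

lemma nn_integral_gaussian_indep:
  fixes Y :: "'w \<Rightarrow> 'a::euclidean_space"
  assumes M: "prob_space M" and sub: "subalgebra M F" and s: "0 < s" and Y: "gaussian_indep M F Y s"
    and f[measurable]: "f \<in> borel_measurable (F \<Otimes>\<^sub>M borel)"
  shows "(\<integral>\<^sup>+w. f (w, Y w) \<partial>M) = (\<integral>\<^sup>+w. (\<integral>\<^sup>+y. f (w, y) \<partial>gaussian_measure s) \<partial>M)"
proof -
  interpret prob_space M by fact
  interpret G: prob_space "gaussian_measure s :: 'a measure" using s by (rule prob_space_gaussian_measure)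
  have [measurable]: "Y \<in> M \<rightarrow>\<^sub>M borel" using Y by (simp add: gaussian_indep_def)
  have [measurable]: "(\<lambda>w. w) \<in> M \<rightarrow>\<^sub>M F" by (rule measurable_from_subalg[OF sub]) simp
  have [measurable_cong]: "sets (restr_to_subalg M F) = sets F" by (rule sets_restr_to_subalg[OF sub])
  have "(\<integral>\<^sup>+w. f (w, Y w) \<partial>M) = (\<integral>\<^sup>+p. f p \<partial>distr M (F \<Otimes>\<^sub>M borel) (\<lambda>w. (w, Y w)))"
    by (simp add: nn_integral_distr)
  also have "\<dots> = (\<integral>\<^sup>+w. (\<integral>\<^sup>+y. f (w, y) \<partial>gaussian_measure s) \<partial>restr_to_subalg M F)"
    unfolding gaussian_indep_distr[OF M sub s Y] by (rule G.nn_integral_fst[symmetric]) measurable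
  also have "\<dots> = (\<integral>\<^sup>+w. (\<integral>\<^sup>+y. f (w, y) \<partial>gaussian_measure s) \<partial>M)"
    by (rule nn_integral_subalgebra2[OF sub]) measurable
  finally show ?thesis .
qed

lemma
 fixes Y :: "'w \<Rightarrow> 'a::euclidean_space"
    and f :: "_ \<Rightarrow> 'b::{banach, second_countable_topology}"
  assumes M: "prob_space M" and sub: "subalgebra M F" and s: "0 < s" and Y: "gaussian_indep M F Y s"
    and f[measurable]: "f \<in> borel_measurable (F \<Otimes>\<^sub>M borel)" and int: "integrable M (\<lambda>w. f (w, Y w))"
  shows integral_gaussian_indep:
      "(\<integral>w. f (w, Y w) \<partial>M) = (\<integral>w. (\<integral>y. f (w, y) \<partial>gaussian_measure s) \<partial>M)"
    and integrable_gaussian_indep: "integrable M (\<lambda>w. \<integral>y. f (w, y) \<partial>gaussian_measure s)"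
proof -
  interpret prob_space M by fact
  interpret G: prob_space "gaussian_measure s :: 'a measure" using s by (rule prob_space_gaussian_measure)
  interpret R: prob_space "restr_to_subalg M F" by (rule prob_space_restr_to_subalg[OF sub prob_space_axioms])
  interpret pair_sigma_finite "restr_to_subalg M F" "gaussian_measure s :: 'a measure" ..
  have [measurable]: "Y \<in> M \<rightarrow>\<^sub>M borel" using Y by (simp add: gaussian_indep_def)
  have [measurable]: "(\<lambda>w. w) \<in> M \<rightarrow>\<^sub>M F" by (rule measurable_from_subalg[OF sub]) simp
  have [measurable_cong]: "sets (restr_to_subalg M F) = sets F" by (rule sets_restr_to_subalg[OF sub])
  have int': "integrable (restr_to_subalg M F \<Otimes>\<^sub>M gaussian_measure s) f"
    unfolding gaussian_indep_distr[OF M sub s Y, symmetric] using int by (subst integrable_distr_eq) auto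
  show "integrable M (\<lambda>w. \<integral>y. f (w, y) \<partial>gaussian_measure s)"
    by (rule integrable_from_subalg[OF sub integrable_fst'[OF int']])
  have "(\<integral>w. f (w, Y w) \<partial>M) = (\<integral>p. f p \<partial>distr M (F \<Otimes>\<^sub>M borel) (\<lambda>w. (w, Y w)))"
    by (simp add: integral_distr)
  also have "\<dots> = (\<integral>w. (\<integral>y. f (w, y) \<partial>gaussian_measure s) \<partial>restr_to_subalg M F)"
    unfolding gaussian_indep_distr[OF M sub s Y] using integral_fst'[OF int'] by simp
  also have "\<dots> = (\<integral>w. (\<integral>y. f (w, y) \<partial>gaussian_measure s) \<partial>M)"
    by (rule integral_subalgebra2[OF sub]) measurable
  finally show "(\<integral>w. f (w, Y w) \<partial>M) = (\<integral>w. (\<integral>y. f (w, y) \<partial>gaussian_measure s) \<partial>M)" .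
qed

section \<open>Natural filtrations and measurability on path spaces\<close>

lemma space_natural_filtration [simp]: "space (natural_filtration \<Omega> T X t) = \<Omega>"
  by (simp add: natural_filtration_def)

lemma measurable_natural_filtration_component:
  assumes "s \<in> T" "s \<le> t"
  shows "X s \<in> natural_filtration \<Omega> T X t \<rightarrow>\<^sub>M borel"
proof -
  have "(\<lambda>\<omega>. \<lambda>s\<in>T \<inter> {..t}. X s \<omega>) \<in> natural_filtration \<Omega> T X t \<rightarrow>\<^sub>M (\<Pi>\<^sub>M s\<in>T \<inter> {..t}. borel)"
    unfolding natural_filtration_def by (rule measurable_vimage_algebra1) (auto simp: space_PiM)
  from measurable_compose[OF this measurable_component_singleton[of s]] show ?thesis
    using assms by simp
qed

lemma measurable_natural_filtration:
  assumes "f \<in> space N \<rightarrow> \<Omega>" and "\<And>s. s \<in> T \<Longrightarrow> s \<le> t \<Longrightarrow> (\<lambda>x. X s (f x)) \<in> N \<rightarrow>\<^sub>M borel"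
  shows "f \<in> N \<rightarrow>\<^sub>M natural_filtration \<Omega> T X t"
  unfolding natural_filtration_def
  by (rule measurable_vimage_algebra2) (use assms in \<open>auto intro!: measurable_restrict\<close>)

text \<open>Measurability of the identity is an inclusion of \<sigma>-algebras; in this form,
  inclusion of a generated \<sigma>-algebra can be checked on its generators.\<close>

lemma subalgebra_identI:
  assumes "(\<lambda>x. x) \<in> M \<rightarrow>\<^sub>M F" "space F = space M"
  shows "subalgebra M F"
proof -
  have "A \<in> sets M" if "A \<in> sets F" for A
    using measurable_sets[OF assms(1) that] sets.sets_into_space[OF that] assms(2)
    by (simp add: Int_absorb2)
  then show ?thesis using assms(2) by (auto simp: subalgebra_def)
qed

lemma subalgebra_natural_filtration:
  assumes "\<And>s. s \<in> T \<Longrightarrow> X s \<in> M \<rightarrow>\<^sub>M borel"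
  shows "subalgebra M (natural_filtration (space M) T X t)"
  by (rule subalgebra_identI) (auto intro!: measurable_natural_filtration assms)

lemma filtration_natural_filtration: "filtration \<Omega> (natural_filtration \<Omega> T X)"
proof
  fix i j :: real assume ij: "i \<le> j"
  have "subalgebra (natural_filtration \<Omega> T X j) (natural_filtration \<Omega> T X i)"
    using ij by (intro subalgebra_identI measurable_natural_filtration)
      (auto intro: measurable_natural_filtration_component)
  then show "sets (natural_filtration \<Omega> T X i) \<subseteq> sets (natural_filtration \<Omega> T X j)"
    by (simp add: subalgebra_def)
qed simp

lemma space_path_space: "space (path_space T) = {w \<in> extensional T. continuous_on T w}"
  by (auto simp: path_space_def space_restrict_space space_PiM PiE_def)

lemma measurable_path_space_component: "t \<in> T \<Longrightarrow> (\<lambda>w. w t) \<in> path_space T \<rightarrow>\<^sub>M borel"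
  unfolding path_space_def by (rule measurable_restrict_space1) measurable

lemma measurable_path_space:
  assumes "\<And>t. t \<in> T \<Longrightarrow> X t \<in> M \<rightarrow>\<^sub>M borel" "\<And>\<omega>. \<omega> \<in> space M \<Longrightarrow> continuous_on T (\<lambda>t. X t \<omega>)"
  shows "(\<lambda>\<omega>. \<lambda>t\<in>T. X t \<omega>) \<in> M \<rightarrow>\<^sub>M path_space T"
  unfolding path_space_def
proof (rule measurable_restrict_space2)
  show "(\<lambda>\<omega>. \<lambda>t\<in>T. X t \<omega>) \<in> M \<rightarrow>\<^sub>M Pi\<^sub>M T (\<lambda>_. borel)"
    using assms(1) by (intro measurable_restrict)
  show "(\<lambda>\<omega>. \<lambda>t\<in>T. X t \<omega>) \<in> space M \<rightarrow> {w. continuous_on T w}"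
    using assms(2) by (auto cong: continuous_on_cong)
qed

text \<open>The process is the limit of its discretizations in time.\<close>

lemma progressively_measurable:
  fixes c :: "real \<Rightarrow> 'w \<Rightarrow> 'a::euclidean_space"
  assumes u: "0 \<le> u" and c: "\<And>s. s \<in> {0..u} \<Longrightarrow> c s \<in> F \<rightarrow>\<^sub>M borel"
    and cont: "\<And>\<omega>. \<omega> \<in> space F \<Longrightarrow> continuous_on {0..u} (\<lambda>s. c s \<omega>)"
  shows "(\<lambda>(\<omega>, s). c (max 0 (min u s)) \<omega>) \<in> F \<Otimes>\<^sub>M borel \<rightarrow>\<^sub>M borel"
proof -
  define clip where "clip s = max 0 (min u s)" for s :: real
  have clip: "clip s \<in> {0..u}" for s using u by (auto simp: clip_def)
  have [measurable]: "c (clip s) \<in> F \<rightarrow>\<^sub>M borel" for s by (rule c[OF clip])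
  \<comment> \<open>Time is rounded down to the grid of mesh \<open>1 / Suc n\<close>, so only
    countably many time indices occur and joint measurability is immediate. Clipping comes after
    rounding, which keeps the evaluation inside \<open>{0..u}\<close>.\<close>
  define g where "g n p = c (clip (real_of_int \<lfloor>real (Suc n) * snd p\<rfloor> / real (Suc n))) (fst p)" for n and p :: "'w \<times> real"
  have gm: "g n \<in> F \<Otimes>\<^sub>M borel \<rightarrow>\<^sub>M borel" for n
    unfolding g_def
    by (rule measurable_compose_countable[where f="\<lambda>i p. c (clip (real_of_int i / real (Suc n))) (fst p)"])
       measurable
  have lim: "(\<lambda>n. g n p) \<longlonglongrightarrow> c (clip (snd p)) (fst p)" if p: "p \<in> space (F \<Otimes>\<^sub>M borel)" for p
  proof -
    have "(\<lambda>n. real_of_int \<lfloor>real (Suc n) * snd p\<rfloor> / real (Suc n)) \<longlonglongrightarrow> snd p"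
    proof (rule real_tendsto_sandwich)
      show "\<forall>\<^sub>F n in sequentially. snd p - 1 / real (Suc n) \<le> real_of_int \<lfloor>real (Suc n) * snd p\<rfloor> / real (Suc n)"
      proof (intro always_eventually allI)
        fix n
        have "real (Suc n) * snd p - 1 \<le> real_of_int \<lfloor>real (Suc n) * snd p\<rfloor>" by linarith
        then have "(real (Suc n) * snd p - 1) / real (Suc n) \<le> real_of_int \<lfloor>real (Suc n) * snd p\<rfloor> / real (Suc n)"
          by (rule divide_right_mono) simp
        then show "snd p - 1 / real (Suc n) \<le> real_of_int \<lfloor>real (Suc n) * snd p\<rfloor> / real (Suc n)"
          by (simp add: diff_divide_distrib)
      qed
      show "\<forall>\<^sub>F n in sequentially. real_of_int \<lfloor>real (Suc n) * snd p\<rfloor> / real (Suc n) \<le> snd p"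
      proof (intro always_eventually allI)
        fix n
        have "real_of_int \<lfloor>real (Suc n) * snd p\<rfloor> \<le> real (Suc n) * snd p" by linarith
        then have "real_of_int \<lfloor>real (Suc n) * snd p\<rfloor> / real (Suc n) \<le> (real (Suc n) * snd p) / real (Suc n)"
          by (rule divide_right_mono) simp
        then show "real_of_int \<lfloor>real (Suc n) * snd p\<rfloor> / real (Suc n) \<le> snd p" by simp
      qed
      show "(\<lambda>n. snd p - 1 / real (Suc n)) \<longlonglongrightarrow> snd p"
        using tendsto_diff[OF tendsto_const LIMSEQ_Suc[OF lim_1_over_n], of "snd p"] by simp
    qed simp
    then have "(\<lambda>n. clip (real_of_int \<lfloor>real (Suc n) * snd p\<rfloor> / real (Suc n))) \<longlonglongrightarrow> clip (snd p)"
      unfolding clip_def by (intro tendsto_intros)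
    with cont show ?thesis
      unfolding g_def using p clip
      by (intro continuous_on_tendsto_compose[where s="{0..u}" and f="\<lambda>s. c s (fst p)"])
         (auto simp: space_pair_measure)
  qed
  have "(\<lambda>p. c (clip (snd p)) (fst p)) \<in> F \<Otimes>\<^sub>M borel \<rightarrow>\<^sub>M borel"
    by (rule borel_measurable_LIMSEQ_metric[OF gm lim])
  then show ?thesis by (simp add: split_beta' clip_def)
qed

text \<open>The integral against a parameter-dependent measure is rewritten as a Lebesgue integral
  of a jointly measurable integrand. Where an integral diverges it takes the default value 0, and
  the measurability of parameter integrals covers these points.\<close>

lemma measurable_tilted_mean:
  assumes [measurable]: "\<pi>0 \<in> borel_measurable borel" and pos: "\<And>x. 0 \<le> \<pi>0 x"
  shows "(\<lambda>(t, c). tilted_mean \<pi>0 t c) \<in> borel \<Otimes>\<^sub>M borel \<rightarrow>\<^sub>M borel"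
proof -
  have *: "tilted_mean \<pi>0 t c = (\<integral>x. (exp (c \<bullet> x - t / 2 * (norm x)\<^sup>2) * \<pi>0 x /
        (\<integral>y. exp (c \<bullet> y - t / 2 * (norm y)\<^sup>2) * \<pi>0 y \<partial>lborel)) *\<^sub>R x \<partial>lborel)" for t c
    unfolding tilted_mean_def tilted_measure_def
    by (rule integral_density)
       (measurable, intro AE_I2 divide_nonneg_nonneg mult_nonneg_nonneg pos integral_nonneg, simp_all add: pos)
  show ?thesis unfolding * split_beta' by measurable
qed

section \<open>Transport of weak solutions to the path space\<close>

lemma continuous_on_atLeastI:
  fixes f :: "real \<Rightarrow> 'a::topological_space"
  assumes "\<And>n::nat. continuous_on {0..real n} f"
  shows "continuous_on {0..} f"
  unfolding continuous_on_eq_continuous_within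
proof
  fix t :: real assume t: "t \<in> {0..}"
  obtain n :: nat where n: "t < real n" using reals_Archimedean2 by blast
  have "at t within {0..} = at t within {0..real n}"
    by (rule at_within_nhd[where S="{..<real n}"]) (use n in auto)
  moreover have "continuous (at t within {0..real n}) f"
    using assms[of n] t n by (simp add: continuous_on_eq_continuous_within)
  ultimately show "continuous (at t within {0..}) f" by simp
qed

text \<open>On each bounded interval the Lebesgue integral agrees with the gauge integral, whose
  indefinite integral is continuous.\<close>

lemma continuous_on_indefinite_set_integral:
  fixes f :: "real \<Rightarrow> 'a::euclidean_space"
  assumes f: "\<And>n::nat. set_integrable lborel {0..real n} f"
  shows "continuous_on {0..} (\<lambda>t. LINT s:{0..t}|lborel. f s)"
proof (rule continuous_on_atLeastI)
  fix n :: nat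
  have sub: "set_integrable lborel {0..t} f" if "t \<le> real n" for t
    using f[of n] by (rule set_integrable_subset) (use that in auto)
  have "continuous_on {0..real n} (\<lambda>t. integral {0..t} f)"
    using set_borel_integral_eq_integral(1)[OF f[of n]] by (rule indefinite_integral_continuous_1)
  then show "continuous_on {0..real n} (\<lambda>t. LINT s:{0..t}|lborel. f s)"
    by (rule continuous_on_eq) (simp add: set_borel_integral_eq_integral(2)[OF sub])
qed

text \<open>Events of \<open>N\<close> pull back along \<open>\<Phi>\<close> to events of
  \<open>F\<close>. The increments need to agree only almost everywhere, because a noise that is
  reconstructed from the path equals the original noise only off a null set.\<close>

lemma gaussian_indep_distr_AE:
  fixes Y :: "'w \<Rightarrow> 'a::euclidean_space"
  assumes \<Phi>[measurable]: "\<Phi> \<in> M \<rightarrow>\<^sub>M Q" and \<Phi>': "\<Phi> \<in> F \<rightarrow>\<^sub>M N" and sub: "subalgebra M F" and subN: "subalgebra Q N"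
    and Y': "Y' \<in> Q \<rightarrow>\<^sub>M borel" and eq: "AE \<omega> in M. Y' (\<Phi> \<omega>) = Y \<omega>"
    and Y: "gaussian_indep M F Y s"
  shows "gaussian_indep (distr M Q \<Phi>) N Y' s"
  unfolding gaussian_indep_def
proof (intro conjI ballI)
  show "Y' \<in> distr M Q \<Phi> \<rightarrow>\<^sub>M borel" using Y' by simp
  fix A D assume A: "A \<in> sets N" and D: "D \<in> sets (borel :: 'a measure)"
  note [measurable] = Y'
  have [measurable]: "Y \<in> M \<rightarrow>\<^sub>M borel" using Y by (simp add: gaussian_indep_def)
  note D[measurable]
  have subs: "sets F \<subseteq> sets M" "space F = space M" "sets N \<subseteq> sets Q" "space N = space Q"
    using sub subN by (auto simp: subalgebra_def)
  then have AQ[measurable]: "A \<in> sets Q" using A by auto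
  have A': "\<Phi> -` A \<inter> space M \<in> sets F" using measurable_sets[OF \<Phi>' A] subs by simp
  have "emeasure (distr M Q \<Phi>) (A \<inter> (Y' -` D \<inter> space (distr M Q \<Phi>)))
      = emeasure M (\<Phi> -` (A \<inter> (Y' -` D \<inter> space Q)) \<inter> space M)"
    by (subst emeasure_distr) auto
  also have "\<dots> = emeasure M ((\<Phi> -` A \<inter> space M) \<inter> (Y -` D \<inter> space M))"
  proof (rule emeasure_eq_AE)
    show "AE \<omega> in M. (\<omega> \<in> \<Phi> -` (A \<inter> (Y' -` D \<inter> space Q)) \<inter> space M) = (\<omega> \<in> (\<Phi> -` A \<inter> space M) \<inter> (Y -` D \<inter> space M))"
      using eq AE_space by eventually_elim (use measurable_space[OF \<Phi>] in auto)
  qed (use A' subs in auto)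
  also have "\<dots> = emeasure M (\<Phi> -` A \<inter> space M) * emeasure (gaussian_measure s) D"
    using Y A' D by (simp add: gaussian_indep_def)
  also have "emeasure M (\<Phi> -` A \<inter> space M) = emeasure (distr M Q \<Phi>) A"
    by (simp add: emeasure_distr)
  finally show "emeasure (distr M Q \<Phi>) (A \<inter> (Y' -` D \<inter> space (distr M Q \<Phi>)))
     = emeasure (distr M Q \<Phi>) A * emeasure (gaussian_measure s) D" .
qed

text \<open>The integrals below see a process only on the time interval \<open>{0..u}\<close>; clipping the time makes
  \<open>progressively_measurable\<close> applicable.\<close>

lemma measurable_drift:
  fixes c :: "real \<Rightarrow> 'w \<Rightarrow> 'a::euclidean_space"
  assumes [measurable]: "\<pi>0 \<in> borel_measurable borel" and pos: "\<And>x. 0 \<le> \<pi>0 x"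
    and u: "0 \<le> u" and c: "\<And>s. s \<in> {0..u} \<Longrightarrow> c s \<in> F \<rightarrow>\<^sub>M borel"
    and cont: "\<And>\<omega>. \<omega> \<in> space F \<Longrightarrow> continuous_on {0..u} (\<lambda>s. c s \<omega>)"
  shows "(\<lambda>(\<omega>, s). indicator {0..u} s *\<^sub>R tilted_mean \<pi>0 s (c s \<omega>)) \<in> F \<Otimes>\<^sub>M borel \<rightarrow>\<^sub>M borel"
proof -
  have [measurable]: "(\<lambda>(\<omega>, s). c (max 0 (min u s)) \<omega>) \<in> F \<Otimes>\<^sub>M borel \<rightarrow>\<^sub>M borel"
    by (rule progressively_measurable[OF u c cont])
  note [measurable] = measurable_tilted_mean[OF assms(1,2), simplified]
  have "(\<lambda>p. indicator {0..u} (snd p) *\<^sub>R (\<lambda>(t, c). tilted_mean \<pi>0 t c) (snd p, (\<lambda>(\<omega>, s). c (max 0 (min u s)) \<omega>) p)) \<in> F \<Otimes>\<^sub>M borel \<rightarrow>\<^sub>M borel"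
    by measurable
  also have "(\<lambda>p. indicator {0..u} (snd p) *\<^sub>R (\<lambda>(t, c). tilted_mean \<pi>0 t c) (snd p, (\<lambda>(\<omega>, s). c (max 0 (min u s)) \<omega>) p))
     = (\<lambda>(\<omega>, s). indicator {0..u} s *\<^sub>R tilted_mean \<pi>0 s (c s \<omega>))"
    by (auto simp: fun_eq_iff indicator_def)
  finally show ?thesis .
qed

text \<open>The third part turns integrability of the drift into finiteness of a measurable
  nonnegative integral. It thereby becomes a measurable event, and almost sure statements about it
  pass to the image measure.\<close>

lemma
  fixes c :: "real \<Rightarrow> 'w \<Rightarrow> 'a::euclidean_space"
  assumes \<pi>: "\<pi>0 \<in> borel_measurable borel" and pos: "\<And>x. 0 \<le> \<pi>0 x"
    and u: "0 \<le> u" and c: "\<And>s. s \<in> {0..u} \<Longrightarrow> c s \<in> F \<rightarrow>\<^sub>M borel"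
    and cont: "\<And>\<omega>. \<omega> \<in> space F \<Longrightarrow> continuous_on {0..u} (\<lambda>s. c s \<omega>)"
  shows measurable_integral_drift: "(\<lambda>\<omega>. LINT s:{0..u}|lborel. tilted_mean \<pi>0 s (c s \<omega>)) \<in> F \<rightarrow>\<^sub>M borel"
    and measurable_nn_integral_drift:
      "(\<lambda>\<omega>. \<integral>\<^sup>+s. ennreal (norm (indicator {0..u} s *\<^sub>R tilted_mean \<pi>0 s (c s \<omega>))) \<partial>lborel) \<in> F \<rightarrow>\<^sub>M borel"
    and set_integrable_drift_iff: "\<And>\<omega>. \<omega> \<in> space F \<Longrightarrow> set_integrable lborel {0..u} (\<lambda>s. tilted_mean \<pi>0 s (c s \<omega>)) \<longleftrightarrow>
      (\<integral>\<^sup>+s. ennreal (norm (indicator {0..u} s *\<^sub>R tilted_mean \<pi>0 s (c s \<omega>))) \<partial>lborel) < \<infinity>"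
proof -
  note [measurable] = measurable_drift[OF assms]
  show "(\<lambda>\<omega>. LINT s:{0..u}|lborel. tilted_mean \<pi>0 s (c s \<omega>)) \<in> F \<rightarrow>\<^sub>M borel"
    unfolding set_lebesgue_integral_def by measurable
  show "(\<lambda>\<omega>. \<integral>\<^sup>+s. ennreal (norm (indicator {0..u} s *\<^sub>R tilted_mean \<pi>0 s (c s \<omega>))) \<partial>lborel) \<in> F \<rightarrow>\<^sub>M borel"
    by measurable
  show "set_integrable lborel {0..u} (\<lambda>s. tilted_mean \<pi>0 s (c s \<omega>)) \<longleftrightarrow>
      (\<integral>\<^sup>+s. ennreal (norm (indicator {0..u} s *\<^sub>R tilted_mean \<pi>0 s (c s \<omega>))) \<partial>lborel) < \<infinity>"
    if [measurable]: "\<omega> \<in> space F" for \<omega>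
  proof -
    have "(\<lambda>s. indicator {0..u} s *\<^sub>R tilted_mean \<pi>0 s (c s \<omega>)) \<in> lborel \<rightarrow>\<^sub>M borel"
      using measurable_Pair2[OF measurable_drift[OF assms] that] by simp
    then show ?thesis unfolding set_integrable_def integrable_iff_bounded by simp
  qed
qed

text \<open>On the canonical space the driving noise is recovered from the path.\<close>

lemma tilt_law_distr:
  fixes c :: "real \<Rightarrow> 'w \<Rightarrow> 'a::euclidean_space"
  assumes \<pi>: "\<pi>0 \<in> borel_measurable borel" and pos: "\<And>x. 0 \<le> \<pi>0 x"
    and tp: "tilt_process \<pi>0 M F B c"
  shows "tilt_law \<pi>0 (distr M (path_space {0..}) (\<lambda>\<omega>. \<lambda>t\<in>{0..}. c t \<omega>))"
proof -
  define \<Phi> where "\<Phi> \<omega> = (\<lambda>t\<in>{0..}. c t \<omega>)" for \<omega>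
  define Q where "Q = distr M (path_space {0..}) \<Phi>"
  define X where "X = (\<lambda>t (w :: real \<Rightarrow> 'a). w t)"
  define N where "N = natural_filtration (space Q) {0..} X"
  define B' where "B' t w = w t - (LINT s:{0..t}|lborel. tilted_mean \<pi>0 s (w s))" for t and w :: "real \<Rightarrow> 'a"
  from tp have wp: "wiener_process M F {0..} B" and cF: "\<And>t. 0 \<le> t \<Longrightarrow> c t \<in> F t \<rightarrow>\<^sub>M borel"
    and cc: "\<And>\<omega>. \<omega> \<in> space M \<Longrightarrow> continuous_on {0..} (\<lambda>t. c t \<omega>)"
    and c0: "AE \<omega> in M. c 0 \<omega> = 0"
    and sde: "AE \<omega> in M. \<forall>t\<ge>0. set_integrable lborel {0..t} (\<lambda>s. tilted_mean \<pi>0 s (c s \<omega>)) \<and>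
        c t \<omega> = (LINT s:{0..t}|lborel. tilted_mean \<pi>0 s (c s \<omega>)) + B t \<omega>"
    by (auto simp: tilt_process_def)
  from wp have "prob_space M" and fil: "filtration (space M) F" and sub: "\<And>t. subalgebra M (F t)"
    and inc: "\<And>s t. 0 \<le> s \<Longrightarrow> s < t \<Longrightarrow> distributed M lborel (\<lambda>\<omega>. B t \<omega> - B s \<omega>) (\<lambda>x. ennreal (gaussian_density (sqrt (t - s)) x)) \<and>
        prob_space.indep_set M (sets (F s))
          (sets (vimage_algebra (space M) (\<lambda>\<omega>. B t \<omega> - B s \<omega>) borel))"
    by (auto simp: wiener_process_def)
  interpret prob_space M by fact
  interpret filtration "space M" F by fact
  have cM: "c t \<in> M \<rightarrow>\<^sub>M borel" if "0 \<le> t" for t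
    using measurable_from_subalg[OF sub cF[OF that]] .
  have cc': "continuous_on {0..u} (\<lambda>s. c s \<omega>)" if "\<omega> \<in> space M" for u \<omega>
    by (rule continuous_on_subset[OF cc[OF that]]) auto
  have \<Phi>[measurable]: "\<Phi> \<in> M \<rightarrow>\<^sub>M path_space {0..}"
    unfolding \<Phi>_def by (rule measurable_path_space) (use cM cc in auto)
  have \<Phi>t: "\<Phi> \<omega> t = c t \<omega>" if "0 \<le> t" for \<omega> t using that by (simp add: \<Phi>_def)
  have [measurable_cong]: "sets Q = sets (path_space {0..})" by (simp add: Q_def)
  have spQ: "space Q = {w \<in> extensional {0..}. continuous_on {0..} w}" by (simp add: Q_def space_path_space)
  have XQ: "X t \<in> Q \<rightarrow>\<^sub>M borel" if "0 \<le> t" for t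
    unfolding X_def using measurable_path_space_component[of t "{0..}"] that
    by (simp add: measurable_cong_sets[OF \<open>sets Q = _\<close> refl])
  have XN: "X s \<in> N t \<rightarrow>\<^sub>M borel" if "0 \<le> s" "s \<le> t" for s t
    unfolding N_def using that by (intro measurable_natural_filtration_component) auto
  have subN: "subalgebra Q (N t)" for t
    unfolding N_def by (rule subalgebra_natural_filtration) (use XQ in auto)
  \<comment> \<open>Adaptedness of \<open>c\<close>: events of the natural filtration pull back to
    events of \<open>F t\<close>, so the independence of the noise from \<open>F t\<close> passes to
    the canonical space.\<close>
  have \<Phi>N: "\<Phi> \<in> F t \<rightarrow>\<^sub>M N t" if "0 \<le> t" for t
    unfolding N_def
  proof (rule measurable_natural_filtration)
    show "\<Phi> \<in> space (F t) \<rightarrow> space Q" using measurable_space[OF \<Phi>] by (auto simp: Q_def space_F)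
    fix s :: real assume s: "s \<in> {0..}" "s \<le> t"
    have "c s \<in> F t \<rightarrow>\<^sub>M borel"
      using s sets_F_mono[OF s(2)] by (intro measurable_from_subalg[OF _ cF]) (auto simp: subalgebra_def space_F)
    then show "(\<lambda>x. X s (\<Phi> x)) \<in> F t \<rightarrow>\<^sub>M borel" using s by (simp add: X_def \<Phi>t)
  qed
  have cX: "continuous_on {0..u} (\<lambda>s. X s w)" if "w \<in> space Q" for u w
    using that by (auto simp: X_def spQ intro: continuous_on_subset)
  note drift_Q = \<pi> pos _ XQ cX
  have drift_eq: "indicator {0..u} s *\<^sub>R tilted_mean \<pi>0 s (\<Phi> \<omega> s) = indicator {0..u} s *\<^sub>R tilted_mean \<pi>0 s (c s \<omega>)"
    for u s \<omega> by (auto simp: indicator_def \<Phi>t)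
  \<comment> \<open>Integer times suffice, since integrability is inherited by subintervals; this
    leaves countably many conditions, each of them a measurable event on the path space.\<close>
  have fin: "AE w in Q. \<forall>n::nat. (\<integral>\<^sup>+s. ennreal (norm (indicator {0..real n} s *\<^sub>R tilted_mean \<pi>0 s (X s w))) \<partial>lborel) < \<infinity>"
    unfolding AE_all_countable
  proof
    fix n :: nat
    have m: "(\<lambda>w. \<integral>\<^sup>+s. ennreal (norm (indicator {0..real n} s *\<^sub>R tilted_mean \<pi>0 s (X s w))) \<partial>lborel) \<in> Q \<rightarrow>\<^sub>M borel"
      by (rule measurable_nn_integral_drift) (use drift_Q in auto)
    have "AE \<omega> in M. (\<integral>\<^sup>+s. ennreal (norm (indicator {0..real n} s *\<^sub>R tilted_mean \<pi>0 s (X s (\<Phi> \<omega>)))) \<partial>lborel) < \<infinity>"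
      using sde AE_space
    proof eventually_elim
      case (elim \<omega>)
      have "set_integrable lborel {0..real n} (\<lambda>s. tilted_mean \<pi>0 s (c s \<omega>))" using elim by simp
      moreover have "set_integrable lborel {0..real n} (\<lambda>s. tilted_mean \<pi>0 s (c s \<omega>)) \<longleftrightarrow>
        (\<integral>\<^sup>+s. ennreal (norm (indicator {0..real n} s *\<^sub>R tilted_mean \<pi>0 s (c s \<omega>))) \<partial>lborel) < \<infinity>"
        by (rule set_integrable_drift_iff[where F=M]) (use \<pi> pos cM cc' elim in auto)
      ultimately show ?case unfolding X_def drift_eq by simp
    qed
    then show "AE w in Q. (\<integral>\<^sup>+s. ennreal (norm (indicator {0..real n} s *\<^sub>R tilted_mean \<pi>0 s (X s w))) \<partial>lborel) < \<infinity>"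
      unfolding Q_def by (subst AE_distr_iff[OF \<Phi>]) (use m in simp_all)
  qed
  have int: "AE w in Q. \<forall>n::nat. set_integrable lborel {0..real n} (\<lambda>s. tilted_mean \<pi>0 s (w s))"
    using fin AE_space
  proof eventually_elim
    case (elim w)
    show ?case
    proof
      fix n :: nat
      have "set_integrable lborel {0..real n} (\<lambda>s. tilted_mean \<pi>0 s (X s w)) \<longleftrightarrow>
        (\<integral>\<^sup>+s. ennreal (norm (indicator {0..real n} s *\<^sub>R tilted_mean \<pi>0 s (X s w))) \<partial>lborel) < \<infinity>"
        by (rule set_integrable_drift_iff[where F=Q]) (use drift_Q elim in auto)
      then show "set_integrable lborel {0..real n} (\<lambda>s. tilted_mean \<pi>0 s (w s))"
        using elim by (simp add: X_def)
    qed
  qed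
  have int': "AE w in Q. \<forall>t\<ge>0. set_integrable lborel {0..t} (\<lambda>s. tilted_mean \<pi>0 s (w s))"
    using int
  proof eventually_elim
    case (elim w)
    show ?case
    proof (intro allI impI)
      fix t :: real assume "0 \<le> t"
      obtain n :: nat where "t \<le> real n" using real_arch_simple by blast
      then show "set_integrable lborel {0..t} (\<lambda>s. tilted_mean \<pi>0 s (w s))"
        by (intro set_integrable_subset[OF elim[rule_format, of n]]) auto
    qed
  qed
  have X0: "AE w in Q. w 0 = 0"
  proof -
    have [measurable]: "(\<lambda>w. w 0) \<in> path_space {0..} \<rightarrow>\<^sub>M (borel :: 'a measure)"
      by (rule measurable_path_space_component) simp
    show ?thesis unfolding Q_def by (subst AE_distr_iff[OF \<Phi>]) (use c0 in \<open>simp_all add: \<Phi>t\<close>)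
  qed
  have B'N: "B' t \<in> N t \<rightarrow>\<^sub>M borel" if t: "0 \<le> t" for t
  proof -
    have "(\<lambda>w. LINT s:{0..t}|lborel. tilted_mean \<pi>0 s (X s w)) \<in> N t \<rightarrow>\<^sub>M borel"
      by (rule measurable_integral_drift) (use \<pi> pos t XN cX in \<open>auto simp: N_def\<close>)
    then have "(\<lambda>w. X t w - (LINT s:{0..t}|lborel. tilted_mean \<pi>0 s (X s w))) \<in> N t \<rightarrow>\<^sub>M borel"
      using XN[of t t] t by (intro borel_measurable_diff) auto
    then show ?thesis by (simp add: B'_def[abs_def] X_def)
  qed
  have B'Q: "B' t \<in> Q \<rightarrow>\<^sub>M borel" if "0 \<le> t" for t
    using measurable_from_subalg[OF subN B'N[OF that]] .
  have B'0: "B' 0 w = w 0" for w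
  proof -
    have "(LINT s:{0..0}|lborel. tilted_mean \<pi>0 s (w s)) = 0"
      unfolding set_lebesgue_integral_def
      by (rule integral_eq_zero_AE, use AE_lborel_singleton[of "0::real"] in eventually_elim) auto
    then show ?thesis by (simp add: B'_def)
  qed
  show ?thesis
    unfolding tilt_law_def \<Phi>_def[symmetric] Q_def[symmetric]
  proof (intro conjI exI)
    show "sets Q = sets (path_space {0..})" by fact
    show "tilt_process \<pi>0 Q N B' (\<lambda>t w. w t)"
      unfolding tilt_process_def wiener_process_def
    proof (intro conjI ballI allI impI)
      show Q: "prob_space Q" unfolding Q_def by (rule prob_space_distr[OF \<Phi>])
      show "filtration (space Q) N" unfolding N_def by (rule filtration_natural_filtration)
      show "subalgebra Q (N t)" for t by (rule subN)
      show "B' t \<in> N t \<rightarrow>\<^sub>M borel" if "t \<in> {0..}" for t using B'N that by simp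
      show "AE \<omega> in Q. B' 0 \<omega> = 0" using X0 by (simp add: B'0)
      show "AE \<omega> in Q. continuous_on {0..} (\<lambda>t. B' t \<omega>)"
        using int AE_space
      proof eventually_elim
        case (elim w)
        then show ?case unfolding B'_def
          by (intro continuous_on_diff continuous_on_indefinite_set_integral) (auto simp: spQ)
      qed
      show "(\<lambda>w. w t) \<in> N t \<rightarrow>\<^sub>M borel" if "0 \<le> t" for t using XN[of t t] that by (simp add: X_def)
      show "continuous_on {0..} (\<lambda>t. \<omega> t)" if "\<omega> \<in> space Q" for \<omega> using that by (simp add: spQ)
      show "AE \<omega> in Q. \<omega> 0 = 0" by (rule X0)
      show "AE \<omega> in Q. \<forall>t\<ge>0. set_integrable lborel {0..t} (\<lambda>s. tilted_mean \<pi>0 s (\<omega> s)) \<and>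
             \<omega> t = (LBINT s:{0..t}. tilted_mean \<pi>0 s (\<omega> s)) + B' t \<omega>"
        using int' by eventually_elim (simp add: B'_def)
    next
      fix s t :: real assume s: "s \<in> {0..}" and t: "t \<in> {0..}" and st: "s < t"
      have Q: "prob_space Q" unfolding Q_def by (rule prob_space_distr[OF \<Phi>])
      have "gaussian_indep M (F s) (\<lambda>\<omega>. B t \<omega> - B s \<omega>) (sqrt (t - s))"
        using inc[of s t] s st by (subst gaussian_indep_iff[OF prob_space_axioms sub]) auto
      then have "gaussian_indep (distr M (path_space {0..}) \<Phi>) (N s) (\<lambda>w. B' t w - B' s w) (sqrt (t - s))"
      proof (rule gaussian_indep_distr_AE[OF \<Phi> \<Phi>N sub, rotated -1])
        \<comment> \<open>By the equation itself, the noise read off the path is almost surely the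
          original \<open>B\<close>.\<close>
        show "AE \<omega> in M. B' t (\<Phi> \<omega>) - B' s (\<Phi> \<omega>) = B t \<omega> - B s \<omega>"
          using sde
        proof eventually_elim
          case (elim \<omega>)
          have "B' u (\<Phi> \<omega>) = B u \<omega>" if "0 \<le> u" for u
            using elim[rule_format, OF that] that
            unfolding B'_def set_lebesgue_integral_def drift_eq by (simp add: \<Phi>t)
          then show ?case using s t by simp
        qed
        have "subalgebra Q (N s)" by (rule subN)
        then show "subalgebra (path_space {0..}) (N s)" by (simp add: Q_def subalgebra_def)
        have "(\<lambda>w. B' t w - B' s w) \<in> Q \<rightarrow>\<^sub>M borel"
          using B'Q[of t] B'Q[of s] s t by (intro borel_measurable_diff) auto
        then show "(\<lambda>w. B' t w - B' s w) \<in> path_space {0..} \<rightarrow>\<^sub>M borel" by (simp add: Q_def)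
      qed (use s in auto)
      then have *: "gaussian_indep Q (N s) (\<lambda>w. B' t w - B' s w) (sqrt (t - s))" by (simp add: Q_def)
      show "distributed Q lborel (\<lambda>\<omega>. B' t \<omega> - B' s \<omega>) (\<lambda>x. ennreal (gaussian_density (sqrt (t - s)) x))"
        and "prob_space.indep_set Q (sets (N s)) (sets (vimage_algebra (space Q) (\<lambda>\<omega>. B' t \<omega> - B' s \<omega>) borel))"
        using * st by (simp_all add: gaussian_indep_iff[OF Q subN])
    qed
  qed
qed

section \<open>The innovation process\<close>

text \<open>A Taylor bound that is quadratic in \<open>x\<close> but only linear in
  \<open>v\<close>, for a \<open>v\<close> of which just a first moment is known. If
  \<open>v\<close> is at most \<open>x\<close>, then \<open>a\<close> is at most
  \<open>2 * x\<close> in absolute value and the second-order bound applies; otherwise it is at most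
  \<open>2 * v\<close> and the first-order bound does.\<close>

lemma norm_iexp_diff_le:
  assumes "\<bar>a\<bar> \<le> x + v" "0 \<le> x" "0 \<le> v"
  shows "cmod (iexp a - 1 - \<i> * a) \<le> 2 * x\<^sup>2 + 4 * v"
proof (cases "v \<le> x")
  case True
  have "cmod (iexp a - 1 - \<i> * a) \<le> \<bar>a\<bar>\<^sup>2 / 2"
    using iexp_approx1[of a 1] by (simp add: numeral_2_eq_2 diff_diff_eq)
  also have "\<dots> \<le> (2 * x)\<^sup>2 / 2"
    using assms True by (intro divide_right_mono power_mono) auto
  finally show ?thesis using assms by (simp add: power2_eq_square)
next
  case False
  have "cmod (iexp a - 1 - \<i> * a) \<le> 2 * \<bar>a\<bar>"
    using iexp_approx2[of a 1] by (simp add: diff_diff_eq)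
  also have "\<dots> \<le> 4 * v" using assms False by simp
  finally show ?thesis by (smt (verit) zero_le_power2)
qed

text \<open>The filtering setting: \<open>c\<close> is observed, \<open>m\<close> is the conditional expectation of the hidden
  variable \<open>X\<close>, and given the past and \<open>X\<close> the increments of \<open>c\<close> are Gaussian with drift \<open>X\<close>;
  the last assumption is the part of this that is used.\<close>

locale innovation = prob_space P + filtration "space P" F
  for P :: "'w measure" and F :: "real \<Rightarrow> 'w measure" +
  fixes c m :: "real \<Rightarrow> 'w \<Rightarrow> 'a::euclidean_space" and X :: "'w \<Rightarrow> 'a"
  assumes sub: "0 \<le> t \<Longrightarrow> subalgebra P (F t)"
    and c_adapted: "0 \<le> t \<Longrightarrow> c t \<in> F t \<rightarrow>\<^sub>M borel"
    and m_prog: "0 \<le> u \<Longrightarrow> (\<lambda>(w, s). indicator {0..u} s *\<^sub>R m s w) \<in> F u \<Otimes>\<^sub>M borel \<rightarrow>\<^sub>M borel"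
    and X_int: "integrable P X"
    and m_proj: "0 \<le> t \<Longrightarrow> A \<in> sets (F t) \<Longrightarrow>
        (\<integral>w. indicator A w * (\<theta> \<bullet> m t w) \<partial>P) = (\<integral>w. indicator A w * (\<theta> \<bullet> X w) \<partial>P)"
    and m_norm: "0 \<le> t \<Longrightarrow> A \<in> sets (F t) \<Longrightarrow>
        (\<integral>\<^sup>+w. indicator A w * ennreal (norm (m t w)) \<partial>P) \<le> (\<integral>\<^sup>+w. indicator A w * ennreal (norm (X w)) \<partial>P)"
    and c_incr: "0 \<le> u \<Longrightarrow> 0 < h \<Longrightarrow> \<Gamma> \<in> F u \<rightarrow>\<^sub>M borel \<Longrightarrow> (\<And>w. cmod (\<Gamma> w) \<le> 1) \<Longrightarrow>
        (\<integral>w. \<Gamma> w * iexp (\<theta> \<bullet> (c (u + h) w - c u w)) \<partial>P)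
        = complex_of_real (exp (- (h * (norm \<theta>)\<^sup>2) / 2)) * (\<integral>w. \<Gamma> w * iexp (h * (\<theta> \<bullet> X w)) \<partial>P)"
begin

lemma subsets: "0 \<le> t \<Longrightarrow> sets (F t) \<subseteq> sets P"
  using sub by (simp add: subalgebra_def)

lemma m_adapted: "0 \<le> t \<Longrightarrow> m t \<in> F t \<rightarrow>\<^sub>M borel"
  using measurable_compose[OF _ m_prog[of t], of "\<lambda>w. (w, t)" "F t"] by simp

lemma c_meas: "0 \<le> t \<Longrightarrow> c t \<in> P \<rightarrow>\<^sub>M borel"
  using measurable_from_subalg[OF sub c_adapted] .

lemma m_meas: "0 \<le> t \<Longrightarrow> m t \<in> P \<rightarrow>\<^sub>M borel"
  using measurable_from_subalg[OF sub m_adapted] .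

lemma X_meas [measurable]: "X \<in> P \<rightarrow>\<^sub>M borel"
  using X_int by (rule borel_measurable_integrable)

lemma m_prog_P: 
  assumes "0 \<le> u"
  shows "(\<lambda>(w, s). indicator {0..u} s *\<^sub>R m s w) \<in> P \<Otimes>\<^sub>M borel \<rightarrow>\<^sub>M borel"
proof -
  have [measurable]: "(\<lambda>w. w) \<in> P \<rightarrow>\<^sub>M F u" using assms by (intro measurable_from_subalg[OF sub]) auto
  have "(\<lambda>p. (fst p, snd p)) \<in> P \<Otimes>\<^sub>M borel \<rightarrow>\<^sub>M F u \<Otimes>\<^sub>M borel" by measurable
  from measurable_compose[OF this m_prog[OF assms]] show ?thesis by simp
qed

lemma m_window:
  assumes "0 \<le> u"
  shows "(\<lambda>(w, s). indicator {u..u + h} s *\<^sub>R m s w) \<in> P \<Otimes>\<^sub>M borel \<rightarrow>\<^sub>M borel"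
proof (cases "0 \<le> h")
  case True
  have *: "(\<lambda>p. indicator {u..u + h} (snd p) *\<^sub>R g p) \<in> P \<Otimes>\<^sub>M borel \<rightarrow>\<^sub>M borel"
    if [measurable]: "g \<in> P \<Otimes>\<^sub>M borel \<rightarrow>\<^sub>M borel" for g :: "_ \<Rightarrow> 'a"
    by measurable
  have "(\<lambda>p. indicator {u..u + h} (snd p) *\<^sub>R ((\<lambda>(w, s). indicator {0..u + h} s *\<^sub>R m s w) p)) \<in> P \<Otimes>\<^sub>M borel \<rightarrow>\<^sub>M borel"
    using True assms by (intro * m_prog_P) simp
  also have "(\<lambda>p. indicator {u..u + h} (snd p) *\<^sub>R ((\<lambda>(w, s). indicator {0..u + h} s *\<^sub>R m s w) p))
    = (\<lambda>(w, s). indicator {u..u + h} s *\<^sub>R m s w)"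
    using assms by (auto simp: fun_eq_iff indicator_def)
  finally show ?thesis .
qed simp

lemma nn_m_le: "0 \<le> t \<Longrightarrow> (\<integral>\<^sup>+w. ennreal (norm (m t w)) \<partial>P) \<le> (\<integral>\<^sup>+w. ennreal (norm (X w)) \<partial>P)"
proof -
  assume t: "0 \<le> t"
  have A: "space P \<in> sets (F t)" using sets.top[of "F t"] by (simp add: space_F)
  have "(\<integral>\<^sup>+w. ennreal (norm (f w)) \<partial>P) = (\<integral>\<^sup>+w. indicator (space P) w * ennreal (norm (f w)) \<partial>P)" for f :: "'w \<Rightarrow> 'a"
    by (intro nn_integral_cong) simp
  then show ?thesis using m_norm[OF t A] by simp
qed

lemma nn_X: "(\<integral>\<^sup>+w. ennreal (norm (X w)) \<partial>P) = ennreal (expectation (\<lambda>w. norm (X w)))"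
  using X_int by (intro nn_integral_eq_integral) auto

lemma m_int: "0 \<le> t \<Longrightarrow> integrable P (m t)"
  using nn_m_le[of t] by (intro integrableI_bounded m_meas) (auto simp: nn_X le_less_trans)

text \<open>The identity on events makes \<open>\<theta> \<bullet> m t w\<close> a version of the
  conditional expectation of \<open>\<theta> \<bullet> X w\<close>, and conditional expectations may
  be tested against bounded weights. Complex weights are split into real and imaginary
  parts.\<close>

lemma m_proj_bounded:
  fixes \<Gamma> :: "'w \<Rightarrow> complex"
  assumes t: "0 \<le> t" and \<Gamma>: "\<Gamma> \<in> F t \<rightarrow>\<^sub>M borel" "\<And>w. cmod (\<Gamma> w) \<le> 1"
  shows "(\<integral>w. \<Gamma> w * complex_of_real (\<theta> \<bullet> m t w) \<partial>P) = (\<integral>w. \<Gamma> w * complex_of_real (\<theta> \<bullet> X w) \<partial>P)"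
proof -
  interpret finite_measure_subalgebra P "F t" by unfold_locales (rule sub[OF t])
  note [measurable] = m_adapted[OF t] m_meas[OF t] \<Gamma>(1) measurable_from_subalg[OF sub[OF t] \<Gamma>(1)]
  have im: "integrable P (\<lambda>w. \<theta> \<bullet> m t w)" using m_int[OF t] by simp
  have iX: "integrable P (\<lambda>w. \<theta> \<bullet> X w)" using X_int by simp
  have ce: "AE w in P. real_cond_exp P (F t) (\<lambda>w. \<theta> \<bullet> X w) w = \<theta> \<bullet> m t w"
    by (rule real_cond_exp_charact)
       (use m_proj[OF t] im iX in \<open>auto simp: set_lebesgue_integral_def\<close>)
  have bd: "integrable P (\<lambda>w. f w * g w)"
    if "f \<in> P \<rightarrow>\<^sub>M borel" "\<And>w. \<bar>f w\<bar> \<le> 1" "integrable P g" for f g :: "'w \<Rightarrow> real"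
    using that by (intro Bochner_Integration.integrable_bound[OF that(3)])
      (auto simp: abs_mult mult_left_le_one_le)
  have real: "(\<integral>w. f w * (\<theta> \<bullet> m t w) \<partial>P) = (\<integral>w. f w * (\<theta> \<bullet> X w) \<partial>P)"
    if f[measurable]: "f \<in> F t \<rightarrow>\<^sub>M borel" and b: "\<And>w. \<bar>f w\<bar> \<le> 1" for f :: "'w \<Rightarrow> real"
  proof -
    have [measurable]: "f \<in> P \<rightarrow>\<^sub>M borel" by (rule measurable_from_subalg[OF sub[OF t] f])
    have "(\<integral>w. f w * (\<theta> \<bullet> m t w) \<partial>P) = (\<integral>w. f w * real_cond_exp P (F t) (\<lambda>w. \<theta> \<bullet> X w) w \<partial>P)"
      by (rule integral_cong_AE) (use ce in auto)
    also have "\<dots> = (\<integral>w. f w * (\<theta> \<bullet> X w) \<partial>P)"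
      by (rule real_cond_exp_intg(2)) (use bd[OF _ b iX] in auto)
    finally show ?thesis .
  qed
  have bRe: "\<bar>Re (\<Gamma> w)\<bar> \<le> 1" and bIm: "\<bar>Im (\<Gamma> w)\<bar> \<le> 1" for w
    using \<Gamma>(2)[of w] abs_Re_le_cmod[of "\<Gamma> w"] abs_Im_le_cmod[of "\<Gamma> w"] by linarith+
  have int: "integrable P (\<lambda>w. \<Gamma> w * complex_of_real (g w))" if "integrable P g" for g
    using that \<Gamma>(2) by (intro Bochner_Integration.integrable_bound[OF that])
      (auto simp: norm_mult mult_left_le_one_le)
  show ?thesis
    using real[of "\<lambda>w. Re (\<Gamma> w)"] real[of "\<lambda>w. Im (\<Gamma> w)"] bRe bIm int[OF im] int[OF iX]
    by (simp add: complex_eq_iff integral_Re[symmetric] integral_Im[symmetric] del: integral_Re integral_Im)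
qed

text \<open>Conditional means of one integrable variable are uniformly integrable. On the event A
  that \<open>m t\<close> exceeds \<open>K\<close>, the mean of \<open>norm (m t w)\<close> is at
  most that of \<open>norm (X w)\<close>, which is at most the tail of X beyond \<open>L\<close>
  plus \<open>L\<close> times the probability of A; Markov's inequality bounds this probability by
  \<open>E / K\<close> for all times at once.\<close>

lemma uniform_tail:
  assumes \<epsilon>: "0 < \<epsilon>"
  obtains K where "0 < K"
    "\<And>t. 0 \<le> t \<Longrightarrow> (\<integral>\<^sup>+w. ennreal (indicator {K<..} (norm (m t w)) * norm (m t w)) \<partial>P) \<le> ennreal \<epsilon>"
proof -
  define E where "E = expectation (\<lambda>w. norm (X w))"
  have E: "0 \<le> E" by (simp add: E_def)
  have "(\<lambda>n::nat. \<integral>w. indicator {real n<..} (norm (X w)) * norm (X w) \<partial>P) \<longlonglongrightarrow> (\<integral>w. 0 \<partial>P)"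
  proof (rule integral_dominated_convergence[where w="\<lambda>w. norm (X w)"])
    show "AE w in P. (\<lambda>n. indicator {real n<..} (norm (X w)) * norm (X w)) \<longlonglongrightarrow> 0"
    proof (intro AE_I2 tendsto_eventually)
      fix w
      obtain N :: nat where "norm (X w) \<le> real N" using real_arch_simple by blast
      then show "\<forall>\<^sub>F n in sequentially. indicator {real n<..} (norm (X w)) * norm (X w) = 0"
        by (intro eventually_sequentiallyI[of N]) (auto simp: indicator_def)
    qed
  qed (use X_int in \<open>auto simp: indicator_def\<close>)
  then have "\<forall>\<^sub>F n in sequentially. (\<integral>w. indicator {real n<..} (norm (X w)) * norm (X w) \<partial>P) < \<epsilon> / 2"
    using \<epsilon> by (intro order_tendstoD(2)) auto
  then obtain L :: nat where L: "(\<integral>w. indicator {real L<..} (norm (X w)) * norm (X w) \<partial>P) < \<epsilon> / 2"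
    by (auto simp: eventually_sequentially)
  \<comment> \<open>Chosen so that \<open>L * (E / K)\<close> is at most half of \<epsilon>; the
    summand 1 keeps \<open>K\<close> positive when \<open>L\<close> or \<open>E\<close>
    vanishes.\<close>
  define K where "K = 2 * real L * E / \<epsilon> + 1"
  have K: "0 < K" using \<epsilon> E by (auto simp: K_def intro!: add_nonneg_pos divide_nonneg_nonneg)
  have LE: "real L * (E / K) \<le> \<epsilon> / 2"
  proof -
    have "2 * real L * E \<le> \<epsilon> * K" using \<epsilon> by (simp add: K_def field_simps)
    then show ?thesis using K by (simp add: field_simps)
  qed
  have iL: "integrable P (\<lambda>w. indicator {real L<..} (norm (X w)) * norm (X w))"
    using X_int by (intro Bochner_Integration.integrable_bound[OF integrable_norm[OF X_int]]) (auto simp: indicator_def)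
  have "(\<integral>\<^sup>+w. ennreal (indicator {K<..} (norm (m t w)) * norm (m t w)) \<partial>P) \<le> ennreal \<epsilon>" if t: "0 \<le> t" for t
  proof -
    note [measurable] = m_adapted[OF t] m_meas[OF t]
    define A where "A = {w\<in>space P. K < norm (m t w)}"
    have "{w\<in>space (F t). K < norm (m t w)} \<in> sets (F t)" by measurable
    then have A: "A \<in> sets (F t)" by (simp add: A_def space_F)
    then have AP[measurable]: "A \<in> sets P" using subsets[OF t] by auto
    have "K * prob A \<le> E"
    proof -
      have "K * prob A = (\<integral>w. K * indicator A w \<partial>P)" by simp
      also have "\<dots> \<le> (\<integral>w. norm (m t w) \<partial>P)"
        using m_int[OF t] by (intro integral_mono integrable_mult_right integrable_real_indicator AP)
          (auto simp: A_def indicator_def emeasure_eq_measure)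
      also have "\<dots> \<le> E"
        using nn_m_le[OF t] m_int[OF t] E unfolding nn_X E_def[symmetric]
        by (subst (asm) nn_integral_eq_integral) auto
      finally show ?thesis .
    qed
    then have pA: "prob A \<le> E / K" using K by (simp add: field_simps)
    have "(\<integral>\<^sup>+w. ennreal (indicator {K<..} (norm (m t w)) * norm (m t w)) \<partial>P)
       = (\<integral>\<^sup>+w. indicator A w * ennreal (norm (m t w)) \<partial>P)"
      by (intro nn_integral_cong) (auto simp: A_def indicator_def)
    also have "\<dots> \<le> (\<integral>\<^sup>+w. indicator A w * ennreal (norm (X w)) \<partial>P)" by (rule m_norm[OF t A])
    also have "\<dots> \<le> (\<integral>\<^sup>+w. ennreal (indicator {real L<..} (norm (X w)) * norm (X w) + real L * indicator A w) \<partial>P)"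
      by (intro nn_integral_mono) (auto simp: indicator_def intro!: ennreal_leI)
    also have "\<dots> = ennreal ((\<integral>w. indicator {real L<..} (norm (X w)) * norm (X w) \<partial>P) + real L * prob A)"
    proof -
      have "integrable P (\<lambda>w. real L * indicator A w)"
        by (intro integrable_mult_right integrable_real_indicator AP) (simp add: emeasure_eq_measure)
      with iL show ?thesis
        by (subst nn_integral_eq_integral) (auto simp: integral_add)
    qed
    also have "\<dots> \<le> ennreal \<epsilon>"
    proof -
      have "real L * prob A \<le> \<epsilon> / 2"
        using order_trans[OF mult_left_mono[OF pA, of "real L"] LE] by simp
      with L show ?thesis by (intro ennreal_leI) linarith
    qed
    finally show ?thesis .
  qed
  with K show ?thesis by (rule that)
qed

section \<open>Integrals of the conditional mean over time windows\<close>

lemma window_integrable: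
  assumes u: "0 \<le> u" and h: "0 \<le> h"
  shows "integrable (P \<Otimes>\<^sub>M lborel) (\<lambda>(w, s). indicator {u..u + h} s *\<^sub>R m s w)"
proof -
  interpret pair_sigma_finite P lborel ..
  note [measurable] = m_window[OF u, of h]
  have "(\<integral>\<^sup>+p. ennreal (norm (case p of (w, s) \<Rightarrow> indicator {u..u + h} s *\<^sub>R m s w)) \<partial>(P \<Otimes>\<^sub>M lborel))
    = (\<integral>\<^sup>+s. (\<integral>\<^sup>+w. ennreal (norm (indicator {u..u + h} s *\<^sub>R m s w)) \<partial>P) \<partial>lborel)"
    by (subst nn_integral_snd[symmetric]) auto
  also have "\<dots> \<le> (\<integral>\<^sup>+s. ennreal (expectation (\<lambda>w. norm (X w))) * indicator {u..u + h} s \<partial>lborel)"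
    using u nn_m_le by (intro nn_integral_mono) (auto simp: indicator_def nn_X)
  also have "\<dots> < \<infinity>" using h by (simp add: nn_integral_cmult_indicator ennreal_mult_less_top)
  finally show ?thesis by (intro integrableI_bounded) auto
qed

lemma AE_window_integrable:
  assumes "0 \<le> u" "0 \<le> h"
  shows "AE w in P. set_integrable lborel {u..u + h} (\<lambda>s. m s w)"
proof -
  interpret pair_sigma_finite P lborel ..
  show ?thesis
    using AE_integrable_fst'[OF window_integrable[OF assms]] by (simp add: set_integrable_def)
qed

definition drift :: "real \<Rightarrow> real \<Rightarrow> 'w \<Rightarrow> 'a" where
  "drift u h w = (LINT s:{u..u + h}|lborel. m s w)"

lemma drift_meas: "0 \<le> u \<Longrightarrow> drift u h \<in> P \<rightarrow>\<^sub>M borel"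
  using m_window[of u h] unfolding drift_def[abs_def] set_lebesgue_integral_def
  by (intro lborel.borel_measurable_lebesgue_integral) simp

text \<open>Splitting the integral requires integrability on both windows, which holds for almost
  every path; the common endpoint is a null set.\<close>

lemma drift_add:
  assumes "0 \<le> u" "0 \<le> h"
  shows "AE w in P. drift 0 (u + h) w = drift 0 u w + drift u h w"
  using AE_window_integrable[OF assms] AE_window_integrable[OF order_refl assms(1)]
proof (eventually_elim)
  case (elim w)
  have i: "set_integrable lborel {0..u} (\<lambda>s. m s w)" "set_integrable lborel {u..u + h} (\<lambda>s. m s w)"
    using elim assms by auto
  have "drift 0 (u + h) w = (\<integral>s. indicator {0..u + h} s *\<^sub>R m s w \<partial>lborel)"
    by (simp add: drift_def set_lebesgue_integral_def)
  also have "\<dots> = (\<integral>s. indicator {0..u} s *\<^sub>R m s w + indicator {u<..u + h} s *\<^sub>R m s w \<partial>lborel)"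
    using assms by (intro Bochner_Integration.integral_cong refl) (auto simp: indicator_def)
  also have "\<dots> = (\<integral>s. indicator {0..u} s *\<^sub>R m s w \<partial>lborel) + (\<integral>s. indicator {u<..u + h} s *\<^sub>R m s w \<partial>lborel)"
    using i set_integrable_subset[OF i(2), of "{u<..u + h}"]
    by (intro Bochner_Integration.integral_add) (auto simp: set_integrable_def subset_eq)
  also have "(\<integral>s. indicator {u<..u + h} s *\<^sub>R m s w \<partial>lborel) = (\<integral>s. indicator {u..u + h} s *\<^sub>R m s w \<partial>lborel)"
  proof (rule integral_cong_AE)
    show "AE s in lborel. indicator {u<..u + h} s *\<^sub>R m s w = indicator {u..u + h} s *\<^sub>R m s w"
      using AE_lborel_singleton[of u] by eventually_elim (auto simp: indicator_def)
    show "(\<lambda>s. indicator {u..u + h} s *\<^sub>R m s w) \<in> borel_measurable lborel"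
      using i(2) by (auto simp: set_integrable_def)
    show "(\<lambda>s. indicator {u<..u + h} s *\<^sub>R m s w) \<in> borel_measurable lborel"
      using set_integrable_subset[OF i(2), of "{u<..u + h}"] by (auto simp: set_integrable_def subset_eq)
  qed
  finally show ?case by (simp add: drift_def set_lebesgue_integral_def)
qed

text \<open>Fubini moves the expectation inside the time integral. For each time s of the window,
  \<open>\<Gamma>\<close> is measurable at time s because the filtration increases, so
  \<open>m s\<close> may be replaced by \<open>X\<close>. This is the source of the first-order
  cancellation.\<close>

lemma drift_proj:
  assumes u: "0 \<le> u" and h: "0 \<le> h" and \<Gamma>: "\<Gamma> \<in> F u \<rightarrow>\<^sub>M borel" "\<And>w. cmod (\<Gamma> w) \<le> 1"
  shows "integrable P (\<lambda>w. \<theta> \<bullet> drift u h w)"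
    and "(\<integral>w. \<Gamma> w * complex_of_real (\<theta> \<bullet> drift u h w) \<partial>P)
      = h * (\<integral>w. \<Gamma> w * complex_of_real (\<theta> \<bullet> X w) \<partial>P)"
proof -
  interpret pair_sigma_finite P lborel ..
  note [measurable] = m_window[OF u, of h] measurable_from_subalg[OF sub[OF u] \<Gamma>(1)]
  note wi = window_integrable[OF u h]
  have "integrable P (drift u h)"
    using integrable_fst'[OF wi] by (simp add: drift_def[abs_def] set_lebesgue_integral_def)
  then show "integrable P (\<lambda>w. \<theta> \<bullet> drift u h w)" by simp
  define f where "f = (\<lambda>p. \<Gamma> (fst p) * complex_of_real (\<theta> \<bullet> (case p of (w, s) \<Rightarrow> indicator {u..u + h} s *\<^sub>R m s w)))"
  have fi: "integrable (P \<Otimes>\<^sub>M lborel) f"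
  proof (rule Bochner_Integration.integrable_bound)
    show "integrable (P \<Otimes>\<^sub>M lborel) (\<lambda>p. \<theta> \<bullet> (case p of (w, s) \<Rightarrow> indicator {u..u + h} s *\<^sub>R m s w))"
      using wi by simp
    show "AE p in P \<Otimes>\<^sub>M lborel. norm (f p) \<le> norm (\<theta> \<bullet> (case p of (w, s) \<Rightarrow> indicator {u..u + h} s *\<^sub>R m s w))"
      using \<Gamma>(2) by (intro AE_I2) (simp add: f_def norm_mult mult_left_le_one_le)
  qed (simp add: f_def)
  have "(\<integral>w. \<Gamma> w * complex_of_real (\<theta> \<bullet> drift u h w) \<partial>P) = (\<integral>w. (\<integral>s. f (w, s) \<partial>lborel) \<partial>P)"
  proof (rule integral_cong_AE)
    show "AE w in P. \<Gamma> w * complex_of_real (\<theta> \<bullet> drift u h w) = (\<integral>s. f (w, s) \<partial>lborel)"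
      using AE_window_integrable[OF u h]
    proof eventually_elim
      case (elim w)
      then have i: "integrable lborel (\<lambda>s. indicator {u..u + h} s *\<^sub>R m s w)"
        by (simp add: set_integrable_def)
      have "complex_of_real (\<theta> \<bullet> drift u h w) = (\<integral>s. complex_of_real (\<theta> \<bullet> (indicator {u..u + h} s *\<^sub>R m s w)) \<partial>lborel)"
        unfolding drift_def set_lebesgue_integral_def
        by (simp only: integral_inner_right[OF i] integral_complex_of_real)
      then show ?case by (simp only: f_def prod.case fst_conv integral_mult_right_zero)
    qed
    have [measurable]: "f \<in> P \<Otimes>\<^sub>M lborel \<rightarrow>\<^sub>M borel" using fi by (rule borel_measurable_integrable)
    show "(\<lambda>w. \<integral>s. f (w, s) \<partial>lborel) \<in> borel_measurable P" by measurable
  qed (use drift_meas[OF u, of h] in measurable)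
  also have "\<dots> = (\<integral>s. (\<integral>w. f (w, s) \<partial>P) \<partial>lborel)"
    using Fubini_integral[of "\<lambda>w s. f (w, s)"] fi by simp
  also have "\<dots> = (\<integral>s. indicator {u..u + h} s *\<^sub>R (\<integral>w. \<Gamma> w * complex_of_real (\<theta> \<bullet> X w) \<partial>P) \<partial>lborel)"
  proof (intro Bochner_Integration.integral_cong refl)
    fix s
    show "(\<integral>w. f (w, s) \<partial>P) = indicator {u..u + h} s *\<^sub>R (\<integral>w. \<Gamma> w * complex_of_real (\<theta> \<bullet> X w) \<partial>P)"
    proof (cases "s \<in> {u..u + h}")
      case True
      then have s: "0 \<le> s" "u \<le> s" using u by auto
      have "\<Gamma> \<in> F s \<rightarrow>\<^sub>M borel"
        by (rule measurable_from_subalg[OF _ \<Gamma>(1)])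
           (use sets_F_mono[OF s(2)] in \<open>auto simp: subalgebra_def space_F\<close>)
      from m_proj_bounded[OF s(1) this \<Gamma>(2)] True show ?thesis by (simp add: f_def)
    qed (simp add: f_def)
  qed
  also have "\<dots> = h * (\<integral>w. \<Gamma> w * complex_of_real (\<theta> \<bullet> X w) \<partial>P)"
    using h by (simp add: scaleR_conv_of_real)
  finally show "(\<integral>w. \<Gamma> w * complex_of_real (\<theta> \<bullet> drift u h w) \<partial>P)
      = h * (\<integral>w. \<Gamma> w * complex_of_real (\<theta> \<bullet> X w) \<partial>P)" .
qed

text \<open>The integrand is split at level \<open>K\<close>: the bounded part contributes at most
  \<open>h * K\<close>, and \<open>V\<close> is the time integral of the part above
  \<open>K\<close>, whose expectation is bounded by Tonelli and the uniform tail estimate.\<close>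

lemma drift_bound:
  assumes u: "0 \<le> u" and h: "0 \<le> h" and K: "0 < K" and \<epsilon>: "0 \<le> \<epsilon>"
    and tail: "\<And>t. 0 \<le> t \<Longrightarrow> (\<integral>\<^sup>+w. ennreal (indicator {K<..} (norm (m t w)) * norm (m t w)) \<partial>P) \<le> ennreal \<epsilon>"
  obtains V where "integrable P V" "\<And>w. 0 \<le> V w" "expectation V \<le> h * \<epsilon>"
    "AE w in P. norm (drift u h w) \<le> h * K + V w"
proof
  interpret pair_sigma_finite P lborel ..
  note [measurable] = m_window[OF u, of h]
  define g where "g = (\<lambda>p. case p of (w, s) \<Rightarrow> indicator {u..u + h} s *\<^sub>R m s w)"
  have gm[measurable]: "g \<in> P \<Otimes>\<^sub>M lborel \<rightarrow>\<^sub>M borel" by (simp add: g_def)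
  define v where "v p = indicator {K<..} (norm (g p)) * norm (g p)" for p
  have vm[measurable]: "v \<in> P \<Otimes>\<^sub>M lborel \<rightarrow>\<^sub>M borel" unfolding v_def by measurable
  have vi: "integrable (P \<Otimes>\<^sub>M lborel) v"
    by (rule Bochner_Integration.integrable_bound[OF window_integrable[OF u h]])
       (auto simp: v_def g_def indicator_def)
  define V where "V w = (\<integral>s. v (w, s) \<partial>lborel)" for w
  show "integrable P V" unfolding V_def by (rule integrable_fst'[OF vi])
  show "0 \<le> V w" for w unfolding V_def by (rule Bochner_Integration.integral_nonneg) (simp add: v_def)
  have "ennreal (expectation V) = (\<integral>\<^sup>+p. ennreal (v p) \<partial>(P \<Otimes>\<^sub>M lborel))"
    unfolding V_def integral_fst'[OF vi] using vi by (intro nn_integral_eq_integral[symmetric]) (auto simp: v_def)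
  also have "\<dots> = (\<integral>\<^sup>+s. (\<integral>\<^sup>+w. ennreal (v (w, s)) \<partial>P) \<partial>lborel)"
    by (subst nn_integral_snd[symmetric]) auto
  also have "\<dots> \<le> (\<integral>\<^sup>+s. ennreal \<epsilon> * indicator {u..u + h} s \<partial>lborel)"
    using u tail by (intro nn_integral_mono) (auto simp: v_def g_def indicator_def cong: if_cong)
  also have "\<dots> = ennreal (h * \<epsilon>)"
    using h \<epsilon> by (simp add: nn_integral_cmult_indicator ennreal_mult mult.commute)
  finally show "expectation V \<le> h * \<epsilon>" using h \<epsilon> by (simp add: ennreal_le_iff)
  show "AE w in P. norm (drift u h w) \<le> h * K + V w"
    using AE_window_integrable[OF u h] AE_integrable_fst'[OF vi]
  proof eventually_elim
    case (elim w)
    have "norm (drift u h w) \<le> (\<integral>s. norm (g (w, s)) \<partial>lborel)"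
      using integral_norm_bound[of lborel "\<lambda>s. g (w, s)"]
      unfolding drift_def set_lebesgue_integral_def g_def by simp
    also have "\<dots> \<le> (\<integral>s. K * indicator {u..u + h} s + v (w, s) \<partial>lborel)"
    proof (rule integral_mono)
      show "integrable lborel (\<lambda>s. norm (g (w, s)))" 
        using integrable_norm[OF elim(1)[unfolded set_integrable_def]] by (simp add: g_def)
      show "integrable lborel (\<lambda>s. K * indicator {u..u + h} s + v (w, s))"
        using elim h by (intro Bochner_Integration.integrable_add integrable_mult_right integrable_real_indicator) auto
      show "norm (g (w, s)) \<le> K * indicator {u..u + h} s + v (w, s)" for s
        using K by (auto simp: v_def g_def indicator_def)
    qed
    also have "\<dots> = h * K + V w" using elim h by (subst Bochner_Integration.integral_add) (auto simp: V_def)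
    finally show ?case .
  qed
qed


section \<open>One compensated step of the process\<close>

definition \<psi> :: "'a \<Rightarrow> real \<Rightarrow> complex" where
  "\<psi> \<theta> h = (\<integral>w. iexp (h * (\<theta> \<bullet> X w)) \<partial>P)"

text \<open>The characteristic function of \<open>N(0, h I)\<close> at \<theta>. Its product with
  \<open>\<psi> \<theta> h\<close> is the characteristic function of an increment of
  \<open>c\<close> over a time span h.\<close>

definition q :: "'a \<Rightarrow> real \<Rightarrow> real" where
  "q \<theta> h = exp (- (h * (norm \<theta>)\<^sup>2) / 2)"

text \<open>The square of the integrand is 2 - 2 cos of the phase, and a variance is nonnegative.
  The expected phase factor is \<open>q \<theta> h * \<psi> \<theta> h\<close> by
  \<open>c_incr\<close> with weight 1, so the bound is the same for all \<open>u\<close>; it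
  vanishes as h tends to 0.\<close>

lemma increment_small:
  assumes u: "0 \<le> u" and h: "0 < h"
  shows "(\<integral>w. cmod (iexp (\<theta> \<bullet> (c (u + h) w - c u w)) - 1) \<partial>P) \<le> sqrt (2 - 2 * Re (q \<theta> h * \<psi> \<theta> h))"
proof -
  have meas: "c u \<in> P \<rightarrow>\<^sub>M borel" "c (u + h) \<in> P \<rightarrow>\<^sub>M borel" using u h by (auto intro: c_meas)
  note [measurable] = meas
  define \<delta> where "\<delta> w = \<theta> \<bullet> (c (u + h) w - c u w)" for w
  have [measurable]: "\<delta> \<in> P \<rightarrow>\<^sub>M borel" unfolding \<delta>_def by measurable
  define g where "g w = cmod (iexp (\<delta> w) - 1)" for w
  have [measurable]: "g \<in> P \<rightarrow>\<^sub>M borel" unfolding g_def by measurable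
  have g2: "(g w)\<^sup>2 = 2 - 2 * Re (iexp (\<delta> w))" for w
  proof -
    have "(g w)\<^sup>2 = (cos (\<delta> w) - 1)\<^sup>2 + (sin (\<delta> w))\<^sup>2"
      by (simp add: g_def cmod_power2 Re_exp Im_exp)
    also have "\<dots> = 2 - 2 * cos (\<delta> w)"
      using sin_cos_squared_add[of "\<delta> w"] by (simp add: power2_eq_square algebra_simps)
    finally show ?thesis by (simp add: Re_exp)
  qed
  have ii: "integrable P (\<lambda>w. iexp (\<delta> w))" by (rule integrable_const_bound[of _ 1]) auto
  have gi: "integrable P g"
    by (rule integrable_const_bound[of _ 2]) (auto simp: g_def intro!: order_trans[OF norm_triangle_ineq4])
  have g2i: "integrable P (\<lambda>w. (g w)\<^sup>2)" unfolding g2 using ii by auto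
  have "(expectation g)\<^sup>2 \<le> expectation (\<lambda>w. (g w)\<^sup>2)"
    using variance_positive[of g] variance_eq[OF gi g2i] by simp
  also have "\<dots> = 2 - 2 * Re (\<integral>w. iexp (\<delta> w) \<partial>P)"
    unfolding g2 using ii by (simp add: prob_space)
  also have "(\<integral>w. iexp (\<delta> w) \<partial>P) = q \<theta> h * \<psi> \<theta> h"
    using c_incr[OF u h, of "\<lambda>_. 1" \<theta>] by (simp add: \<delta>_def q_def \<psi>_def)
  finally show ?thesis
    by (intro real_le_rsqrt) (simp add: g_def \<delta>_def)
qed

text \<open>\<open>R1\<close> is the second-order remainder for \<open>h * \<xi>\<close>, and
  \<open>R2\<close> the error in replacing the drift factor by its first-order term
  \<open>- \<i> * a\<close>. The first-order terms cancel up to the factor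
  \<open>q \<theta> h - 1\<close>. In the bound, the term with \<epsilon> is controlled through the
  truncation level \<open>K\<close>; for fixed \<open>K\<close>, every other term is o(h).\<close>

lemma step_error:
  fixes \<Gamma> :: "'w \<Rightarrow> complex"
  assumes u: "0 \<le> u" and h: "0 < h" and \<Gamma>: "\<Gamma> \<in> F u \<rightarrow>\<^sub>M borel" "\<And>w. cmod (\<Gamma> w) \<le> 1"
    and K: "0 < K" and \<epsilon>: "0 \<le> \<epsilon>"
    and tail: "\<And>t. 0 \<le> t \<Longrightarrow> (\<integral>\<^sup>+w. ennreal (indicator {K<..} (norm (m t w)) * norm (m t w)) \<partial>P) \<le> ennreal \<epsilon>"
  shows "cmod ((\<integral>w. \<Gamma> w * iexp (\<theta> \<bullet> (c (u + h) w - c u w - drift u h w)) \<partial>P) - q \<theta> h * (\<integral>w. \<Gamma> w \<partial>P))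
    \<le> (1 - q \<theta> h) * h * (\<integral>w. \<bar>\<theta> \<bullet> X w\<bar> \<partial>P)
      + (\<integral>w. cmod (iexp (h * (\<theta> \<bullet> X w)) - 1 - \<i> * (h * (\<theta> \<bullet> X w))) \<partial>P)
      + 2 * (norm \<theta> * (h * K))\<^sup>2 + 6 * norm \<theta> * (h * \<epsilon>)
      + norm \<theta> * (h * K) * sqrt (2 - 2 * Re (q \<theta> h * \<psi> \<theta> h))"
proof -
  have h': "0 \<le> h" using h by simp
  have meas: "c u \<in> P \<rightarrow>\<^sub>M borel" "c (u + h) \<in> P \<rightarrow>\<^sub>M borel" using u h by (auto intro: c_meas)
  note [measurable] = meas drift_meas[OF u, of h] measurable_from_subalg[OF sub[OF u] \<Gamma>(1)]
  define \<delta> where "\<delta> w = \<theta> \<bullet> (c (u + h) w - c u w)" for w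
  define a where "a w = \<theta> \<bullet> drift u h w" for w
  define \<xi> where "\<xi> w = \<theta> \<bullet> X w" for w
  have [measurable]: "\<delta> \<in> P \<rightarrow>\<^sub>M borel" "a \<in> P \<rightarrow>\<^sub>M borel" "\<xi> \<in> P \<rightarrow>\<^sub>M borel"
    unfolding \<delta>_def a_def \<xi>_def by measurable
  have ai: "integrable P a" unfolding a_def by (rule drift_proj(1)[OF u h' \<Gamma>])
  have \<xi>i: "integrable P \<xi>" unfolding \<xi>_def using X_int by simp
  have bd: "integrable P f" if "f \<in> P \<rightarrow>\<^sub>M borel" "\<And>w. cmod (f w) \<le> B" for f :: "'w \<Rightarrow> complex" and B
    using that by (intro integrable_const_bound[of _ B]) auto
  have \<Gamma>1: "cmod (\<Gamma> w * z) \<le> cmod z" for w z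
    using \<Gamma>(2)[of w] by (simp add: norm_mult mult_left_le_one_le)
  have \<Gamma>1': "cmod (\<Gamma> w) * r \<le> r" if "0 \<le> r" for w r
    using \<Gamma>(2)[of w] that by (simp add: mult_left_le_one_le)
  define R1 where "R1 w = iexp (h * \<xi> w) - 1 - \<i> * (h * \<xi> w)" for w
  define R2 where "R2 w = iexp (\<delta> w) * (iexp (- a w) - 1) + \<i> * a w" for w
  have i\<Gamma>: "integrable P \<Gamma>" using \<Gamma>(2) by (intro bd) auto
  have i\<Gamma>a: "integrable P (\<lambda>w. \<Gamma> w * a w)" 
    by (rule Bochner_Integration.integrable_bound[OF ai]) (auto simp: norm_mult mult_left_le_one_le \<Gamma>(2))
  have i\<Gamma>\<xi>: "integrable P (\<lambda>w. \<Gamma> w * \<xi> w)" 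
    by (rule Bochner_Integration.integrable_bound[OF \<xi>i]) (auto simp: norm_mult mult_left_le_one_le \<Gamma>(2))
  have i1: "integrable P (\<lambda>w. \<Gamma> w * iexp (h * \<xi> w))" "integrable P (\<lambda>w. \<Gamma> w * iexp (\<delta> w))"
    "integrable P (\<lambda>w. \<Gamma> w * iexp (\<delta> w - a w))"
    using \<Gamma>(2) by (auto intro!: bd[of _ 1] simp: norm_mult)
  have R1eq: "\<Gamma> w * R1 w = \<Gamma> w * iexp (h * \<xi> w) - \<Gamma> w - \<i> * h * (\<Gamma> w * \<xi> w)" for w
    by (simp add: R1_def algebra_simps)
  have R2eq: "\<Gamma> w * R2 w = \<Gamma> w * iexp (\<delta> w - a w) - \<Gamma> w * iexp (\<delta> w) + \<i> * (\<Gamma> w * a w)" for w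
  proof -
    have "iexp (\<delta> w - a w) = iexp (\<delta> w) * iexp (- a w)"
      by (simp add: exp_add[symmetric] right_diff_distrib)
    then show ?thesis by (simp add: R2_def algebra_simps)
  qed
  have iR1: "(\<integral>w. \<Gamma> w * R1 w \<partial>P) = (\<integral>w. \<Gamma> w * iexp (h * \<xi> w) \<partial>P) - (\<integral>w. \<Gamma> w \<partial>P) - \<i> * h * (\<integral>w. \<Gamma> w * \<xi> w \<partial>P)"
    unfolding R1eq using i\<Gamma> i1 i\<Gamma>\<xi> by simp
  have iR2: "(\<integral>w. \<Gamma> w * R2 w \<partial>P) = (\<integral>w. \<Gamma> w * iexp (\<delta> w - a w) \<partial>P) - (\<integral>w. \<Gamma> w * iexp (\<delta> w) \<partial>P) + \<i> * (\<integral>w. \<Gamma> w * a w \<partial>P)"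
    unfolding R2eq using i1 i\<Gamma>a by simp
  have e1: "(\<integral>w. \<Gamma> w * iexp (\<delta> w) \<partial>P) = q \<theta> h * (\<integral>w. \<Gamma> w * iexp (h * \<xi> w) \<partial>P)"
    unfolding \<delta>_def q_def \<xi>_def by (rule c_incr[OF u h \<Gamma>])
  have e2: "(\<integral>w. \<Gamma> w * a w \<partial>P) = h * (\<integral>w. \<Gamma> w * \<xi> w \<partial>P)"
    unfolding a_def \<xi>_def by (rule drift_proj(2)[OF u h' \<Gamma>])
  have q01: "0 \<le> q \<theta> h" "q \<theta> h \<le> 1" using h by (auto simp: q_def)
  \<comment> \<open>\<open>R1\<close> enters multiplied by \<open>q \<theta> h\<close> and
    \<open>R2\<close> with factor 1, so their first-order terms cancel up to
    \<open>q \<theta> h - 1\<close>.\<close>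
  have split: "(\<integral>w. \<Gamma> w * iexp (\<delta> w - a w) \<partial>P) - q \<theta> h * (\<integral>w. \<Gamma> w \<partial>P)
    = of_real (q \<theta> h - 1) * (\<i> * h * (\<integral>w. \<Gamma> w * \<xi> w \<partial>P)) + q \<theta> h * (\<integral>w. \<Gamma> w * R1 w \<partial>P) + (\<integral>w. \<Gamma> w * R2 w \<partial>P)"
    unfolding iR1 iR2 e1 e2 by (simp add: algebra_simps)
  have b0: "cmod (of_real (q \<theta> h - 1) * (\<i> * h * (\<integral>w. \<Gamma> w * \<xi> w \<partial>P))) \<le> (1 - q \<theta> h) * h * (\<integral>w. \<bar>\<xi> w\<bar> \<partial>P)"
  proof -
    have "cmod (\<integral>w. \<Gamma> w * \<xi> w \<partial>P) \<le> (\<integral>w. cmod (\<Gamma> w * \<xi> w) \<partial>P)" by (rule integral_norm_bound)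
    also have "\<dots> \<le> (\<integral>w. \<bar>\<xi> w\<bar> \<partial>P)"
      using \<Gamma>1' by (intro integral_mono integrable_norm i\<Gamma>\<xi> integrable_abs \<xi>i) (auto simp: norm_mult)
    finally have "cmod (\<integral>w. \<Gamma> w * \<xi> w \<partial>P) \<le> (\<integral>w. \<bar>\<xi> w\<bar> \<partial>P)" .
    then have "(1 - q \<theta> h) * h * cmod (\<integral>w. \<Gamma> w * \<xi> w \<partial>P) \<le> (1 - q \<theta> h) * h * (\<integral>w. \<bar>\<xi> w\<bar> \<partial>P)"
      using q01 h by (intro mult_left_mono mult_nonneg_nonneg) auto
    moreover have "cmod (of_real (q \<theta> h - 1)) = 1 - q \<theta> h" using q01 unfolding norm_of_real by simp
    ultimately show ?thesis
      using h by (simp only: norm_mult norm_ii norm_of_real abs_of_pos mult_1 mult.assoc)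
  qed
  have iR1n: "integrable P R1"
  proof -
    have "integrable P (\<lambda>w. iexp (h * \<xi> w))" by (rule bd[of _ 1]) auto
    moreover have "integrable P (\<lambda>w. \<i> * (h * \<xi> w))" using \<xi>i by simp
    ultimately show ?thesis unfolding R1_def by (intro Bochner_Integration.integrable_diff) auto
  qed
  have b1: "cmod (q \<theta> h * (\<integral>w. \<Gamma> w * R1 w \<partial>P)) \<le> (\<integral>w. cmod (R1 w) \<partial>P)"
  proof -
    have "cmod (\<integral>w. \<Gamma> w * R1 w \<partial>P) \<le> (\<integral>w. cmod (\<Gamma> w * R1 w) \<partial>P)" by (rule integral_norm_bound)
    also have "\<dots> \<le> (\<integral>w. cmod (R1 w) \<partial>P)"
    proof (rule integral_mono)
      show "integrable P (\<lambda>w. cmod (\<Gamma> w * R1 w))"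
        unfolding R1eq using i\<Gamma> i1 i\<Gamma>\<xi> by (intro integrable_norm) simp
    qed (use iR1n \<Gamma>1 in auto)
    finally have "q \<theta> h * cmod (\<integral>w. \<Gamma> w * R1 w \<partial>P) \<le> 1 * (\<integral>w. cmod (R1 w) \<partial>P)"
      using q01 by (intro mult_mono) auto
    then show ?thesis using q01 by (simp add: norm_mult)
  qed
  obtain V where V: "integrable P V" "\<And>w. 0 \<le> V w" "expectation V \<le> h * \<epsilon>"
    "AE w in P. norm (drift u h w) \<le> h * K + V w"
    using drift_bound[OF u h' K \<epsilon> tail] by blast
  define x where "x = norm \<theta> * (h * K)"
  have x: "0 \<le> x" using h K by (simp add: x_def)
  have R2i: "integrable P (\<lambda>w. cmod (\<Gamma> w * R2 w))"
    unfolding R2eq using i1 i\<Gamma>a by (intro integrable_norm) simp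
  define D where "D w = cmod (iexp (\<delta> w) - 1)" for w
  have Di: "integrable P D"
    unfolding D_def by (intro integrable_norm Bochner_Integration.integrable_diff bd[of _ 1]) auto
  have b2: "cmod (\<integral>w. \<Gamma> w * R2 w \<partial>P) \<le> 2 * x\<^sup>2 + 6 * norm \<theta> * (h * \<epsilon>) + x * expectation D"
  proof -
    have "cmod (\<integral>w. \<Gamma> w * R2 w \<partial>P) \<le> (\<integral>w. cmod (\<Gamma> w * R2 w) \<partial>P)" by (rule integral_norm_bound)
    also have "\<dots> \<le> (\<integral>w. 2 * x\<^sup>2 + 6 * (norm \<theta> * V w) + x * D w \<partial>P)"
    proof (rule integral_mono_AE[OF R2i])
      show "integrable P (\<lambda>w. 2 * x\<^sup>2 + 6 * (norm \<theta> * V w) + x * D w)" using V Di by simp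
      show "AE w in P. cmod (\<Gamma> w * R2 w) \<le> 2 * x\<^sup>2 + 6 * (norm \<theta> * V w) + x * D w"
        using V(4)
      proof eventually_elim
        case (elim w)
        define v where "v = norm \<theta> * V w"
        have v: "0 \<le> v" using V(2) by (simp add: v_def)
        have a: "\<bar>a w\<bar> \<le> x + v"
        proof -
          have "\<bar>a w\<bar> \<le> norm \<theta> * norm (drift u h w)" unfolding a_def by (rule Cauchy_Schwarz_ineq2)
          also have "\<dots> \<le> norm \<theta> * (h * K + V w)" using elim by (intro mult_left_mono) auto
          finally show ?thesis by (simp add: x_def v_def distrib_left)
        qed
        \<comment> \<open>The Taylor remainder at \<open>- a w\<close>, rotated by the phase of the
          increment, and a cross term. The cross term is small because the drift has order h and
          \<open>D\<close> tends to 0 in mean.\<close>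
        have "R2 w = (iexp (- a w) - 1 - \<i> * (- a w)) * iexp (\<delta> w) - \<i> * a w * (iexp (\<delta> w) - 1)"
          by (simp add: R2_def algebra_simps)
        then have "cmod (R2 w) \<le> cmod (iexp (- a w) - 1 - \<i> * (- a w)) + \<bar>a w\<bar> * D w"
          using norm_triangle_ineq4[of "(iexp (- a w) - 1 - \<i> * (- a w)) * iexp (\<delta> w)" "\<i> * a w * (iexp (\<delta> w) - 1)"]
          by (simp add: norm_mult D_def)
        also have "cmod (iexp (- a w) - 1 - \<i> * (- a w)) \<le> 2 * x\<^sup>2 + 4 * v"
          using norm_iexp_diff_le[of "- a w" x v] a x v by simp
        \<comment> \<open>For the unbounded part \<open>v\<close> only the trivial bound 2 on
          \<open>D\<close> is used. With the \<open>4 * v\<close> from the Taylor remainder this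
          makes the constant 6.\<close>
        also have "\<bar>a w\<bar> * D w \<le> x * D w + 2 * v"
        proof -
          have D2: "0 \<le> D w" "D w \<le> 2"
            using norm_triangle_ineq4[of "iexp (\<delta> w)" 1] by (simp_all add: D_def)
          have "\<bar>a w\<bar> * D w \<le> (x + v) * D w" using a D2 by (intro mult_right_mono) auto
          also have "\<dots> \<le> x * D w + v * 2"
            using D2 v mult_left_mono[of "D w" 2 v] by (simp add: distrib_right)
          finally show ?thesis by simp
        qed
        finally have "cmod (R2 w) \<le> 2 * x\<^sup>2 + 6 * v + x * D w" by simp
        then show ?case using \<Gamma>1[of w "R2 w"] by (simp add: v_def)
      qed
    qed
    also have "\<dots> = 2 * x\<^sup>2 + 6 * (norm \<theta> * expectation V) + x * expectation D"
      using V Di by (simp add: prob_space)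
    also have "\<dots> \<le> 2 * x\<^sup>2 + 6 * (norm \<theta> * (h * \<epsilon>)) + x * expectation D"
      using V(3) by (intro add_mono mult_left_mono order_refl) auto
    finally show ?thesis by simp
  qed
  have "x * expectation D \<le> x * sqrt (2 - 2 * Re (q \<theta> h * \<psi> \<theta> h))"
    using increment_small[OF u h, of \<theta>] x unfolding D_def \<delta>_def by (rule mult_left_mono)
  moreover have "cmod ((\<integral>w. \<Gamma> w * iexp (\<delta> w - a w) \<partial>P) - q \<theta> h * (\<integral>w. \<Gamma> w \<partial>P))
    \<le> (1 - q \<theta> h) * h * (\<integral>w. \<bar>\<xi> w\<bar> \<partial>P) + (\<integral>w. cmod (R1 w) \<partial>P) + (2 * x\<^sup>2 + 6 * norm \<theta> * (h * \<epsilon>) + x * expectation D)"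
    unfolding split by (intro norm_triangle_le add_mono b0 b1 b2)
  ultimately have "cmod ((\<integral>w. \<Gamma> w * iexp (\<delta> w - a w) \<partial>P) - q \<theta> h * (\<integral>w. \<Gamma> w \<partial>P))
    \<le> (1 - q \<theta> h) * h * (\<integral>w. \<bar>\<xi> w\<bar> \<partial>P) + (\<integral>w. cmod (R1 w) \<partial>P) + 2 * x\<^sup>2 + 6 * norm \<theta> * (h * \<epsilon>)
      + x * sqrt (2 - 2 * Re (q \<theta> h * \<psi> \<theta> h))" by simp
  then show ?thesis
    by (simp add: \<delta>_def a_def \<xi>_def R1_def x_def inner_diff_right)
qed


text \<open>Uniform in the starting time and in the weight, because iteration along a partition
  applies it with weights that collect all previous steps.\<close>

definition step_close :: "'a \<Rightarrow> real \<Rightarrow> real \<Rightarrow> bool" where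
  "step_close \<theta> h \<epsilon> \<longleftrightarrow> (\<forall>u\<ge>0. \<forall>\<Gamma>\<in>F u \<rightarrow>\<^sub>M (borel :: complex measure). (\<forall>w. cmod (\<Gamma> w) \<le> 1) \<longrightarrow>
    cmod ((\<integral>w. \<Gamma> w * iexp (\<theta> \<bullet> (c (u + h) w - c u w - drift u h w)) \<partial>P)
      - q \<theta> h * (\<integral>w. \<Gamma> w \<partial>P)) \<le> \<epsilon> * h)"

lemma uniform_step_error:
  assumes d: "0 < d" and \<epsilon>: "0 < \<epsilon>"
  shows "\<forall>\<^sub>F n in sequentially. step_close \<theta> (d / Suc n) \<epsilon>"
proof -
  define h where "h n = d / real (Suc n)" for n
  have h: "0 < h n" for n using d by (simp add: h_def)
  have hl: "h \<longlonglongrightarrow> 0" unfolding h_def using LIMSEQ_Suc[OF lim_const_over_n[of d]] by simp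
  \<comment> \<open>Makes the truncation term \<open>6 * norm \<theta> * \<epsilon>'\<close> at most
    half of \<epsilon>; the summand 1 covers \<theta> = 0. The level \<open>K\<close> is then fixed
    before the step length tends to 0.\<close>
  define \<epsilon>' where "\<epsilon>' = \<epsilon> / (12 * (norm \<theta> + 1))"
  have t1: "0 < norm \<theta> + 1" by (simp add: add_nonneg_pos)
  have \<epsilon>': "0 < \<epsilon>'" using \<epsilon> t1 by (simp add: \<epsilon>'_def)
  have e6: "6 * norm \<theta> * \<epsilon>' \<le> \<epsilon> / 2"
  proof -
    have "6 * norm \<theta> * \<epsilon>' \<le> 6 * (norm \<theta> + 1) * \<epsilon>'" using \<epsilon>' by (intro mult_right_mono) auto
    also have "\<dots> = \<epsilon> / 2" using t1 by (simp add: \<epsilon>'_def field_simps)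
    finally show ?thesis .
  qed
  obtain K where K: "0 < K"
    and tail: "\<And>t. 0 \<le> t \<Longrightarrow> (\<integral>\<^sup>+w. ennreal (indicator {K<..} (norm (m t w)) * norm (m t w)) \<partial>P) \<le> ennreal \<epsilon>'"
    using uniform_tail[OF \<epsilon>'] by blast
  define \<xi> where "\<xi> w = \<theta> \<bullet> X w" for w
  have [measurable]: "\<xi> \<in> P \<rightarrow>\<^sub>M borel" unfolding \<xi>_def by measurable
  have \<xi>i: "integrable P \<xi>" unfolding \<xi>_def using X_int by simp
  define R where "R n w = iexp (h n * \<xi> w) - 1 - \<i> * (h n * \<xi> w)" for n w
  have [measurable]: "R n \<in> P \<rightarrow>\<^sub>M borel" for n unfolding R_def by measurable
  \<comment> \<open>The linear bound supplies the integrable majorant, and the quadratic bound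
    \<open>Rb2\<close> supplies the pointwise limit; \<xi> is integrable but possibly not square
    integrable.\<close>
  have Rb1: "cmod (R n w) / h n \<le> 2 * \<bar>\<xi> w\<bar>" for n w
    using iexp_approx2[of "h n * \<xi> w" 1] h[of n]
    by (simp add: R_def diff_diff_eq abs_mult field_simps)
  have Rb2: "cmod (R n w) / h n \<le> h n * (\<xi> w)\<^sup>2 / 2" for n w
    using iexp_approx1[of "h n * \<xi> w" 1] h[of n]
    by (simp add: R_def diff_diff_eq abs_mult field_simps power2_eq_square)
  have "(\<lambda>n. \<integral>w. cmod (R n w) / h n \<partial>P) \<longlonglongrightarrow> (\<integral>w. 0 \<partial>P)"
  proof (rule integral_dominated_convergence[where w="\<lambda>w. 2 * \<bar>\<xi> w\<bar>"])
    show "AE w in P. (\<lambda>n. cmod (R n w) / h n) \<longlonglongrightarrow> 0"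
    proof (rule AE_I2)
      fix w
      have "(\<lambda>n. h n * (\<xi> w)\<^sup>2 / 2) \<longlonglongrightarrow> 0 * (\<xi> w)\<^sup>2 / 2" by (intro tendsto_intros hl) simp
      then have "(\<lambda>n. h n * (\<xi> w)\<^sup>2 / 2) \<longlonglongrightarrow> 0" by simp
      moreover have "\<forall>n. norm (cmod (R n w) / h n) \<le> h n * (\<xi> w)\<^sup>2 / 2"
        using Rb2 h by (simp only: real_norm_def abs_divide abs_norm_cancel abs_of_pos simp_thms)
      ultimately show "(\<lambda>n. cmod (R n w) / h n) \<longlonglongrightarrow> 0"
        by (rule Lim_null_comparison[OF always_eventually, rotated])
    qed
    show "AE w in P. norm (cmod (R n w) / h n) \<le> 2 * \<bar>\<xi> w\<bar>" for n
      using Rb1[of n] h[of n] by (simp only: real_norm_def abs_divide abs_norm_cancel abs_of_pos) simp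
  qed (use \<xi>i in auto)
  then have lR: "(\<lambda>n. (\<integral>w. cmod (R n w) \<partial>P) / h n) \<longlonglongrightarrow> 0" by simp
  have lq: "(\<lambda>n. q \<theta> (h n)) \<longlonglongrightarrow> 1"
  proof -
    have "(\<lambda>n. exp (- (h n * (norm \<theta>)\<^sup>2) / 2)) \<longlonglongrightarrow> exp (- (0 * (norm \<theta>)\<^sup>2) / 2)"
      by (intro tendsto_intros hl) simp
    then show ?thesis by (simp add: q_def)
  qed
  have l\<psi>: "(\<lambda>n. \<psi> \<theta> (h n)) \<longlonglongrightarrow> 1"
  proof -
    have "(\<lambda>n. \<integral>w. iexp (h n * \<xi> w) \<partial>P) \<longlonglongrightarrow> (\<integral>w. 1 \<partial>P)"
    proof (rule integral_dominated_convergence[where w="\<lambda>_. 1"])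
      show "AE w in P. (\<lambda>n. iexp (h n * \<xi> w)) \<longlonglongrightarrow> 1"
      proof (rule AE_I2)
        fix w
        have "(\<lambda>n. iexp (h n * \<xi> w)) \<longlonglongrightarrow> iexp (0 * \<xi> w)" by (intro tendsto_intros hl)
        then show "(\<lambda>n. iexp (h n * \<xi> w)) \<longlonglongrightarrow> 1" by simp
      qed
    qed auto
    then show ?thesis by (simp add: \<psi>_def \<xi>_def prob_space)
  qed
  \<comment> \<open>The bound of \<open>step_error\<close> divided by the step length, without the
    term in \<epsilon>'.\<close>
  define err where "err n = (1 - q \<theta> (h n)) * (\<integral>w. \<bar>\<xi> w\<bar> \<partial>P) + (\<integral>w. cmod (R n w) \<partial>P) / h n
      + 2 * (norm \<theta> * K)\<^sup>2 * h n + norm \<theta> * K * sqrt (2 - 2 * Re (q \<theta> (h n) * \<psi> \<theta> (h n)))" for n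
  have "err \<longlonglongrightarrow> (1 - 1) * (\<integral>w. \<bar>\<xi> w\<bar> \<partial>P) + 0 + 2 * (norm \<theta> * K)\<^sup>2 * 0
      + norm \<theta> * K * sqrt (2 - 2 * Re (complex_of_real 1 * 1))"
    unfolding err_def by (intro tendsto_intros lq l\<psi> lR hl)
  then have "err \<longlonglongrightarrow> 0" by simp
  then have "\<forall>\<^sub>F n in sequentially. err n < \<epsilon> / 2" using \<epsilon> by (intro order_tendstoD(2)) auto
  then show ?thesis
  proof eventually_elim
    case (elim n)
    show ?case unfolding step_close_def h_def[symmetric]
    proof (intro allI impI ballI)
      fix u :: real and \<Gamma> :: "'w \<Rightarrow> complex" assume u: "0 \<le> u" and \<Gamma>: "\<Gamma> \<in> F u \<rightarrow>\<^sub>M borel" "\<forall>w. cmod (\<Gamma> w) \<le> 1"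
      have "cmod ((\<integral>w. \<Gamma> w * iexp (\<theta> \<bullet> (c (u + h n) w - c u w - drift u (h n) w)) \<partial>P) - q \<theta> (h n) * (\<integral>w. \<Gamma> w \<partial>P))
         \<le> (1 - q \<theta> (h n)) * h n * (\<integral>w. \<bar>\<xi> w\<bar> \<partial>P) + (\<integral>w. cmod (R n w) \<partial>P)
          + 2 * (norm \<theta> * (h n * K))\<^sup>2 + 6 * norm \<theta> * (h n * \<epsilon>')
          + norm \<theta> * (h n * K) * sqrt (2 - 2 * Re (q \<theta> (h n) * \<psi> \<theta> (h n)))"
        unfolding \<xi>_def R_def
        by (rule step_error[OF u h \<Gamma>(1) _ K less_imp_le[OF \<epsilon>'] tail]) (use \<Gamma>(2) in auto)
      also have "\<dots> = (err n + 6 * norm \<theta> * \<epsilon>') * h n"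
        using h[of n] by (simp add: err_def distrib_right power_mult_distrib power2_eq_square)
      also have "\<dots> \<le> \<epsilon> * h n"
        using elim e6 h[of n] by (intro mult_right_mono) auto
      finally show "cmod ((\<integral>w. \<Gamma> w * iexp (\<theta> \<bullet> (c (u + h n) w - c u w - drift u (h n) w)) \<partial>P) - q \<theta> (h n) * (\<integral>w. \<Gamma> w \<partial>P))
         \<le> \<epsilon> * h n" .
    qed
  qed
qed

section \<open>The compensated process has independent Gaussian increments\<close>

definition noise :: "real \<Rightarrow> 'w \<Rightarrow> 'a" where
  "noise t w = c t w - drift 0 t w"

lemma noise_adapted:
  assumes "0 \<le> s" "s \<le> t" shows "noise s \<in> F t \<rightarrow>\<^sub>M borel"
proof -
  have "drift 0 s \<in> F s \<rightarrow>\<^sub>M borel"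
    using m_prog[OF assms(1)] unfolding drift_def[abs_def] set_lebesgue_integral_def
    by (intro lborel.borel_measurable_lebesgue_integral) simp
  then have "noise s \<in> F s \<rightarrow>\<^sub>M borel"
    unfolding noise_def[abs_def] using c_adapted[OF assms(1)] by (rule borel_measurable_diff[rotated])
  then show ?thesis
    by (rule measurable_from_subalg[rotated])
       (use sets_F_mono[OF assms(2)] in \<open>auto simp: subalgebra_def space_F\<close>)
qed

lemma noise_meas: "0 \<le> s \<Longrightarrow> noise s \<in> P \<rightarrow>\<^sub>M borel"
  using measurable_from_subalg[OF sub noise_adapted[OF _ order_refl]] .

text \<open>Along a partition of \<open>{s..t}\<close> into \<open>Suc n\<close> equal steps, each
  step multiplies the partial expectation by \<open>q\<close>, up to \<epsilon> times the step
  length. As \<open>q\<close> lies between 0 and 1, earlier errors are not amplified and add up to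
  \<epsilon> times the total length, while the powers of \<open>q\<close> give the exact Gaussian
  factor.\<close>

lemma noise_char:
  assumes s: "0 \<le> s" and st: "s < t" and A: "A \<in> sets (F s)"
  shows "(\<integral>w. indicator A w * iexp (\<theta> \<bullet> (noise t w - noise s w)) \<partial>P)
    = complex_of_real (prob A * exp (- ((t - s) * (norm \<theta>)\<^sup>2) / 2))"
proof -
  define d where "d = t - s"
  have d: "0 < d" using st by (simp add: d_def)
  define \<phi> where "\<phi> n k = (\<integral>w. indicator A w * iexp (\<theta> \<bullet> (noise (s + real k * (d / Suc n)) w - noise s w)) \<partial>P)" for n k
  have AP: "A \<in> sets P" using subsets[OF s] A by auto
  have step: "cmod (\<phi> n (Suc k) - q \<theta> (d / Suc n) * \<phi> n k) \<le> \<epsilon> * (d / Suc n)"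
    if n: "step_close \<theta> (d / Suc n) \<epsilon>" for \<epsilon> n k
  proof -
    define h where "h = d / Suc n"
    have h: "0 < h" using d by (simp add: h_def)
    define u where "u = s + real k * h"
    have u: "0 \<le> u" "s \<le> u" using s h by (auto simp: u_def)
    \<comment> \<open>The event and the increment accumulated since \<open>s\<close> form an
      admissible weight: known at time \<open>u\<close> and bounded by 1.\<close>
    define \<Gamma> where "\<Gamma> w = indicator A w * iexp (\<theta> \<bullet> (noise u w - noise s w))" for w
    have Au: "A \<in> sets (F u)" using A sets_F_mono[OF u(2)] by auto
    note [measurable] = noise_adapted[OF u(1) order_refl] noise_adapted[OF s u(2)] Au
    have \<Gamma>: "\<Gamma> \<in> F u \<rightarrow>\<^sub>M borel" unfolding \<Gamma>_def by measurable
    have \<Gamma>1: "\<forall>w. cmod (\<Gamma> w) \<le> 1" by (auto simp: \<Gamma>_def norm_mult indicator_def)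
    have eq: "\<phi> n (Suc k) = (\<integral>w. \<Gamma> w * iexp (\<theta> \<bullet> (c (u + h) w - c u w - drift u h w)) \<partial>P)"
    proof -
      have uh: "s + real (Suc k) * h = u + h" by (simp add: u_def distrib_right)
      have "noise (u + h) \<in> P \<rightarrow>\<^sub>M borel" "noise u \<in> P \<rightarrow>\<^sub>M borel" "noise s \<in> P \<rightarrow>\<^sub>M borel"
        "c (u + h) \<in> P \<rightarrow>\<^sub>M borel" "c u \<in> P \<rightarrow>\<^sub>M borel" "drift u h \<in> P \<rightarrow>\<^sub>M borel"
        using u s h by (auto intro!: noise_meas c_meas drift_meas)
      moreover have "\<Gamma> \<in> P \<rightarrow>\<^sub>M borel" by (rule measurable_from_subalg[OF sub[OF u(1)] \<Gamma>])
      note [measurable] = calculation this AP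
      show ?thesis
        unfolding \<phi>_def h_def[symmetric] uh
      proof (rule integral_cong_AE)
        show "AE w in P. indicator A w * iexp (\<theta> \<bullet> (noise (u + h) w - noise s w)) =
            \<Gamma> w * iexp (\<theta> \<bullet> (c (u + h) w - c u w - drift u h w))"
          using drift_add[OF u(1) less_imp_le[OF h]]
        proof eventually_elim
          case (elim w)
          have "noise (u + h) w - noise s w = (noise u w - noise s w) + (c (u + h) w - c u w - drift u h w)"
            by (simp add: noise_def elim)
          then show ?case
            by (simp only: \<Gamma>_def inner_add_right of_real_add distrib_left exp_add mult.assoc)
        qed
      qed measurable
    qed
    have "\<phi> n k = (\<integral>w. \<Gamma> w \<partial>P)" by (simp add: \<phi>_def \<Gamma>_def u_def h_def)
    then show ?thesis
      using n u(1) \<Gamma> \<Gamma>1 unfolding eq h_def[symmetric] step_close_def by simp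
  qed
  have bound: "cmod (\<phi> n (Suc n) - of_real (exp (- (d * (norm \<theta>)\<^sup>2) / 2)) * \<phi> n 0) \<le> \<epsilon> * d"
    if n: "step_close \<theta> (d / Suc n) \<epsilon>" for \<epsilon> n
  proof -
    define Q where "Q = q \<theta> (d / Suc n)"
    have Q: "0 \<le> Q" "Q \<le> 1" using d by (auto simp: Q_def q_def)
    have "cmod (\<phi> n k - of_real (Q ^ k) * \<phi> n 0) \<le> real k * (\<epsilon> * (d / Suc n))" for k
    proof (induction k)
      case (Suc k)
      have "\<phi> n (Suc k) - of_real (Q ^ Suc k) * \<phi> n 0
        = (\<phi> n (Suc k) - Q * \<phi> n k) + Q * (\<phi> n k - of_real (Q ^ k) * \<phi> n 0)"
        by (simp add: algebra_simps)
      then have "cmod (\<phi> n (Suc k) - of_real (Q ^ Suc k) * \<phi> n 0)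
        \<le> cmod (\<phi> n (Suc k) - Q * \<phi> n k) + Q * cmod (\<phi> n k - of_real (Q ^ k) * \<phi> n 0)"
        using norm_triangle_ineq[of "\<phi> n (Suc k) - Q * \<phi> n k"] Q by (metis abs_of_nonneg norm_mult norm_of_real)
      also have "\<dots> \<le> \<epsilon> * (d / Suc n) + 1 * cmod (\<phi> n k - of_real (Q ^ k) * \<phi> n 0)"
        using Q by (intro add_mono mult_right_mono step[OF n, folded Q_def]) auto
      also have "\<dots> \<le> \<epsilon> * (d / Suc n) + real k * (\<epsilon> * (d / Suc n))" using Suc by simp
      finally show ?case by (simp only: of_nat_Suc distrib_right mult_1)
    qed simp
    from this[of "Suc n"] have "cmod (\<phi> n (Suc n) - of_real (Q ^ Suc n) * \<phi> n 0) \<le> real (Suc n) * (\<epsilon> * (d / Suc n))" .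
    also have "Q ^ Suc n = exp (real (Suc n) * (- (d / Suc n * (norm \<theta>)\<^sup>2) / 2))"
      unfolding Q_def q_def exp_of_nat_mult ..
    also have "real (Suc n) * (- (d / Suc n * (norm \<theta>)\<^sup>2) / 2) = - (d * (norm \<theta>)\<^sup>2) / 2" by (simp add: field_simps)
    also have "real (Suc n) * (\<epsilon> * (d / Suc n)) = \<epsilon> * d" by (simp add: field_simps)
    finally show ?thesis .
  qed
  define L where "L = (\<integral>w. indicator A w * iexp (\<theta> \<bullet> (noise t w - noise s w)) \<partial>P)"
  have \<phi>L: "\<phi> n (Suc n) = L" for n
  proof -
    have "s + real (Suc n) * (d / real (Suc n)) = t" by (simp add: d_def del: of_nat_Suc)
    then show ?thesis by (simp only: \<phi>_def L_def)
  qed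
  have \<phi>0: "\<phi> n 0 = complex_of_real (prob A)" for n
  proof -
    have "\<phi> n 0 = (\<integral>w. complex_of_real (indicator A w) \<partial>P)"
      unfolding \<phi>_def by (intro Bochner_Integration.integral_cong) (auto simp: indicator_def)
    then show ?thesis using AP by (simp add: integral_complex_of_real)
  qed
  have "cmod (L - of_real (exp (- (d * (norm \<theta>)\<^sup>2) / 2)) * complex_of_real (prob A)) \<le> \<epsilon>" if \<epsilon>: "0 < \<epsilon>" for \<epsilon>
  proof -
    have "0 < \<epsilon> / d" using \<epsilon> d by simp
    from eventually_happens'[OF sequentially_bot uniform_step_error[OF d this, of \<theta>]]
    obtain n where n: "step_close \<theta> (d / Suc n) (\<epsilon> / d)" by blast
    from bound[OF n] show ?thesis using d by (simp add: \<phi>L \<phi>0)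
  qed
  then have "cmod (L - of_real (exp (- (d * (norm \<theta>)\<^sup>2) / 2)) * complex_of_real (prob A)) \<le> 0"
    by (rule field_le_epsilon[of _ 0, simplified])
  then show ?thesis by (simp add: L_def d_def mult.commute)
qed

text \<open>For a fixed event \<open>A\<close>, both sides of the product formula are finite
  measures in \<open>D\<close>, and \<open>noise_char\<close> says that their characteristic
  functions coincide.\<close>

theorem noise_gaussian_indep:
  assumes s: "0 \<le> s" and st: "s < t"
  shows "gaussian_indep P (F s) (\<lambda>w. noise t w - noise s w) (sqrt (t - s))"
proof -
  define Y where "Y w = noise t w - noise s w" for w
  have [measurable]: "noise t \<in> P \<rightarrow>\<^sub>M borel" "noise s \<in> P \<rightarrow>\<^sub>M borel"
    using s st by (auto intro: noise_meas)
  have Ym[measurable]: "Y \<in> P \<rightarrow>\<^sub>M borel" unfolding Y_def by measurable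
  have r: "0 < sqrt (t - s)" using st by simp
  interpret G: prob_space "gaussian_measure (sqrt (t - s)) :: 'a measure"
    using r by (rule prob_space_gaussian_measure)
  have "emeasure P (A \<inter> (Y -` D \<inter> space P)) = emeasure P A * emeasure (gaussian_measure (sqrt (t - s))) D"
    if A: "A \<in> sets (F s)" and D: "D \<in> sets borel" for A D
  proof -
    have AP[measurable]: "A \<in> sets P" using subsets[OF s] A by auto
    \<comment> \<open>The law of the increment restricted to \<open>A\<close>, left unnormalised so
      that events of probability 0 fit in.\<close>
    define \<mu> where "\<mu> = distr (density P (\<lambda>w. ennreal (indicator A w))) borel Y"
    define \<nu> where "\<nu> = density (gaussian_measure (sqrt (t - s)) :: 'a measure) (\<lambda>_. ennreal (prob A))"
    have \<mu>D: "emeasure \<mu> D = emeasure P (A \<inter> (Y -` D \<inter> space P))" if "D \<in> sets borel" for D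
    proof -
      have "emeasure \<mu> D = (\<integral>\<^sup>+w. ennreal (indicator A w) * indicator (Y -` D \<inter> space P) w \<partial>P)"
        using that by (simp add: \<mu>_def emeasure_distr emeasure_density)
      also have "\<dots> = (\<integral>\<^sup>+w. indicator (A \<inter> (Y -` D \<inter> space P)) w \<partial>P)"
        by (intro nn_integral_cong) (auto simp: indicator_def)
      also have "\<dots> = emeasure P (A \<inter> (Y -` D \<inter> space P))"
        using AP measurable_sets[OF Ym that] by (intro nn_integral_indicator) auto
      finally show ?thesis .
    qed
    have \<nu>D: "emeasure \<nu> D = emeasure P A * emeasure (gaussian_measure (sqrt (t - s))) D" if "D \<in> sets borel" for D
      using that by (simp add: \<nu>_def emeasure_density nn_integral_cmult_indicator emeasure_eq_measure)
    have "\<mu> = \<nu>"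
    proof (rule measure_eqI_char)
      show "sets \<mu> = sets borel" "sets \<nu> = sets borel" by (simp_all add: \<mu>_def \<nu>_def)
      then have [simp]: "space \<mu> = UNIV" "space \<nu> = UNIV" by (auto dest: sets_eq_imp_space_eq)
      show "finite_measure \<mu>" by (rule finite_measureI) (simp add: \<mu>D emeasure_eq_measure)
      show "finite_measure \<nu>" by (rule finite_measureI) (simp add: \<nu>D emeasure_eq_measure G.emeasure_eq_measure flip: ennreal_mult)
      fix \<theta> :: 'a
      have "(\<integral>x. iexp (\<theta> \<bullet> x) \<partial>\<mu>) = (\<integral>w. iexp (\<theta> \<bullet> Y w) \<partial>density P (\<lambda>w. ennreal (indicator A w)))"
        unfolding \<mu>_def by (rule integral_distr) auto
      also have "\<dots> = (\<integral>w. indicator A w * iexp (\<theta> \<bullet> Y w) \<partial>P)"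
        by (subst integral_density) (auto simp: scaleR_conv_of_real intro!: Bochner_Integration.integral_cong split: split_indicator)
      also have "\<dots> = complex_of_real (prob A) * complex_of_real (exp (- ((t - s) * (norm \<theta>)\<^sup>2) / 2))"
        using noise_char[OF s st A, of \<theta>] by (simp add: Y_def)
      also have "\<dots> = (\<integral>x. iexp (\<theta> \<bullet> x) \<partial>\<nu>)"
        using char_gaussian_measure[OF r, of \<theta>] st unfolding \<nu>_def
        by (subst integral_density) (auto simp: scaleR_conv_of_real)
      finally show "(\<integral>x. iexp (\<theta> \<bullet> x) \<partial>\<mu>) = (\<integral>x. iexp (\<theta> \<bullet> x) \<partial>\<nu>)" .
    qed
    then show ?thesis using \<mu>D[OF D] \<nu>D[OF D] by simp
  qed
  then show ?thesis unfolding gaussian_indep_def Y_def[symmetric] using Ym by auto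
qed

end

section \<open>The Schroedinger bridge as a density\<close>

text \<open>Data processing for \<open>KL\<close> by Gibbs' inequality: with \<open>f = dQ/dW\<close>, the bound
  \<open>ln (g \<circ> T) \<le> ln f - 1 + (g \<circ> T) / f\<close> is integrated against \<open>Q\<close>, and the left-hand side
  depends on \<open>Q\<close> only through the law of \<open>T\<close>.\<close>

lemma KL_density_comp_le:
  fixes g :: "'b \<Rightarrow> real"
  assumes W: "prob_space W" and Q: "prob_space Q" "sets Q = sets W"
    and T[measurable]: "T \<in> W \<rightarrow>\<^sub>M S" and g[measurable]: "g \<in> borel_measurable S" and g0: "\<And>x. 0 \<le> g x"
    and R: "prob_space (density W (\<lambda>w. ennreal (g (T w))))"
    and law: "distr Q S T = distr (density W (\<lambda>w. ennreal (g (T w)))) S T"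
  shows "KL (density W (\<lambda>w. ennreal (g (T w)))) W \<le> KL Q W"
proof (cases "absolutely_continuous W Q \<and> integrable Q (entropy_density (exp 1) W Q)")
  case False
  then show ?thesis by (auto simp: KL_def)
next
  case True
  then have ac: "absolutely_continuous W Q" and ent: "integrable Q (entropy_density (exp 1) W Q)" by auto
  interpret W: prob_space W by fact
  interpret Q: prob_space Q by fact
  define R where "R = density W (\<lambda>w. ennreal (g (T w)))"
  interpret R: prob_space R using R by (simp add: R_def)
  note law = law[folded R_def]
  have [measurable_cong]: "sets Q = sets W" "sets R = sets W" using Q(2) by (simp_all add: R_def)
  have [simp]: "space Q = space W" using sets_eq_imp_space_eq[OF Q(2)] .
  define f where "f w = enn2real (RN_deriv W Q w)" for w
  have [measurable]: "f \<in> borel_measurable W" unfolding f_def by measurable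
  have f0: "0 \<le> f w" for w by (simp add: f_def)
  have fin: "AE w in W. RN_deriv W Q w \<noteq> \<infinity>"
    by (rule W.RN_deriv_finite[OF Q.sigma_finite_measure_axioms ac Q(2)])
  have Qf: "Q = density W (\<lambda>w. ennreal (f w))"
  proof -
    have "Q = density W (RN_deriv W Q)" using W.density_RN_deriv[OF ac Q(2)] by simp
    also have "\<dots> = density W (\<lambda>w. ennreal (f w))"
      by (rule density_cong) (use fin in \<open>auto simp: f_def less_top\<close>)
    finally show ?thesis .
  qed
  have lnf: "entropy_density (exp 1) W Q = (\<lambda>w. ln (f w))"
    by (simp add: entropy_density_def f_def fun_eq_iff log_def)
  have iQf: "integrable Q (\<lambda>w. ln (f w))" using ent by (simp add: lnf)
  \<comment> \<open>\<open>Q\<close> and \<open>R\<close> give \<open>T\<close> the same law, so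
    statements about \<open>T\<close> alone transfer between them.\<close>
  have AE_law: "(AE w in Q. p (T w)) \<longleftrightarrow> (AE w in R. p (T w))" if [measurable]: "Measurable.pred S p" for p
    using AE_distr_iff[of T Q S p] AE_distr_iff[of T R S p] unfolding law by simp
  have f_pos: "AE w in Q. 0 < f w"
    unfolding Qf by (subst AE_density) (auto simp: f0 ennreal_eq_0_iff less_le)
  have g_pos_R: "AE w in R. 0 < g (T w)"
    unfolding R_def by (subst AE_density) (auto simp: g0 ennreal_eq_0_iff less_le)
  then have g_pos: "AE w in Q. 0 < g (T w)" using AE_law[of "\<lambda>x. 0 < g x"] by simp
  have W1: "(\<integral>\<^sup>+w. ennreal (g (T w)) \<partial>W) = 1"
    using R.emeasure_space_1 by (simp add: R_def emeasure_density cong: nn_integral_cong)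
  \<comment> \<open>Only an inequality: where \<open>f\<close> vanishes the quotient is 0 by
    convention, while \<open>g (T w)\<close> may be positive.\<close>
  have gf: "(\<integral>\<^sup>+w. ennreal (g (T w) / f w) \<partial>Q) \<le> 1"
  proof -
    have "(\<integral>\<^sup>+w. ennreal (g (T w) / f w) \<partial>Q) = (\<integral>\<^sup>+w. ennreal (f w) * ennreal (g (T w) / f w) \<partial>W)"
      unfolding Qf by (rule nn_integral_density) measurable
    also have "\<dots> \<le> (\<integral>\<^sup>+w. ennreal (g (T w)) \<partial>W)"
      by (intro nn_integral_mono) (auto simp: f0 g0 divide_nonneg_nonneg simp flip: ennreal_mult)
    finally show ?thesis by (simp add: W1)
  qed
  have igf: "integrable Q (\<lambda>w. g (T w) / f w)"
    using gf by (intro integrableI_bounded) (auto simp: f0 g0 le_less_trans[OF _ ennreal_one_less_top])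
  have gf1: "(\<integral>w. g (T w) / f w \<partial>Q) \<le> 1"
    using gf igf by (subst (asm) nn_integral_eq_integral) (auto simp: f0 g0)
  \<comment> \<open>Finiteness is seen under \<open>R\<close>, where the weight
    \<open>g (T w)\<close> cancels. It makes the lower bound \<open>lo\<close> integrable.\<close>
  have ginv: "(\<integral>\<^sup>+w. ennreal (1 / g (T w)) \<partial>Q) \<le> 1"
  proof -
    have "(\<integral>\<^sup>+w. ennreal (1 / g (T w)) \<partial>Q) = (\<integral>\<^sup>+x. ennreal (1 / g x) \<partial>distr Q S T)"
      by (simp add: nn_integral_distr)
    also have "\<dots> = (\<integral>\<^sup>+w. ennreal (1 / g (T w)) \<partial>R)"
      unfolding law by (simp add: nn_integral_distr)
    also have "\<dots> = (\<integral>\<^sup>+w. ennreal (g (T w)) * ennreal (1 / g (T w)) \<partial>W)"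
      unfolding R_def by (rule nn_integral_density) measurable
    also have "\<dots> \<le> (\<integral>\<^sup>+w. 1 \<partial>W)"
      by (intro nn_integral_mono) (auto simp: g0 simp flip: ennreal_mult)
    finally show ?thesis by (simp add: W.emeasure_space_1)
  qed
  have iginv: "integrable Q (\<lambda>w. 1 / g (T w))"
    using ginv by (intro integrableI_bounded) (auto simp: g0 le_less_trans[OF _ ennreal_one_less_top])
  have up: "AE w in Q. ln (g (T w)) \<le> ln (f w) - 1 + g (T w) / f w"
    using f_pos g_pos
  proof eventually_elim
    case (elim w)
    then show ?case using ln_le_minus_one[of "g (T w) / f w"] by (simp add: ln_div)
  qed
  have lo: "AE w in Q. 1 - 1 / g (T w) \<le> ln (g (T w))"
    using g_pos
  proof eventually_elim
    case (elim w)
    then show ?case using ln_le_minus_one[of "1 / g (T w)"] by (simp add: ln_div)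
  qed
  have iQ: "integrable Q (\<lambda>w. ln (g (T w)))"
  proof (rule Bochner_Integration.integrable_bound)
    show "integrable Q (\<lambda>w. \<bar>ln (f w) - 1 + g (T w) / f w\<bar> + \<bar>1 - 1 / g (T w)\<bar>)"
      using iQf igf iginv by auto
    show "AE w in Q. norm (ln (g (T w))) \<le> norm (\<bar>ln (f w) - 1 + g (T w) / f w\<bar> + \<bar>1 - 1 / g (T w)\<bar>)"
      using up lo by eventually_elim (auto simp: abs_if)
  qed measurable
  have le: "(\<integral>w. ln (g (T w)) \<partial>Q) \<le> (\<integral>w. ln (f w) \<partial>Q)"
  proof -
    have "(\<integral>w. ln (g (T w)) \<partial>Q) \<le> (\<integral>w. ln (f w) - 1 + g (T w) / f w \<partial>Q)"
      using iQ iQf igf up by (intro integral_mono_AE) auto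
    also have "\<dots> = (\<integral>w. ln (f w) \<partial>Q) - 1 + (\<integral>w. g (T w) / f w \<partial>Q)"
      using iQf igf Q.prob_space by simp
    finally show ?thesis using gf1 by simp
  qed
  \<comment> \<open>\<open>ln (g (T w))\<close> depends on \<open>w\<close> through \<open>T\<close>
    alone, so its integrals under \<open>Q\<close> and \<open>R\<close> coincide; under
    \<open>R\<close> it is the log-density, and its integral is the relative entropy of
    \<open>R\<close>.\<close>
  have iR: "integrable R (\<lambda>w. ln (g (T w)))"
    using iQ integrable_distr_eq[of T Q S "\<lambda>x. ln (g x)"] integrable_distr_eq[of T R S "\<lambda>x. ln (g x)"] law
    by simp
  have eqR: "(\<integral>w. ln (g (T w)) \<partial>Q) = (\<integral>w. ln (g (T w)) \<partial>R)"
    using integral_distr[of T Q S "\<lambda>x. ln (g x)"] integral_distr[of T R S "\<lambda>x. ln (g x)"] law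
    by simp
  have RN: "AE w in W. ennreal (g (T w)) = RN_deriv W R w"
    by (rule W.RN_deriv_unique) (auto simp: R_def)
  have "AE w in W. entropy_density (exp 1) W R w = ln (g (T w))"
    using RN
  proof eventually_elim
    case (elim w)
    show ?case unfolding entropy_density_def comp_def elim[symmetric] by (simp add: g0 log_def)
  qed
  then have eR: "AE w in R. entropy_density (exp 1) W R w = ln (g (T w))"
    by (subst (2) R_def, subst AE_density) auto
  have em: "entropy_density (exp 1) W R \<in> borel_measurable R"
    using measurable_entropy_density[of "exp 1" W R] by (simp add: R_def)
  have entR: "integrable R (entropy_density (exp 1) W R)"
    by (rule integrable_cong_AE_imp[OF iR em]) (use eR in \<open>auto elim: eventually_mono\<close>)
  have entR': "(\<integral>w. entropy_density (exp 1) W R w \<partial>R) = (\<integral>w. ln (g (T w)) \<partial>R)"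
    by (rule integral_cong_AE[OF em _ eR]) measurable
  have acR: "absolutely_continuous W R" unfolding R_def by (rule absolutely_continuousI_density) measurable
  have "KL R W = ereal (\<integral>w. ln (g (T w)) \<partial>R)"
    using acR entR entR' by (simp add: KL_def KL_divergence_def)
  also have "\<dots> \<le> ereal (\<integral>w. ln (f w) \<partial>Q)" using le by (simp add: eqR)
  also have "\<dots> = KL Q W" using True by (simp add: KL_def KL_divergence_def lnf)
  finally show ?thesis by (simp add: R_def)
qed

context
  fixes W :: "(real \<Rightarrow> 'a::euclidean_space) measure"
  assumes W: "wiener_measure W"
begin

lemma sets_wiener: "sets W = sets (path_space {0..1})"
  using W by (simp add: wiener_measure_def)

lemma space_wiener: "space W = {w \<in> extensional {0..1}. continuous_on {0..1} w}"
  using sets_eq_imp_space_eq[OF sets_wiener] by (simp add: space_path_space)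

lemma wiener_component: "t \<in> {0..1} \<Longrightarrow> (\<lambda>w. w t) \<in> W \<rightarrow>\<^sub>M borel"
  using measurable_path_space_component[of t "{0..1}"] by (simp add: measurable_cong_sets[OF sets_wiener refl])

lemma prob_space_wiener: "prob_space W"
  using W by (simp add: wiener_measure_def wiener_process_def)

lemma wiener_0: "AE w in W. w 0 = 0"
  using W by (simp add: wiener_measure_def wiener_process_def)

lemma wiener_increment:
  assumes "0 \<le> s" "s < t" "t \<le> 1"
  shows "gaussian_indep W (natural_filtration (space W) {0..1} (\<lambda>t w. w t) s) (\<lambda>w. w t - w s) (sqrt (t - s))"
proof (subst gaussian_indep_iff[OF prob_space_wiener])
  show "subalgebra W (natural_filtration (space W) {0..1} (\<lambda>t w. w t) s)"
    by (rule subalgebra_natural_filtration) (rule wiener_component)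
qed (use W assms in \<open>auto simp: wiener_measure_def wiener_process_def\<close>)

lemma distr_wiener_1: "distr W borel (\<lambda>w. w 1) = gaussian_measure 1"
proof (rule measure_eqI)
  interpret prob_space W by (rule prob_space_wiener)
  let ?N = "natural_filtration (space W) {0..1} (\<lambda>t w. w t) 0"
  note [measurable] = wiener_component[of 0, simplified] wiener_component[of 1, simplified]
  fix D assume "D \<in> sets (distr W borel (\<lambda>w. w 1))"
  then have D[measurable]: "D \<in> sets (borel :: 'a measure)" by simp
  have sp: "space W \<in> sets ?N" using sets.top[of ?N] by simp
  have "emeasure (distr W borel (\<lambda>w. w 1)) D = emeasure W ((\<lambda>w. w 1) -` D \<inter> space W)"
    by (simp add: emeasure_distr)
  also have "\<dots> = emeasure W (space W \<inter> ((\<lambda>w. w 1 - w 0) -` D \<inter> space W))"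
  proof (rule emeasure_eq_AE)
    show "AE w in W. (w \<in> (\<lambda>w. w 1) -` D \<inter> space W) = (w \<in> space W \<inter> ((\<lambda>w. w 1 - w 0) -` D \<inter> space W))"
      using wiener_0 by eventually_elim auto
  qed measurable
  also have "\<dots> = emeasure (gaussian_measure 1) D"
    using wiener_increment[of 0 1] sp D by (auto simp: gaussian_indep_def emeasure_space_1 dest: bspec[of _ _ "space W"])
  finally show "emeasure (distr W borel (\<lambda>w. w 1)) D = emeasure (gaussian_measure 1) D" .
qed simp

text \<open>Feasibility fixes the terminal law of every competitor, so
  \<open>KL_density_comp_le\<close> applies with evaluation at time 1 as the statistic. The
  candidate is itself feasible: absolute continuity preserves the start at 0, and the Gaussian
  density cancels in the terminal law.\<close>

lemma bridge_optimal_eq: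
  fixes \<pi>0 :: "'a \<Rightarrow> real"
  assumes \<pi>[measurable]: "\<pi>0 \<in> borel_measurable borel" and pos: "\<And>x. 0 \<le> \<pi>0 x"
    and \<pi>1: "prob_space (density lborel (\<lambda>x. ennreal (\<pi>0 x)))"
    and opt: "bridge_optimal W \<pi>0 P"
  shows "P = density W (\<lambda>w. ennreal (\<pi>0 (w 1) / gaussian_density 1 (w 1)))"
proof -
  note w01 = wiener_component[of 0, simplified] wiener_component[of 1, simplified]
  interpret W: prob_space W by (rule prob_space_wiener)
  define g where "g x = \<pi>0 x / gaussian_density 1 x" for x
  have [measurable]: "g \<in> borel_measurable borel" unfolding g_def by measurable
  have g0: "0 \<le> g x" for x by (simp add: g_def pos gaussian_density_nonneg)
  define R where "R = density W (\<lambda>w. ennreal (g (w 1)))"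
  have w01R: "(\<lambda>w. w 0) \<in> R \<rightarrow>\<^sub>M borel" "(\<lambda>w. w 1) \<in> R \<rightarrow>\<^sub>M borel"
    using w01 by (simp_all add: R_def)
  have gW: "(\<lambda>w. ennreal (g (w 1))) \<in> borel_measurable W"
    using w01(2) by (intro measurable_compose[OF w01(2), of "\<lambda>x. ennreal (g x)"]) simp
  have lawR: "distr R borel (\<lambda>w. w 1) = density lborel (\<lambda>x. ennreal (\<pi>0 x))"
  proof -
    have "distr R borel (\<lambda>w. w 1) = density (distr W borel (\<lambda>w. w 1)) (\<lambda>x. ennreal (g x))"
      unfolding R_def by (rule density_distr[symmetric]) (simp_all add: w01)
    also have "\<dots> = density lborel (\<lambda>x. ennreal (gaussian_density 1 x) * ennreal (g x))"
      unfolding distr_wiener_1 gaussian_measure_def by (rule density_density_eq) measurable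
    also have "(\<lambda>x. ennreal (gaussian_density 1 x) * ennreal (g x)) = (\<lambda>x. ennreal (\<pi>0 x))"
    proof
      fix x :: 'a
      have "gaussian_density 1 x \<noteq> 0" using gaussian_density_pos[of 1 x] by simp
      then show "ennreal (gaussian_density 1 x) * ennreal (g x) = ennreal (\<pi>0 x)"
        unfolding ennreal_mult[OF gaussian_density_nonneg g0, symmetric] by (simp add: g_def)
    qed
    finally show ?thesis .
  qed
  have R1: "prob_space R"
  proof (rule prob_spaceI)
    have "emeasure R (space R) = emeasure (distr R borel (\<lambda>w. w 1)) (space borel)"
      by (subst emeasure_distr) (simp_all add: w01R)
    also have "\<dots> = 1" unfolding lawR using prob_space.emeasure_space_1[OF \<pi>1] by simp
    finally show "emeasure R (space R) = 1" .
  qed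
  interpret R: prob_space R by (rule R1)
  have feas: "bridge_feasible \<pi>0 R"
    unfolding bridge_feasible_def
  proof (intro conjI)
    show "prob_space R" by (rule R1)
    show "sets R = sets (path_space {0..1})" by (simp add: R_def sets_wiener)
    show "distr R borel (\<lambda>w. w 1) = density lborel (\<lambda>x. ennreal (\<pi>0 x))" by (rule lawR)
    show "distr R borel (\<lambda>w. w 0) = return borel 0"
    proof -
      have "AE w in R. w 0 = 0" unfolding R_def using wiener_0 by (subst AE_density) (auto simp: gW)
      then have "distr R borel (\<lambda>w. w 0) = distr R borel (\<lambda>w. 0)"
        by (intro distr_cong_AE) (simp_all add: w01R)
      then show ?thesis by (simp add: R.distr_const)
    qed
  qed
  have "KL R W \<le> KL Q W" if Q: "bridge_feasible \<pi>0 Q" for Q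
    unfolding R_def
  proof (rule KL_density_comp_le[where T="\<lambda>w. w 1" and S=borel])
    show "distr Q borel (\<lambda>w. w 1) = distr (density W (\<lambda>w. ennreal (g (w 1)))) borel (\<lambda>w. w 1)"
      using Q lawR by (simp add: bridge_feasible_def R_def)
  qed (use Q R1 g0 w01 in \<open>auto simp: bridge_feasible_def R_def sets_wiener prob_space_wiener\<close>)
  then have "is_arg_min (\<lambda>Q. KL Q W) (bridge_feasible \<pi>0) R"
    using feas by (simp add: is_arg_min_linorder)
  then show ?thesis using opt by (auto simp: bridge_optimal_def R_def g_def)
qed

end

section \<open>Gaussian bridges and tilted measures\<close>

lemma nn_integral_lborel_translate:
  fixes f :: "'a::euclidean_space \<Rightarrow> ennreal"
  assumes [measurable]: "f \<in> borel_measurable borel"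
  shows "(\<integral>\<^sup>+x. f (z + x) \<partial>lborel) = (\<integral>\<^sup>+x. f x \<partial>lborel)"
proof -
  have "(\<integral>\<^sup>+x. f x \<partial>lborel) = (\<integral>\<^sup>+x. f x \<partial>distr lborel borel ((+) z))" by (simp add: lborel_distr_plus)
  also have "\<dots> = (\<integral>\<^sup>+x. f (z + x) \<partial>lborel)" by (subst nn_integral_distr) auto
  finally show ?thesis ..
qed

lemma integral_lborel_translate:
  fixes f :: "'a::euclidean_space \<Rightarrow> 'b::{banach, second_countable_topology}"
  assumes [measurable]: "f \<in> borel_measurable borel"
  shows "(\<integral>x. f (z + x) \<partial>lborel) = (\<integral>x. f x \<partial>lborel)"
proof -
  have "(\<integral>x. f x \<partial>lborel) = (\<integral>x. f x \<partial>distr lborel borel ((+) z))" by (simp add: lborel_distr_plus)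
  also have "\<dots> = (\<integral>x. f (z + x) \<partial>lborel)" by (subst integral_distr) auto
  finally show ?thesis ..
qed

text \<open>A non-integrable function has integral 0 by convention, so the bound holds in every
  case. Tilted means are estimated with it along every path, also where the mean is such a default
  value.\<close>

lemma norm_integral_le_nn_integral:
  fixes f :: "'a \<Rightarrow> 'b::{banach, second_countable_topology}"
  shows "ennreal (norm (integral\<^sup>L M f)) \<le> (\<integral>\<^sup>+x. ennreal (norm (f x)) \<partial>M)"
  by (cases "integrable M f") (auto simp: integral_norm_bound_ennreal not_integrable_integral_eq)

lemma gaussian_fourier_shifted:
  fixes \<eta> :: "'a::euclidean_space" assumes s: "0 < s"
  shows "(\<integral>a. iexp (\<eta> \<bullet> a) * complex_of_real (gaussian_density s (a - z)) \<partial>lborel)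
     = iexp (\<eta> \<bullet> z) * complex_of_real (exp (- (s\<^sup>2 * (norm \<eta>)\<^sup>2) / 2))"
proof -
  have "(\<integral>a. iexp (\<eta> \<bullet> a) * complex_of_real (gaussian_density s (a - z)) \<partial>lborel)
      = (\<integral>a. iexp (\<eta> \<bullet> (z + a)) * complex_of_real (gaussian_density s ((z + a) - z)) \<partial>lborel)"
    by (rule integral_lborel_translate[symmetric]) measurable
  also have "\<dots> = (\<integral>a. iexp (\<eta> \<bullet> z) * (iexp (\<eta> \<bullet> a) * complex_of_real (gaussian_density s a)) \<partial>lborel)"
    by (simp add: inner_add_right distrib_left exp_add mult.assoc)
  finally show ?thesis by (simp only: integral_mult_right_zero gaussian_fourier[OF s])
qed

text \<open>The first of two independent Gaussian increments is integrated out conditionally on their sum.\<close>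

lemma gaussian_bridge_fourier:
  fixes H :: "'a::euclidean_space \<Rightarrow> complex"
  assumes pos: "0 < p" "0 < r" and [measurable]: "H \<in> borel_measurable borel"
    and fin: "(\<integral>\<^sup>+y. ennreal (cmod (H y)) \<partial>gaussian_measure (sqrt (p + r))) < \<infinity>"
  shows "(\<integral>a. iexp (\<eta> \<bullet> a) * (\<integral>y. H (a + y) \<partial>gaussian_measure (sqrt r)) \<partial>gaussian_measure (sqrt p))
    = complex_of_real (exp (- (p * r / (p + r) * (norm \<eta>)\<^sup>2) / 2))
      * (\<integral>y. iexp (p / (p + r) * (\<eta> \<bullet> y)) * H y \<partial>gaussian_measure (sqrt (p + r)))"
proof -
  define s where "s = sqrt (p * r / (p + r))"
  define \<rho> where "\<rho> = p / (p + r)"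
  have s: "0 < s" using pos by (simp add: s_def)
  have pr: "0 < p + r" using pos by simp
  define g where "g = (\<lambda>(a, x). iexp (\<eta> \<bullet> a) * H x * complex_of_real (gaussian_density (sqrt p) a * gaussian_density (sqrt r) (x - a)))"
  have g_eq: "g (a, x) = (H x * complex_of_real (gaussian_density (sqrt (p + r)) x))
      * (iexp (\<eta> \<bullet> a) * complex_of_real (gaussian_density s (a - \<rho> *\<^sub>R x)))" for a x
    unfolding g_def by (simp add: gaussian_density_bridge[OF pos] s_def \<rho>_def)
  have [measurable]: "g \<in> borel_measurable (lborel \<Otimes>\<^sub>M lborel)" unfolding g_def by measurable
  have shift1: "(\<integral>\<^sup>+a. ennreal (gaussian_density s (a - z)) \<partial>lborel) = 1" for z :: 'a
    using nn_integral_lborel_translate[of "\<lambda>a. ennreal (gaussian_density s (a - z))" z] nn_integral_gaussian_density[OF s, where ?'a='a]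
    by simp
  have "(\<integral>\<^sup>+x. ennreal (cmod (g x)) \<partial>(lborel \<Otimes>\<^sub>M lborel)) = (\<integral>\<^sup>+x. (\<integral>\<^sup>+a. ennreal (cmod (g (a, x))) \<partial>lborel) \<partial>lborel)"
    by (subst lborel_pair.nn_integral_snd[symmetric]) auto
  also have "\<dots> = (\<integral>\<^sup>+x. (\<integral>\<^sup>+a. ennreal (cmod (H x) * gaussian_density (sqrt (p + r)) x) * ennreal (gaussian_density s (a - \<rho> *\<^sub>R x)) \<partial>lborel) \<partial>lborel)"
    by (intro nn_integral_cong) (simp add: g_eq norm_mult gaussian_density_nonneg flip: ennreal_mult)
  also have "\<dots> = (\<integral>\<^sup>+x. ennreal (cmod (H x) * gaussian_density (sqrt (p + r)) x) \<partial>lborel)"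
    by (simp add: nn_integral_cmult shift1)
  also have "\<dots> = (\<integral>\<^sup>+y. ennreal (cmod (H y)) \<partial>gaussian_measure (sqrt (p + r)))"
    by (simp add: nn_integral_gaussian_measure ennreal_mult gaussian_density_nonneg mult.commute)
  finally have gi: "integrable (lborel \<Otimes>\<^sub>M lborel) g" using fin by (intro integrableI_bounded) auto
  have "(\<integral>a. iexp (\<eta> \<bullet> a) * (\<integral>y. H (a + y) \<partial>gaussian_measure (sqrt r)) \<partial>gaussian_measure (sqrt p))
    = (\<integral>a. (\<integral>x. g (a, x) \<partial>lborel) \<partial>lborel)"
  proof -
    have "gaussian_density (sqrt p) a *\<^sub>R (iexp (\<eta> \<bullet> a) * (\<integral>y. H (a + y) \<partial>gaussian_measure (sqrt r))) = (\<integral>x. g (a, x) \<partial>lborel)" for a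
    proof -
      have "(\<integral>y. H (a + y) \<partial>gaussian_measure (sqrt r)) = (\<integral>y. gaussian_density (sqrt r) ((a + y) - a) *\<^sub>R H (a + y) \<partial>lborel)"
        by (subst integral_gaussian_measure) auto
      also have "\<dots> = (\<integral>x. gaussian_density (sqrt r) (x - a) *\<^sub>R H x \<partial>lborel)"
        by (rule integral_lborel_translate) measurable
      finally have "gaussian_density (sqrt p) a *\<^sub>R (iexp (\<eta> \<bullet> a) * (\<integral>y. H (a + y) \<partial>gaussian_measure (sqrt r)))
        = (gaussian_density (sqrt p) a *\<^sub>R iexp (\<eta> \<bullet> a)) * (\<integral>x. gaussian_density (sqrt r) (x - a) *\<^sub>R H x \<partial>lborel)" by simp
      also have "\<dots> = (\<integral>x. (gaussian_density (sqrt p) a *\<^sub>R iexp (\<eta> \<bullet> a)) * (gaussian_density (sqrt r) (x - a) *\<^sub>R H x) \<partial>lborel)"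
        by (rule integral_mult_right_zero[symmetric])
      also have "\<dots> = (\<integral>x. g (a, x) \<partial>lborel)"
        by (intro Bochner_Integration.integral_cong) (auto simp: g_def scaleR_conv_of_real)
      finally show ?thesis .
    qed
    moreover have "(\<lambda>a. iexp (\<eta> \<bullet> a) * (\<integral>y. H (a + y) \<partial>gaussian_measure (sqrt r))) \<in> borel_measurable borel"
    proof -
      interpret G: prob_space "gaussian_measure (sqrt r) :: 'a measure"
        by (rule prob_space_gaussian_measure) (use pos in simp)
      show ?thesis by measurable
    qed
    ultimately show ?thesis by (simp add: integral_gaussian_measure)
  qed
  also have "\<dots> = (\<integral>x. (\<integral>a. g (a, x) \<partial>lborel) \<partial>lborel)"
    using lborel_pair.Fubini_integral[of "\<lambda>a x. g (a, x)"] gi by simp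
  also have "\<dots> = (\<integral>x. complex_of_real (exp (- (s\<^sup>2 * (norm \<eta>)\<^sup>2) / 2)) * (gaussian_density (sqrt (p + r)) x *\<^sub>R (iexp (\<rho> * (\<eta> \<bullet> x)) * H x)) \<partial>lborel)"
  proof (intro Bochner_Integration.integral_cong refl)
    fix x :: 'a
    have "(\<integral>a. g (a, x) \<partial>lborel) = (H x * complex_of_real (gaussian_density (sqrt (p + r)) x))
        * (iexp (\<eta> \<bullet> (\<rho> *\<^sub>R x)) * complex_of_real (exp (- (s\<^sup>2 * (norm \<eta>)\<^sup>2) / 2)))"
      by (simp only: g_eq integral_mult_right_zero gaussian_fourier_shifted[OF s])
    then show "(\<integral>a. g (a, x) \<partial>lborel) = complex_of_real (exp (- (s\<^sup>2 * (norm \<eta>)\<^sup>2) / 2))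
        * (gaussian_density (sqrt (p + r)) x *\<^sub>R (iexp (\<rho> * (\<eta> \<bullet> x)) * H x))"
      by (simp only: scaleR_conv_of_real inner_scaleR_right ac_simps)
  qed
  also have "\<dots> = complex_of_real (exp (- (s\<^sup>2 * (norm \<eta>)\<^sup>2) / 2)) * (\<integral>y. iexp (\<rho> * (\<eta> \<bullet> y)) * H y \<partial>gaussian_measure (sqrt (p + r)))"
    by (simp only: integral_mult_right_zero) (subst integral_gaussian_measure, auto)
  also have "s\<^sup>2 = p * r / (p + r)" using pos by (simp add: s_def)
  finally show ?thesis unfolding \<rho>_def .
qed

section \<open>Tilt weights and their normalisation\<close>

definition tilt_weight :: "('a::euclidean_space \<Rightarrow> real) \<Rightarrow> real \<Rightarrow> 'a \<Rightarrow> 'a \<Rightarrow> real" where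
  "tilt_weight \<pi>0 t c x = exp (c \<bullet> x - t / 2 * (norm x)\<^sup>2) * \<pi>0 x"

locale prior =
  fixes \<pi>0 :: "'a::euclidean_space \<Rightarrow> real"
  assumes \<pi>_meas [measurable]: "\<pi>0 \<in> borel_measurable borel" and \<pi>_nonneg: "\<And>x. 0 \<le> \<pi>0 x"
    and \<pi>_prob: "prob_space (density lborel (\<lambda>x. ennreal (\<pi>0 x)))"
begin

lemma weight_nonneg: "0 \<le> tilt_weight \<pi>0 t c x"
  by (simp add: tilt_weight_def \<pi>_nonneg)

lemma weight_measurable [measurable]: "tilt_weight \<pi>0 t c \<in> borel_measurable borel"
  unfolding tilt_weight_def by measurable

definition Z :: "real \<Rightarrow> 'a \<Rightarrow> real" where
  "Z t c = (\<integral>x. tilt_weight \<pi>0 t c x \<partial>lborel)"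

lemma Z_measurable [measurable]: "Z t \<in> borel_measurable borel"
  unfolding Z_def[abs_def] tilt_weight_def by measurable

lemma tilted_measure_eq: "tilted_measure \<pi>0 t c = density lborel (\<lambda>x. ennreal (tilt_weight \<pi>0 t c x / Z t c))"
  by (simp add: tilted_measure_def tilt_weight_def Z_def)

lemma nn_integral_\<pi>: "(\<integral>\<^sup>+x. ennreal (\<pi>0 x) \<partial>lborel) = 1"
  using prob_space.emeasure_space_1[OF \<pi>_prob] by (simp add: emeasure_density)

text \<open>Expand the square of \<open>norm (c - t *\<^sub>R x)\<close>. For positive t the
  quadratic term dominates any tilt; at t = 0 the tilt must be 0, as \<open>\<pi>0\<close> may lack
  exponential moments, and the exponent on the right is then 0 / 0 = 0.\<close>

lemma weight_le:
  assumes "0 < t \<or> t = 0 \<and> c = 0"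
  shows "tilt_weight \<pi>0 t c x \<le> exp ((norm c)\<^sup>2 / (2 * t)) * \<pi>0 x"
proof -
  have "c \<bullet> x - t / 2 * (norm x)\<^sup>2 \<le> (norm c)\<^sup>2 / (2 * t)"
  proof (cases "0 < t")
    case True
    have "0 \<le> (norm (c - t *\<^sub>R x))\<^sup>2" by simp
    also have "\<dots> = (norm c)\<^sup>2 - 2 * t * (c \<bullet> x) + t\<^sup>2 * (norm x)\<^sup>2"
      unfolding power2_norm_eq_inner
      by (simp add: inner_diff_left inner_diff_right inner_commute power2_eq_square algebra_simps)
    finally have "2 * t * (c \<bullet> x - t / 2 * (norm x)\<^sup>2) \<le> (norm c)\<^sup>2"
      by (simp add: power2_eq_square algebra_simps)
    then show ?thesis using True by (simp add: field_simps)
  qed (use assms in auto)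
  then show ?thesis by (simp add: tilt_weight_def mult_right_mono \<pi>_nonneg)
qed

text \<open>Finiteness comes from \<open>weight_le\<close>. The exponential factor never vanishes,
  so a null weight would force \<open>\<pi>0\<close> to be null, against its total mass 1.\<close>

lemma
  assumes tc: "0 < t \<or> t = 0 \<and> c = 0"
  shows Z_pos: "0 < Z t c"
    and nn_integral_weight: "(\<integral>\<^sup>+x. ennreal (tilt_weight \<pi>0 t c x) \<partial>lborel) = ennreal (Z t c)"
proof -
  have "(\<integral>\<^sup>+x. ennreal (tilt_weight \<pi>0 t c x) \<partial>lborel) \<le> (\<integral>\<^sup>+x. ennreal (exp ((norm c)\<^sup>2 / (2 * t))) * ennreal (\<pi>0 x) \<partial>lborel)"
    using weight_le[OF tc] by (intro nn_integral_mono) (simp add: \<pi>_nonneg flip: ennreal_mult)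
  also have "\<dots> < \<infinity>" by (simp add: nn_integral_cmult nn_integral_\<pi>)
  finally have "integrable lborel (tilt_weight \<pi>0 t c)"
    by (intro integrableI_bounded) (auto simp: weight_nonneg)
  then show eq: "(\<integral>\<^sup>+x. ennreal (tilt_weight \<pi>0 t c x) \<partial>lborel) = ennreal (Z t c)"
    unfolding Z_def by (intro nn_integral_eq_integral) (auto simp: weight_nonneg)
  have "0 \<le> Z t c" unfolding Z_def by (intro Bochner_Integration.integral_nonneg) (simp add: weight_nonneg)
  moreover have "Z t c \<noteq> 0"
  proof
    assume "Z t c = 0"
    then have "(\<integral>\<^sup>+x. ennreal (tilt_weight \<pi>0 t c x) \<partial>lborel) = 0" using eq by simp
    then have "AE x in lborel. ennreal (tilt_weight \<pi>0 t c x) = 0"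
      by (simp add: nn_integral_0_iff_AE)
    then have "AE x in lborel. ennreal (\<pi>0 x) = 0"
      by eventually_elim (auto simp: tilt_weight_def ennreal_eq_0_iff mult_le_0_iff not_le dest: leD)
    then have "(\<integral>\<^sup>+x. ennreal (\<pi>0 x) \<partial>lborel) = 0" by (simp add: nn_integral_0_iff_AE)
    then show False by (simp add: nn_integral_\<pi>)
  qed
  ultimately show "0 < Z t c" by simp
qed

lemma nn_integral_tilted:
  assumes [measurable]: "\<psi> \<in> borel_measurable borel" and tc: "0 < t \<or> t = 0 \<and> c = 0"
  shows "ennreal (Z t c) * (\<integral>\<^sup>+x. \<psi> x \<partial>tilted_measure \<pi>0 t c) = (\<integral>\<^sup>+x. ennreal (tilt_weight \<pi>0 t c x) * \<psi> x \<partial>lborel)"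
proof -
  have "ennreal (Z t c) * (\<integral>\<^sup>+x. \<psi> x \<partial>tilted_measure \<pi>0 t c)
     = ennreal (Z t c) * (\<integral>\<^sup>+x. ennreal (tilt_weight \<pi>0 t c x / Z t c) * \<psi> x \<partial>lborel)"
    unfolding tilted_measure_eq by (subst nn_integral_density) auto
  also have "\<dots> = (\<integral>\<^sup>+x. ennreal (Z t c) * (ennreal (tilt_weight \<pi>0 t c x / Z t c) * \<psi> x) \<partial>lborel)"
    by (rule nn_integral_cmult[symmetric]) measurable
  also have "\<dots> = (\<integral>\<^sup>+x. ennreal (tilt_weight \<pi>0 t c x) * \<psi> x \<partial>lborel)"
    using Z_pos[OF tc] weight_nonneg[of t c]
    by (intro nn_integral_cong) (simp add: mult.assoc[symmetric] flip: ennreal_mult)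
  finally show ?thesis .
qed

lemma measurable_nn_integral_tilted [measurable]:
  assumes [measurable]: "\<psi> \<in> borel_measurable borel"
  shows "(\<lambda>c. \<integral>\<^sup>+x. \<psi> x \<partial>tilted_measure \<pi>0 t c) \<in> borel_measurable borel"
proof -
  have "(\<integral>\<^sup>+x. \<psi> x \<partial>tilted_measure \<pi>0 t c) = (\<integral>\<^sup>+x. ennreal (tilt_weight \<pi>0 t c x / Z t c) * \<psi> x \<partial>lborel)" for c
    unfolding tilted_measure_eq by (subst nn_integral_density) auto
  then show ?thesis unfolding tilt_weight_def by simp
qed

end

section \<open>The terminal value of the bridge given its past\<close>

locale bridge = prior \<pi>0 for \<pi>0 :: "'a::euclidean_space \<Rightarrow> real" +
  fixes W P :: "(real \<Rightarrow> 'a) measure"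
  assumes wiener: "wiener_measure W" and optimal: "bridge_optimal W \<pi>0 P"
    and mean: "integrable (density lborel (\<lambda>x. ennreal (\<pi>0 x))) (\<lambda>x. x)"
begin

definition N :: "real \<Rightarrow> (real \<Rightarrow> 'a) measure" where
  "N = natural_filtration (space W) {0..1} (\<lambda>t w. w t)"

definition dens :: "'a \<Rightarrow> real" where
  "dens x = \<pi>0 x / gaussian_density 1 x"

sublocale W: prob_space W
  using wiener by (rule prob_space_wiener)

lemma dens_nonneg: "0 \<le> dens x"
  by (simp add: dens_def \<pi>_nonneg gaussian_density_nonneg)

lemma dens_measurable [measurable]: "dens \<in> borel_measurable borel"
  unfolding dens_def by measurable

lemma P_eq: "P = density W (\<lambda>w. ennreal (dens (w 1)))"
  unfolding dens_def by (rule bridge_optimal_eq[OF wiener \<pi>_meas \<pi>_nonneg \<pi>_prob optimal])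

lemma sets_P [measurable_cong, simp]: "sets P = sets W"
  by (simp add: P_eq)

lemma space_P [simp]: "space P = space W"
  by (simp add: P_eq)

lemma feasible: "bridge_feasible \<pi>0 P"
  using optimal unfolding bridge_optimal_def is_arg_min_def by (rule conjunct1[THEN conjunct1])

sublocale P: prob_space P
  using feasible unfolding bridge_feasible_def by (rule conjunct1)

lemma distr_P_1: "distr P borel (\<lambda>w. w 1) = density lborel (\<lambda>x. ennreal (\<pi>0 x))"
  using feasible unfolding bridge_feasible_def by (elim conjE)

lemma component_W: "0 \<le> t \<Longrightarrow> t \<le> 1 \<Longrightarrow> (\<lambda>w. w t) \<in> W \<rightarrow>\<^sub>M borel"
  using wiener_component[OF wiener] by auto

lemma component_N: "0 \<le> s \<Longrightarrow> s \<le> t \<Longrightarrow> s \<le> 1 \<Longrightarrow> (\<lambda>w. w s) \<in> N t \<rightarrow>\<^sub>M borel"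
  unfolding N_def by (rule measurable_natural_filtration_component) auto

lemma space_N [simp]: "space (N t) = space W"
  by (simp add: N_def)

lemma subalgebra_W: "subalgebra W (N t)"
  unfolding N_def by (rule subalgebra_natural_filtration) (use component_W in auto)

lemma subalgebra_P: "subalgebra P (N t)"
  using subalgebra_W[of t] by (simp add: subalgebra_def)

lemma filtration_N: "filtration (space W) N"
  unfolding N_def by (rule filtration_natural_filtration)

lemma N_mono: "s \<le> t \<Longrightarrow> f \<in> N s \<rightarrow>\<^sub>M S \<Longrightarrow> f \<in> N t \<rightarrow>\<^sub>M S"
  by (rule measurable_from_subalg[rotated])
     (use filtration.sets_F_mono[OF filtration_N] in \<open>auto simp: subalgebra_def\<close>)

lemma increment: "0 \<le> s \<Longrightarrow> s < t \<Longrightarrow> t \<le> 1 \<Longrightarrow> gaussian_indep W (N s) (\<lambda>w. w t - w s) (sqrt (t - s))"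
  unfolding N_def by (rule wiener_increment[OF wiener])

lemma dens_1_measurable: "(\<lambda>w. ennreal (dens (w 1))) \<in> borel_measurable W"
  by (rule measurable_compose[OF component_W[of 1], of "\<lambda>x. ennreal (dens x)"]) simp_all

lemma AE_P:
  assumes "AE w in W. p w"
  shows "AE w in P. p w"
  unfolding P_eq AE_density[OF dens_1_measurable] using assms by eventually_elim simp

text \<open>The factor by which \<open>\<pi>0 x\<close> times the Gaussian transition density from \<open>z\<close> at time \<open>\<tau>\<close> to
  \<open>x\<close> at time \<open>1\<close>, relative to the density of \<open>N(0, I)\<close>, differs from the tilt weight.\<close>

definition tilt_factor :: "real \<Rightarrow> 'a \<Rightarrow> real" where
  "tilt_factor \<tau> z = (1 / sqrt (2 * pi * (1 - \<tau>))) ^ DIM('a) / (1 / sqrt (2 * pi)) ^ DIM('a)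
     * exp (- (norm z)\<^sup>2 / (2 * (1 - \<tau>)))"

text \<open>This is where the time change originates. The factor exp(|x|^2 / 2) from dividing by the
  standard Gaussian leaves the coefficient -\<tau> / (2 (1 - \<tau>)) on |x|^2, and the transition
  density leaves the linear term z / (1 - \<tau>); these are -t / 2 and the tilt.\<close>

lemma dens_transition:
  assumes \<tau>: "0 \<le> \<tau>" "\<tau> < 1"
  shows "dens x * gaussian_density (sqrt (1 - \<tau>)) (x - z)
    = tilt_factor \<tau> z * tilt_weight \<pi>0 (\<tau> / (1 - \<tau>)) ((1 / (1 - \<tau>)) *\<^sub>R z) x"
proof -
  have "- (norm (x - z))\<^sup>2 / (2 * (1 - \<tau>)) + (norm x)\<^sup>2 / 2
      = - (norm z)\<^sup>2 / (2 * (1 - \<tau>)) + (((1 / (1 - \<tau>)) *\<^sub>R z) \<bullet> x - \<tau> / (1 - \<tau>) / 2 * (norm x)\<^sup>2)"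
  proof -
    have *: "- (a - 2 * b + c) / (2 * d) + a / 2 = - c / (2 * d) + (b / d - (1 - d) / d / 2 * a)"
      if "d \<noteq> 0" for a b c d :: real
      using that by (simp add: divide_simps) algebra
    have "(norm (x - z))\<^sup>2 = (norm x)\<^sup>2 - 2 * (z \<bullet> x) + (norm z)\<^sup>2"
      unfolding power2_norm_eq_inner by (simp add: inner_diff_left inner_diff_right inner_commute)
    then show ?thesis
      using *[of "1 - \<tau>" "(norm x)\<^sup>2" "z \<bullet> x" "(norm z)\<^sup>2"] \<tau> by simp
  qed
  then have e: "exp (- (norm (x - z))\<^sup>2 / (2 * (1 - \<tau>))) * exp ((norm x)\<^sup>2 / 2)
     = exp (- (norm z)\<^sup>2 / (2 * (1 - \<tau>))) * exp (((1 / (1 - \<tau>)) *\<^sub>R z) \<bullet> x - \<tau> / (1 - \<tau>) / 2 * (norm x)\<^sup>2)"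
    by (simp only: exp_add[symmetric])
  define u v where "u = (1 / sqrt (2 * pi)) ^ DIM('a)" and "v = (1 / sqrt (2 * pi * (1 - \<tau>))) ^ DIM('a)"
  have g1: "gaussian_density 1 x = u * exp (- ((norm x)\<^sup>2 / 2))"
    by (simp add: gaussian_density_norm u_def)
  have d: "dens x = \<pi>0 x / u * exp ((norm x)\<^sup>2 / 2)"
    unfolding dens_def g1 exp_minus inverse_eq_divide by simp
  have g: "gaussian_density (sqrt (1 - \<tau>)) (x - z) = v * exp (- (norm (x - z))\<^sup>2 / (2 * (1 - \<tau>)))"
    using \<tau> by (simp add: gaussian_density_norm v_def)
  have "dens x * gaussian_density (sqrt (1 - \<tau>)) (x - z)
     = \<pi>0 x / u * v * (exp (- (norm (x - z))\<^sup>2 / (2 * (1 - \<tau>))) * exp ((norm x)\<^sup>2 / 2))"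
    unfolding d g by simp
  then show ?thesis
    unfolding e tilt_factor_def tilt_weight_def u_def[symmetric] v_def[symmetric] by simp
qed

lemma tilt_factor_nonneg: "\<tau> < 1 \<Longrightarrow> 0 \<le> tilt_factor \<tau> z"
  by (simp add: tilt_factor_def)

lemma tilt_factor_measurable [measurable]: "tilt_factor \<tau> \<in> borel_measurable borel"
  unfolding tilt_factor_def[abs_def] by measurable

lemma nn_integral_P:
  assumes f[measurable]: "f \<in> borel_measurable W"
  shows "(\<integral>\<^sup>+w. f w \<partial>P) = (\<integral>\<^sup>+w. ennreal (dens (w 1)) * f w \<partial>W)"
  unfolding P_eq by (intro nn_integral_density dens_1_measurable f)

text \<open>Under \<open>W\<close>, the increment after \<tau> is integrated out with the past
  frozen, and \<open>dens_transition\<close> is applied at the endpoint. The factor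
  \<open>tilt_factor\<close> does not involve the endpoint, hence is the same for every
  \<open>\<psi>\<close>.\<close>

lemma nn_integral_future:
  assumes \<tau>: "0 \<le> \<tau>" "\<tau> < 1" and \<Gamma>[measurable]: "\<Gamma> \<in> borel_measurable (N \<tau>)"
    and \<psi>[measurable]: "\<psi> \<in> borel_measurable borel"
  shows "(\<integral>\<^sup>+w. \<Gamma> w * \<psi> (w 1) \<partial>P) = (\<integral>\<^sup>+w. \<Gamma> w * (ennreal (tilt_factor \<tau> (w \<tau>)) *
     (\<integral>\<^sup>+x. ennreal (tilt_weight \<pi>0 (\<tau> / (1 - \<tau>)) ((1 / (1 - \<tau>)) *\<^sub>R w \<tau>) x) * \<psi> x \<partial>lborel)) \<partial>W)"
proof -
  define e where "e = (\<lambda>w :: real \<Rightarrow> 'a. w \<tau>)"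
  define f where "f = (\<lambda>(w, y). ennreal (dens (e w + y)) * (\<Gamma> w * \<psi> (e w + y)))"
  have [measurable]: "e \<in> N \<tau> \<rightarrow>\<^sub>M borel" using component_N[of \<tau> \<tau>] \<tau> by (simp add: e_def)
  have fm: "f \<in> borel_measurable (N \<tau> \<Otimes>\<^sub>M borel)" unfolding f_def by measurable
  have "(\<lambda>w. \<Gamma> w * \<psi> (w 1)) \<in> borel_measurable W"
    by (intro borel_measurable_times_ennreal measurable_from_subalg[OF subalgebra_W \<Gamma>]
        measurable_compose[OF component_W \<psi>]) auto
  then have "(\<integral>\<^sup>+w. \<Gamma> w * \<psi> (w 1) \<partial>P) = (\<integral>\<^sup>+w. f (w, w 1 - w \<tau>) \<partial>W)"
    by (subst nn_integral_P) (simp_all add: f_def e_def)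
  also have "\<dots> = (\<integral>\<^sup>+w. (\<integral>\<^sup>+y. f (w, y) \<partial>gaussian_measure (sqrt (1 - \<tau>))) \<partial>W)"
    by (rule nn_integral_gaussian_indep[OF W.prob_space_axioms subalgebra_W _ increment fm]) (use \<tau> in auto)
  also have "\<dots> = (\<integral>\<^sup>+w. \<Gamma> w * (ennreal (tilt_factor \<tau> (w \<tau>)) *
     (\<integral>\<^sup>+x. ennreal (tilt_weight \<pi>0 (\<tau> / (1 - \<tau>)) ((1 / (1 - \<tau>)) *\<^sub>R w \<tau>) x) * \<psi> x \<partial>lborel)) \<partial>W)"
  proof (rule nn_integral_cong)
    fix w assume "w \<in> space W"
    then have [measurable]: "(\<lambda>y. f (w, y)) \<in> borel_measurable borel"
      by (intro measurable_Pair2[OF fm]) simp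
    have "(\<integral>\<^sup>+y. f (w, y) \<partial>gaussian_measure (sqrt (1 - \<tau>)))
      = (\<integral>\<^sup>+y. ennreal (gaussian_density (sqrt (1 - \<tau>)) ((w \<tau> + y) - w \<tau>)) * (ennreal (dens (w \<tau> + y)) * (\<Gamma> w * \<psi> (w \<tau> + y))) \<partial>lborel)"
      by (subst nn_integral_gaussian_measure) (simp_all add: f_def e_def)
    also have "\<dots> = (\<integral>\<^sup>+x. ennreal (gaussian_density (sqrt (1 - \<tau>)) (x - w \<tau>)) * (ennreal (dens x) * (\<Gamma> w * \<psi> x)) \<partial>lborel)"
      by (rule nn_integral_lborel_translate) measurable
    also have "\<dots> = (\<integral>\<^sup>+x. (\<Gamma> w * ennreal (tilt_factor \<tau> (w \<tau>))) * (ennreal (tilt_weight \<pi>0 (\<tau> / (1 - \<tau>)) ((1 / (1 - \<tau>)) *\<^sub>R w \<tau>) x) * \<psi> x) \<partial>lborel)"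
    proof (rule nn_integral_cong)
      fix x :: 'a
      have "ennreal (gaussian_density (sqrt (1 - \<tau>)) (x - w \<tau>)) * ennreal (dens x)
        = ennreal (tilt_factor \<tau> (w \<tau>)) * ennreal (tilt_weight \<pi>0 (\<tau> / (1 - \<tau>)) ((1 / (1 - \<tau>)) *\<^sub>R w \<tau>) x)"
        using dens_transition[OF \<tau>, of x "w \<tau>"] tilt_factor_nonneg[OF \<tau>(2)]
        by (simp add: gaussian_density_nonneg dens_nonneg weight_nonneg mult.commute flip: ennreal_mult)
      then show "ennreal (gaussian_density (sqrt (1 - \<tau>)) (x - w \<tau>)) * (ennreal (dens x) * (\<Gamma> w * \<psi> x))
        = (\<Gamma> w * ennreal (tilt_factor \<tau> (w \<tau>))) * (ennreal (tilt_weight \<pi>0 (\<tau> / (1 - \<tau>)) ((1 / (1 - \<tau>)) *\<^sub>R w \<tau>) x) * \<psi> x)"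
        by (metis mult.assoc mult.left_commute)
    qed
    also have "\<dots> = (\<Gamma> w * ennreal (tilt_factor \<tau> (w \<tau>))) * (\<integral>\<^sup>+x. (ennreal (tilt_weight \<pi>0 (\<tau> / (1 - \<tau>)) ((1 / (1 - \<tau>)) *\<^sub>R w \<tau>) x) * \<psi> x) \<partial>lborel)"
      by (rule nn_integral_cmult) measurable
    finally show "(\<integral>\<^sup>+y. f (w, y) \<partial>gaussian_measure (sqrt (1 - \<tau>))) = \<Gamma> w * (ennreal (tilt_factor \<tau> (w \<tau>)) *
     (\<integral>\<^sup>+x. ennreal (tilt_weight \<pi>0 (\<tau> / (1 - \<tau>)) ((1 / (1 - \<tau>)) *\<^sub>R w \<tau>) x) * \<psi> x \<partial>lborel))"
      by (simp add: mult.assoc)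
  qed
  finally show ?thesis .
qed

text \<open>At \<tau> = 0 the only admissible tilt is 0, and the path starts there almost
  surely.\<close>

lemma AE_admissible:
  assumes "0 \<le> \<tau>" "\<tau> < 1"
  shows "AE w in W. 0 < \<tau> / (1 - \<tau>) \<or> \<tau> / (1 - \<tau>) = 0 \<and> (1 / (1 - \<tau>)) *\<^sub>R w \<tau> = 0"
proof (cases "\<tau> = 0")
  case True
  show ?thesis using wiener_0[OF wiener] by eventually_elim (simp add: True)
qed (use assms in auto)

text \<open>Bayes' formula without division: \<open>nn_integral_future\<close> is used once for
  \<open>\<psi>\<close> and once for the constant 1, with the inner integral absorbed into the past
  weight. The second use produces the normalisation \<open>Z\<close>, and
  \<open>nn_integral_tilted\<close> equates the two results.\<close>

lemma nn_integral_P_tilted: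
  assumes \<tau>: "0 \<le> \<tau>" "\<tau> < 1" and \<Gamma>[measurable]: "\<Gamma> \<in> borel_measurable (N \<tau>)"
    and \<psi>[measurable]: "\<psi> \<in> borel_measurable borel"
  shows "(\<integral>\<^sup>+w. \<Gamma> w * \<psi> (w 1) \<partial>P)
    = (\<integral>\<^sup>+w. \<Gamma> w * (\<integral>\<^sup>+x. \<psi> x \<partial>tilted_measure \<pi>0 (\<tau> / (1 - \<tau>)) ((1 / (1 - \<tau>)) *\<^sub>R w \<tau>)) \<partial>P)"
proof -
  define t where "t = \<tau> / (1 - \<tau>)"
  define cc where "cc = (\<lambda>w :: real \<Rightarrow> 'a. (1 / (1 - \<tau>)) *\<^sub>R w \<tau>)"
  have [measurable]: "cc \<in> N \<tau> \<rightarrow>\<^sub>M borel"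
    using component_N[of \<tau> \<tau>] \<tau> by (simp add: cc_def)
  have m: "(\<lambda>w. \<Gamma> w * (\<integral>\<^sup>+x. \<psi> x \<partial>tilted_measure \<pi>0 t (cc w))) \<in> borel_measurable (N \<tau>)"
    by measurable
  have "(\<integral>\<^sup>+w. \<Gamma> w * (\<integral>\<^sup>+x. \<psi> x \<partial>tilted_measure \<pi>0 t (cc w)) \<partial>P)
    = (\<integral>\<^sup>+w. \<Gamma> w * (\<integral>\<^sup>+x. \<psi> x \<partial>tilted_measure \<pi>0 t (cc w)) * 1 \<partial>P)" by simp
  also have "\<dots> = (\<integral>\<^sup>+w. \<Gamma> w * (\<integral>\<^sup>+x. \<psi> x \<partial>tilted_measure \<pi>0 t (cc w)) * (ennreal (tilt_factor \<tau> (w \<tau>)) *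
     (\<integral>\<^sup>+x. ennreal (tilt_weight \<pi>0 t (cc w) x) * 1 \<partial>lborel)) \<partial>W)"
    using nn_integral_future[OF \<tau> m, of "\<lambda>_. 1"] by (simp add: t_def cc_def)
  also have "\<dots> = (\<integral>\<^sup>+w. \<Gamma> w * (ennreal (tilt_factor \<tau> (w \<tau>)) *
     (\<integral>\<^sup>+x. ennreal (tilt_weight \<pi>0 t (cc w) x) * \<psi> x \<partial>lborel)) \<partial>W)"
  proof (rule nn_integral_cong_AE)
    show "AE w in W. \<Gamma> w * (\<integral>\<^sup>+x. \<psi> x \<partial>tilted_measure \<pi>0 t (cc w)) * (ennreal (tilt_factor \<tau> (w \<tau>)) *
       (\<integral>\<^sup>+x. ennreal (tilt_weight \<pi>0 t (cc w) x) * 1 \<partial>lborel))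
      = \<Gamma> w * (ennreal (tilt_factor \<tau> (w \<tau>)) * (\<integral>\<^sup>+x. ennreal (tilt_weight \<pi>0 t (cc w) x) * \<psi> x \<partial>lborel))"
      using AE_admissible[OF \<tau>]
    proof eventually_elim
      case (elim w)
      then have tc: "0 < t \<or> t = 0 \<and> cc w = 0" by (simp add: t_def cc_def)
      show ?case
        unfolding nn_integral_tilted[OF \<psi> tc, symmetric]
        by (simp add: nn_integral_weight[OF tc] ac_simps)
    qed
  qed
  also have "\<dots> = (\<integral>\<^sup>+w. \<Gamma> w * \<psi> (w 1) \<partial>P)"
    using nn_integral_future[OF \<tau> \<Gamma> \<psi>] by (simp add: t_def cc_def)
  finally show ?thesis by (simp add: t_def cc_def)
qed

text \<open>A kernel must be defined at every tilt, also where the weight is not integrable. There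
  \<open>Z\<close> defaults to 0, division by 0 makes the density 0, and the measure is the zero
  measure.\<close>

lemma tilted_subprob: "subprob_space (tilted_measure \<pi>0 t c)"
proof (rule subprob_spaceI)
  have "(\<integral>\<^sup>+x. ennreal (tilt_weight \<pi>0 t c x / Z t c) \<partial>lborel) \<le> 1"
  proof (cases "integrable lborel (tilt_weight \<pi>0 t c)")
    case True
    have "(\<integral>\<^sup>+x. ennreal (tilt_weight \<pi>0 t c x / Z t c) \<partial>lborel) = ennreal (\<integral>x. tilt_weight \<pi>0 t c x / Z t c \<partial>lborel)"
      using True by (intro nn_integral_eq_integral)
        (auto intro!: divide_nonneg_nonneg weight_nonneg Bochner_Integration.integral_nonneg simp: Z_def)
    also have "\<dots> \<le> 1" using True by (simp add: Z_def[symmetric])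
    finally show ?thesis .
  next
    case False
    then show ?thesis by (simp add: Z_def not_integrable_integral_eq)
  qed
  then show "emeasure (tilted_measure \<pi>0 t c) (space (tilted_measure \<pi>0 t c)) \<le> 1"
    by (simp add: tilted_measure_eq emeasure_density)
qed (simp add: tilted_measure_def)

lemma cond_law_tilted:
  assumes \<tau>: "0 \<le> \<tau>" "\<tau> < 1"
  shows "cond_law P (\<lambda>v. v 1) (\<lambda>v. v \<tau>) (\<lambda>z. tilted_measure \<pi>0 (\<tau> / (1 - \<tau>)) ((1 / (1 - \<tau>)) *\<^sub>R z))"
proof -
  have emeas: "emeasure (tilted_measure \<pi>0 t c) A = (\<integral>\<^sup>+x. indicator A x \<partial>tilted_measure \<pi>0 t c)"
    if "A \<in> sets borel" for t c A
    using that by (subst nn_integral_indicator) (auto simp: tilted_measure_def)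
  define \<kappa> where "\<kappa> z = tilted_measure \<pi>0 (\<tau> / (1 - \<tau>)) ((1 / (1 - \<tau>)) *\<^sub>R z)" for z
  have em: "(\<lambda>z. emeasure (\<kappa> z) A) \<in> borel_measurable borel" if [measurable]: "A \<in> sets borel" for A
    unfolding \<kappa>_def emeas[OF that]
    by (rule measurable_compose[OF _ measurable_nn_integral_tilted]) measurable
  show ?thesis
    unfolding cond_law_def \<kappa>_def[symmetric]
  proof (intro conjI ballI)
    show "\<kappa> \<in> borel \<rightarrow>\<^sub>M subprob_algebra borel"
    proof (rule measurable_subprob_algebra)
      show "subprob_space (\<kappa> z)" for z unfolding \<kappa>_def by (rule tilted_subprob)
      show "sets (\<kappa> z) = sets borel" for z by (simp add: \<kappa>_def tilted_measure_def)
    qed (rule em)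
    fix A B :: "'a set" assume A[measurable]: "A \<in> sets borel" and B[measurable]: "B \<in> sets borel"
    have w\<tau>: "(\<lambda>w. w \<tau>) \<in> W \<rightarrow>\<^sub>M borel" and w1: "(\<lambda>w. w 1) \<in> W \<rightarrow>\<^sub>M borel"
      using component_W \<tau> by auto
    have "{w \<in> space P. w 1 \<in> A \<and> w \<tau> \<in> B} = (\<lambda>w. w 1) -` A \<inter> space W \<inter> ((\<lambda>w. w \<tau>) -` B \<inter> space W)" by auto
    also have "\<dots> \<in> sets W" using measurable_sets[OF w1 A] measurable_sets[OF w\<tau> B] by auto
    finally have S: "{w \<in> space P. w 1 \<in> A \<and> w \<tau> \<in> B} \<in> sets P" by simp
    have \<Gamma>: "(\<lambda>w. indicator B (w \<tau>) :: ennreal) \<in> borel_measurable (N \<tau>)"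
      using \<tau> by (intro measurable_compose[OF component_N, of \<tau>]) auto
    have "emeasure P {w \<in> space P. w 1 \<in> A \<and> w \<tau> \<in> B} = (\<integral>\<^sup>+w. indicator B (w \<tau>) * indicator A (w 1) \<partial>P)"
      unfolding nn_integral_indicator[OF S, symmetric] by (intro nn_integral_cong) (auto simp: indicator_def)
    also have "\<dots> = (\<integral>\<^sup>+w. indicator B (w \<tau>) * emeasure (\<kappa> (w \<tau>)) A \<partial>P)"
      unfolding \<kappa>_def emeas[OF A] by (rule nn_integral_P_tilted[OF \<tau> \<Gamma>]) measurable
    also have "\<dots> = (\<integral>\<^sup>+z. emeasure (\<kappa> z) A * indicator B z \<partial>distr P borel (\<lambda>v. v \<tau>))"
      by (subst nn_integral_distr) (use w\<tau> em[OF A] in \<open>auto simp: mult.commute cong: measurable_cong_sets\<close>)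
    finally show "emeasure P {w \<in> space P. w 1 \<in> A \<and> w \<tau> \<in> B} = (\<integral>\<^sup>+z\<in>B. emeasure (\<kappa> z) A \<partial>distr P borel (\<lambda>v. v \<tau>))" .
  qed
qed

end

section \<open>The time-changed bridge\<close>

context bridge
begin

lemma integral_P:
  fixes f :: "(real \<Rightarrow> 'a) \<Rightarrow> complex"
  assumes "f \<in> borel_measurable W"
  shows "(\<integral>w. f w \<partial>P) = (\<integral>w. dens (w 1) *\<^sub>R f w \<partial>W)"
  unfolding P_eq
  by (rule integral_density[OF assms])
     (auto simp: dens_nonneg intro!: measurable_compose[OF component_W dens_measurable])

lemma nn_integral_dens: "(\<integral>\<^sup>+w. ennreal (dens (w 1)) \<partial>W) = 1"
  using nn_integral_P[of "\<lambda>_. 1"] P.emeasure_space_1 by simp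

lemma dens_1_measurable': "(\<lambda>w. dens (w 1)) \<in> borel_measurable W"
  by (rule measurable_compose[OF component_W dens_measurable]) auto

text \<open>Given the path up to time \<open>\<sigma>\<close> and the terminal value \<open>x\<close>, the increment on the left-hand side is
  \<open>N(h x, h I)\<close>. For the proof, the density of \<open>P\<close> is integrated out against the increments on \<open>{\<tau>..1}\<close> and then
  \<open>{\<sigma>..\<tau>}\<close>.\<close>

lemma char_increment:
  assumes \<sigma>: "0 \<le> \<sigma>" "\<sigma> < \<tau>" "\<tau> < 1"
    and \<Gamma>: "\<Gamma> \<in> N \<sigma> \<rightarrow>\<^sub>M borel" "\<And>w. cmod (\<Gamma> w) \<le> 1"
    and h: "h = 1 / (1 - \<tau>) - 1 / (1 - \<sigma>)"
  shows "(\<integral>w. \<Gamma> w * iexp (\<theta> \<bullet> ((1 / (1 - \<tau>)) *\<^sub>R w \<tau> - (1 / (1 - \<sigma>)) *\<^sub>R w \<sigma>)) \<partial>P)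
    = complex_of_real (exp (- (h * (norm \<theta>)\<^sup>2) / 2)) * (\<integral>w. \<Gamma> w * iexp (h * (\<theta> \<bullet> w 1)) \<partial>P)"
proof -
  define S T where "S = 1 / (1 - \<sigma>)" and "T = 1 / (1 - \<tau>)"
  define e1 es et where "e1 = (\<lambda>w :: real \<Rightarrow> 'a. w 1)" and "es = (\<lambda>w :: real \<Rightarrow> 'a. w \<sigma>)" and "et = (\<lambda>w :: real \<Rightarrow> 'a. w \<tau>)"
  define p r where "p = \<tau> - \<sigma>" and "r = 1 - \<tau>"
  have pr: "0 < p" "0 < r" "p + r = 1 - \<sigma>" using \<sigma> by (auto simp: p_def r_def)
  have hTS: "h = T - S" by (simp add: h T_def S_def)
  have pT: "p / (p + r) * T = h"
  proof -
    have "(\<tau> - \<sigma>) / (1 - \<sigma>) * (1 / (1 - \<tau>)) = 1 / (1 - \<tau>) - 1 / (1 - \<sigma>)"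
      using \<sigma> by (simp add: field_simps)
    then show ?thesis unfolding pr(3) unfolding p_def T_def h .
  qed
  have prT: "p * r / (p + r) * T\<^sup>2 = h"
  proof -
    have "r * T = 1" using \<sigma> by (simp add: r_def T_def)
    moreover have "p * r / (p + r) * T\<^sup>2 = (p / (p + r) * T) * (r * T)" by (simp add: power2_eq_square)
    ultimately show ?thesis by (simp only: pT mult_1_right)
  qed
  have es_s: "es \<in> N \<sigma> \<rightarrow>\<^sub>M borel" and es_t: "es \<in> N \<tau> \<rightarrow>\<^sub>M borel" and et_t: "et \<in> N \<tau> \<rightarrow>\<^sub>M borel"
    unfolding es_def et_def using component_N \<sigma> by auto
  have \<Gamma>t: "\<Gamma> \<in> N \<tau> \<rightarrow>\<^sub>M borel" using \<sigma> by (intro N_mono[OF _ \<Gamma>(1)]) simp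
  have W_meas: "e1 \<in> W \<rightarrow>\<^sub>M borel" "es \<in> W \<rightarrow>\<^sub>M borel" "et \<in> W \<rightarrow>\<^sub>M borel" "\<Gamma> \<in> W \<rightarrow>\<^sub>M borel"
    unfolding e1_def es_def et_def using component_W \<sigma> measurable_from_subalg[OF subalgebra_W \<Gamma>(1)] by auto
  have di: "integrable W (\<lambda>w. dens (e1 w))"
    using dens_1_measurable' nn_integral_dens by (intro integrableI_bounded) (auto simp: dens_nonneg e1_def)
  have bnd: "integrable W (\<lambda>w. dens (e1 w) *\<^sub>R f w)"
    if [measurable]: "f \<in> borel_measurable W" and "\<And>w. cmod (f w) \<le> 1" for f :: "_ \<Rightarrow> complex"
  proof -
    note [measurable] = W_meas(1)
    show ?thesis using that
      by (intro Bochner_Integration.integrable_bound[OF di]) (auto simp: dens_nonneg mult_left_le)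
  qed
  define f1 where "f1 = (\<lambda>(w, y). dens (et w + y) *\<^sub>R (\<Gamma> w * iexp (\<theta> \<bullet> (T *\<^sub>R et w - S *\<^sub>R es w))))"
  \<comment> \<open>The density of \<open>P\<close> relative to \<open>W\<close> on the path up to
    \<tau>, as a function of the position at \<tau>.\<close>
  define D where "D z = (\<integral>y. complex_of_real (dens (z + y)) \<partial>gaussian_measure (sqrt (1 - \<tau>)))" for z
  interpret Gr: prob_space "gaussian_measure (sqrt (1 - \<tau>)) :: 'a measure"
    by (rule prob_space_gaussian_measure) (use \<sigma> in simp)
  have D_meas: "D \<in> borel_measurable borel" unfolding D_def[abs_def] by measurable
  define f2 where "f2 = (\<lambda>(w, a). (\<Gamma> w * iexp (\<theta> \<bullet> (T *\<^sub>R (es w + a) - S *\<^sub>R es w))) * D (es w + a))"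
  define f3 where "f3 = (\<lambda>(w, y). dens (es w + y) *\<^sub>R (\<Gamma> w * iexp (h * (\<theta> \<bullet> (es w + y)))))"
  have f1_meas: "f1 \<in> borel_measurable (N \<tau> \<Otimes>\<^sub>M borel)"
  proof -
    note [measurable] = es_t et_t \<Gamma>t
    show ?thesis unfolding f1_def by measurable
  qed
  have f23_meas: "f2 \<in> borel_measurable (N \<sigma> \<Otimes>\<^sub>M borel)" "f3 \<in> borel_measurable (N \<sigma> \<Otimes>\<^sub>M borel)"
  proof -
    note [measurable] = es_s \<Gamma>(1) D_meas
    show "f2 \<in> borel_measurable (N \<sigma> \<Otimes>\<^sub>M borel)" unfolding f2_def by measurable
    show "f3 \<in> borel_measurable (N \<sigma> \<Otimes>\<^sub>M borel)" unfolding f3_def by measurable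
  qed
  have lhs_meas: "(\<lambda>w. \<Gamma> w * iexp (\<theta> \<bullet> (T *\<^sub>R et w - S *\<^sub>R es w))) \<in> borel_measurable W"
    and rhs_meas: "(\<lambda>w. \<Gamma> w * iexp (h * (\<theta> \<bullet> e1 w))) \<in> borel_measurable W"
  proof -
    note [measurable] = W_meas
    show "(\<lambda>w. \<Gamma> w * iexp (\<theta> \<bullet> (T *\<^sub>R et w - S *\<^sub>R es w))) \<in> borel_measurable W" by measurable
    show "(\<lambda>w. \<Gamma> w * iexp (h * (\<theta> \<bullet> e1 w))) \<in> borel_measurable W" by measurable
  qed
  have i1: "integrable W (\<lambda>w. f1 (w, w 1 - w \<tau>))"
    using bnd[OF lhs_meas] \<Gamma>(2) by (simp add: f1_def e1_def et_def norm_mult)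
  have i3: "integrable W (\<lambda>w. f3 (w, w 1 - w \<sigma>))"
    using bnd[OF rhs_meas] \<Gamma>(2) by (simp add: f3_def e1_def es_def norm_mult)
  note gi1 = W.prob_space_axioms subalgebra_W _ increment f1_meas i1
  have f1_D: "(\<integral>y. f1 (w, y) \<partial>gaussian_measure (sqrt (1 - \<tau>))) = f2 (w, w \<tau> - w \<sigma>)" for w
  proof -
    have "f1 (w, y) = (\<Gamma> w * iexp (\<theta> \<bullet> (T *\<^sub>R et w - S *\<^sub>R es w))) * complex_of_real (dens (et w + y))" for y
      by (simp only: f1_def prod.case scaleR_conv_of_real ac_simps)
    then have "(\<integral>y. f1 (w, y) \<partial>gaussian_measure (sqrt (1 - \<tau>)))
       = (\<Gamma> w * iexp (\<theta> \<bullet> (T *\<^sub>R et w - S *\<^sub>R es w))) * D (et w)"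
      by (simp only: integral_mult_right_zero D_def)
    then show ?thesis by (simp add: f2_def es_def et_def)
  qed
  have i2: "integrable W (\<lambda>w. f2 (w, w \<tau> - w \<sigma>))"
    unfolding f1_D[symmetric] by (rule integrable_gaussian_indep[OF gi1]) (use \<sigma> in auto)
  have "(\<integral>w. \<Gamma> w * iexp (\<theta> \<bullet> (T *\<^sub>R w \<tau> - S *\<^sub>R w \<sigma>)) \<partial>P) = (\<integral>w. f1 (w, w 1 - w \<tau>) \<partial>W)"
    using integral_P[OF lhs_meas] by (simp add: f1_def et_def es_def)
  also have "\<dots> = (\<integral>w. f2 (w, w \<tau> - w \<sigma>) \<partial>W)"
    unfolding f1_D[symmetric] by (rule integral_gaussian_indep[OF gi1]) (use \<sigma> in auto)
  also have "\<dots> = (\<integral>w. (\<integral>a. f2 (w, a) \<partial>gaussian_measure (sqrt (\<tau> - \<sigma>))) \<partial>W)"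
    by (rule integral_gaussian_indep[OF W.prob_space_axioms subalgebra_W _ increment f23_meas(1) i2]) (use \<sigma> in auto)
  also have "\<dots> = (\<integral>w. complex_of_real (exp (- (h * (norm \<theta>)\<^sup>2) / 2)) * (\<integral>y. f3 (w, y) \<partial>gaussian_measure (sqrt (1 - \<sigma>))) \<partial>W)"
  proof (rule integral_cong_AE)
    interpret Gp: prob_space "gaussian_measure (sqrt (\<tau> - \<sigma>)) :: 'a measure"
      by (rule prob_space_gaussian_measure) (use \<sigma> in simp)
    interpret Gs: prob_space "gaussian_measure (sqrt (1 - \<sigma>)) :: 'a measure"
      by (rule prob_space_gaussian_measure) (use \<sigma> in simp)
    have "(\<lambda>w. \<integral>a. f2 (w, a) \<partial>gaussian_measure (sqrt (\<tau> - \<sigma>))) \<in> borel_measurable (N \<sigma>)"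
      using f23_meas(1) by measurable
    then show "(\<lambda>w. \<integral>a. f2 (w, a) \<partial>gaussian_measure (sqrt (\<tau> - \<sigma>))) \<in> borel_measurable W"
      by (rule measurable_from_subalg[OF subalgebra_W])
    have "(\<lambda>w. complex_of_real (exp (- (h * (norm \<theta>)\<^sup>2) / 2)) * (\<integral>y. f3 (w, y) \<partial>gaussian_measure (sqrt (1 - \<sigma>)))) \<in> borel_measurable (N \<sigma>)"
      using f23_meas(2) by measurable
    then show "(\<lambda>w. complex_of_real (exp (- (h * (norm \<theta>)\<^sup>2) / 2)) * (\<integral>y. f3 (w, y) \<partial>gaussian_measure (sqrt (1 - \<sigma>)))) \<in> borel_measurable W"
      by (rule measurable_from_subalg[OF subalgebra_W])
    \<comment> \<open>\<open>gaussian_bridge_fourier\<close> asks for an integrable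
      \<open>H\<close>. The density has expectation 1, so its average given the path up to \<sigma>
      is finite for almost every path.\<close>
    define k where "k = (\<lambda>(w, y). ennreal (dens (es w + y)))"
    have km: "k \<in> borel_measurable (N \<sigma> \<Otimes>\<^sub>M borel)"
    proof -
      note [measurable] = es_s
      show ?thesis unfolding k_def by measurable
    qed
    have "(\<integral>\<^sup>+w. (\<integral>\<^sup>+y. k (w, y) \<partial>gaussian_measure (sqrt (1 - \<sigma>))) \<partial>W) = (\<integral>\<^sup>+w. k (w, w 1 - w \<sigma>) \<partial>W)"
      by (rule nn_integral_gaussian_indep[OF W.prob_space_axioms subalgebra_W _ increment km, symmetric]) (use \<sigma> in auto)
    also have "\<dots> = 1" using nn_integral_dens by (simp add: k_def es_def)
    finally have k1: "(\<integral>\<^sup>+w. (\<integral>\<^sup>+y. k (w, y) \<partial>gaussian_measure (sqrt (1 - \<sigma>))) \<partial>W) \<noteq> \<infinity>" by simp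
    have "(\<lambda>w. \<integral>\<^sup>+y. k (w, y) \<partial>gaussian_measure (sqrt (1 - \<sigma>))) \<in> borel_measurable (N \<sigma>)"
      using km by measurable
    then have "(\<lambda>w. \<integral>\<^sup>+y. k (w, y) \<partial>gaussian_measure (sqrt (1 - \<sigma>))) \<in> borel_measurable W"
      by (rule measurable_from_subalg[OF subalgebra_W])
    from nn_integral_PInf_AE[OF this k1]
    show "AE w in W. (\<integral>a. f2 (w, a) \<partial>gaussian_measure (sqrt (\<tau> - \<sigma>)))
      = complex_of_real (exp (- (h * (norm \<theta>)\<^sup>2) / 2)) * (\<integral>y. f3 (w, y) \<partial>gaussian_measure (sqrt (1 - \<sigma>)))"
    proof eventually_elim
      case (elim w)
      define z where "z = es w"
      define H where "H y = complex_of_real (dens (z + y))" for y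
      have [measurable]: "H \<in> borel_measurable borel" unfolding H_def by measurable
      have fin: "(\<integral>\<^sup>+y. ennreal (cmod (H y)) \<partial>gaussian_measure (sqrt (p + r))) < \<infinity>"
        using elim unfolding pr(3) by (simp add: H_def k_def z_def dens_nonneg less_top)
      have "f2 (w, a) = (\<Gamma> w * iexp (h * (\<theta> \<bullet> z))) * (iexp ((T *\<^sub>R \<theta>) \<bullet> a) * (\<integral>y. H (a + y) \<partial>gaussian_measure (sqrt r)))" for a
      proof -
        \<comment> \<open>As h = T - S, the known position contributes the phase
          \<open>h * (\<theta> \<bullet> z)\<close>, which the phase in \<open>y\<close> later
          completes to that of the terminal value \<open>z + y\<close>.\<close>
        have "\<theta> \<bullet> (T *\<^sub>R (z + a) - S *\<^sub>R z) = h * (\<theta> \<bullet> z) + (T *\<^sub>R \<theta>) \<bullet> a"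
          by (simp add: hTS inner_diff_right inner_add_right algebra_simps)
        moreover have "D (z + a) = (\<integral>y. H (a + y) \<partial>gaussian_measure (sqrt r))"
          by (simp add: D_def H_def r_def add.assoc)
        ultimately show ?thesis
          by (simp only: f2_def prod.case z_def[symmetric] of_real_add distrib_left exp_add mult.assoc)
      qed
      then have "(\<integral>a. f2 (w, a) \<partial>gaussian_measure (sqrt (\<tau> - \<sigma>)))
        = (\<Gamma> w * iexp (h * (\<theta> \<bullet> z))) * (\<integral>a. iexp ((T *\<^sub>R \<theta>) \<bullet> a) * (\<integral>y. H (a + y) \<partial>gaussian_measure (sqrt r)) \<partial>gaussian_measure (sqrt p))"
        by (simp only: integral_mult_right_zero p_def)
      also have "(\<integral>a. iexp ((T *\<^sub>R \<theta>) \<bullet> a) * (\<integral>y. H (a + y) \<partial>gaussian_measure (sqrt r)) \<partial>gaussian_measure (sqrt p))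
        = complex_of_real (exp (- (p * r / (p + r) * (norm (T *\<^sub>R \<theta>))\<^sup>2) / 2))
          * (\<integral>y. iexp (p / (p + r) * ((T *\<^sub>R \<theta>) \<bullet> y)) * H y \<partial>gaussian_measure (sqrt (p + r)))"
        by (rule gaussian_bridge_fourier[OF pr(1,2) _ fin]) measurable
      also have "p * r / (p + r) * (norm (T *\<^sub>R \<theta>))\<^sup>2 = h * (norm \<theta>)\<^sup>2"
        unfolding prT[symmetric] by (simp add: power_mult_distrib)
      also have "(\<integral>y. iexp (p / (p + r) * ((T *\<^sub>R \<theta>) \<bullet> y)) * H y \<partial>gaussian_measure (sqrt (p + r)))
        = (\<integral>y. iexp (h * (\<theta> \<bullet> y)) * H y \<partial>gaussian_measure (sqrt (1 - \<sigma>)))"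
        unfolding inner_scaleR_left mult.assoc[symmetric] pT by (simp only: pr(3) mult.assoc)
      also have "\<Gamma> w * iexp (h * (\<theta> \<bullet> z)) * (complex_of_real (exp (- (h * (norm \<theta>)\<^sup>2) / 2)) *
            (\<integral>y. iexp (h * (\<theta> \<bullet> y)) * H y \<partial>gaussian_measure (sqrt (1 - \<sigma>))))
        = complex_of_real (exp (- (h * (norm \<theta>)\<^sup>2) / 2)) *
            (\<integral>y. (\<Gamma> w * iexp (h * (\<theta> \<bullet> z))) * (iexp (h * (\<theta> \<bullet> y)) * H y) \<partial>gaussian_measure (sqrt (1 - \<sigma>)))"
        unfolding integral_mult_right_zero by (rule mult.left_commute)
      also have "(\<lambda>y. (\<Gamma> w * iexp (h * (\<theta> \<bullet> z))) * (iexp (h * (\<theta> \<bullet> y)) * H y)) = (\<lambda>y. f3 (w, y))"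
      proof
        fix y
        have "iexp (h * (\<theta> \<bullet> (z + y))) = iexp (h * (\<theta> \<bullet> z)) * iexp (h * (\<theta> \<bullet> y))"
          by (simp only: inner_add_right distrib_left of_real_add exp_add)
        then show "(\<Gamma> w * iexp (h * (\<theta> \<bullet> z))) * (iexp (h * (\<theta> \<bullet> y)) * H y) = f3 (w, y)"
          by (simp only: f3_def prod.case z_def[symmetric] H_def scaleR_conv_of_real ac_simps)
      qed
      finally show ?case .
    qed
  qed
  also have "\<dots> = complex_of_real (exp (- (h * (norm \<theta>)\<^sup>2) / 2)) * (\<integral>w. (\<integral>y. f3 (w, y) \<partial>gaussian_measure (sqrt (1 - \<sigma>))) \<partial>W)"
    by (rule integral_mult_right_zero)
  also have "(\<integral>w. (\<integral>y. f3 (w, y) \<partial>gaussian_measure (sqrt (1 - \<sigma>))) \<partial>W) = (\<integral>w. f3 (w, w 1 - w \<sigma>) \<partial>W)"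
    by (rule integral_gaussian_indep[OF W.prob_space_axioms subalgebra_W _ increment f23_meas(2) i3, symmetric]) (use \<sigma> in auto)
  also have "\<dots> = (\<integral>w. \<Gamma> w * iexp (h * (\<theta> \<bullet> w 1)) \<partial>P)"
    using integral_P[OF rhs_meas] by (simp add: f3_def e1_def es_def)
  finally show ?thesis by (simp add: T_def S_def)
qed

text \<open>The inverse of the time change, t / (1 + t) for nonnegative t. The \<open>max\<close>
  makes it monotone on the whole line, as filtrations are indexed by all reals.\<close>

definition clock :: "real \<Rightarrow> real" where
  "clock t = 1 - 1 / (1 + max 0 t)"

lemma clock_bounds: "0 \<le> clock t" "clock t < 1"
  by (auto simp: clock_def divide_le_eq)

lemma clock_mono: "s \<le> t \<Longrightarrow> clock s \<le> clock t"
  unfolding clock_def by (intro diff_left_mono divide_left_mono) auto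

lemma clock_strict_mono: "0 \<le> s \<Longrightarrow> s < t \<Longrightarrow> clock s < clock t"
  unfolding clock_def by (intro diff_strict_left_mono divide_strict_left_mono) auto

lemma clock_inverse:
  assumes "0 \<le> t"
  shows "1 / (1 - clock t) = 1 + t" "clock t / (1 - clock t) = t"
  using assms by (simp_all add: clock_def field_simps)

definition path :: "real \<Rightarrow> (real \<Rightarrow> 'a) \<Rightarrow> 'a" where
  "path t w = (1 + t) *\<^sub>R w (clock t)"

lemma path_N: "0 \<le> t \<Longrightarrow> path t \<in> N (clock t) \<rightarrow>\<^sub>M borel"
  unfolding path_def using component_N[of "clock t" "clock t"] clock_bounds[of t] by simp

lemma path_N': "0 \<le> s \<Longrightarrow> s \<le> t \<Longrightarrow> path s \<in> N (clock t) \<rightarrow>\<^sub>M borel"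
  by (rule N_mono[OF clock_mono path_N])

lemma path_continuous: "w \<in> space W \<Longrightarrow> continuous_on {0..} (\<lambda>t. path t w)"
proof -
  assume "w \<in> space W"
  then have w: "continuous_on {0..1} w" using space_wiener[OF wiener] by simp
  have "continuous_on {0..} clock"
    unfolding clock_def by (intro continuous_intros) auto
  then have "continuous_on {0..} (\<lambda>t. w (clock t))"
    by (rule continuous_on_compose2[OF w]) (auto simp: clock_bounds less_imp_le)
  then show ?thesis unfolding path_def by (intro continuous_intros)
qed

lemma path_continuous': "w \<in> space W \<Longrightarrow> continuous_on {0..u} (\<lambda>t. path t w)"
  by (rule continuous_on_subset[OF path_continuous]) auto

section \<open>Conditional means along the time-changed bridge\<close>

lemma nn_integral_P_path:
  assumes t: "0 \<le> t" and \<Gamma>: "\<Gamma> \<in> borel_measurable (N (clock t))" and \<psi>: "\<psi> \<in> borel_measurable borel"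
  shows "(\<integral>\<^sup>+w. \<Gamma> w * \<psi> (w 1) \<partial>P) = (\<integral>\<^sup>+w. \<Gamma> w * (\<integral>\<^sup>+x. \<psi> x \<partial>tilted_measure \<pi>0 t (path t w)) \<partial>P)"
  using nn_integral_P_tilted[OF clock_bounds[of t] \<Gamma> \<psi>] by (simp add: clock_inverse[OF t] path_def)

lemma X_integrable: "integrable P (\<lambda>w. w 1)"
proof -
  have m: "(\<lambda>w. w 1) \<in> P \<rightarrow>\<^sub>M borel" using component_W[of 1] by simp
  show ?thesis
    using mean unfolding distr_P_1[symmetric] by (subst (asm) integrable_distr_eq[OF m]) auto
qed

definition m :: "real \<Rightarrow> (real \<Rightarrow> 'a) \<Rightarrow> 'a" where
  "m t w = tilted_mean \<pi>0 t (path t w)"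

text \<open>By the tower property, the tilted first absolute moments average to the mean of
  \<open>norm (w 1)\<close>, which is finite.\<close>

lemma AE_tilted_integrable:
  assumes t: "0 \<le> t"
  shows "AE w in P. integrable (tilted_measure \<pi>0 t (path t w)) (\<lambda>x. x)"
proof -
  have "(\<integral>\<^sup>+w. (\<integral>\<^sup>+x. ennreal (norm x) \<partial>tilted_measure \<pi>0 t (path t w)) \<partial>P) = (\<integral>\<^sup>+w. ennreal (norm (w 1)) \<partial>P)"
    using nn_integral_P_path[OF t, of "\<lambda>_. 1" "\<lambda>x. ennreal (norm x)"] by simp
  also have "\<dots> = ennreal (\<integral>w. norm (w 1) \<partial>P)"
    by (rule nn_integral_eq_integral) (use X_integrable in auto)
  also have "\<dots> \<noteq> \<infinity>" by simp
  finally have fin: "(\<integral>\<^sup>+w. (\<integral>\<^sup>+x. ennreal (norm x) \<partial>tilted_measure \<pi>0 t (path t w)) \<partial>P) \<noteq> \<infinity>" .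
  have "(\<lambda>w. \<integral>\<^sup>+x. ennreal (norm x) \<partial>tilted_measure \<pi>0 t (path t w)) \<in> borel_measurable P"
    using measurable_from_subalg[OF subalgebra_P path_N[OF t]]
    by (rule measurable_compose[OF _ measurable_nn_integral_tilted]) measurable
  from nn_integral_PInf_AE[OF this fin] show ?thesis
  proof eventually_elim
    case (elim w)
    have "(\<lambda>x. x) \<in> borel_measurable (tilted_measure \<pi>0 t (path t w))" by (simp add: tilted_measure_def)
    then show ?case using elim by (intro integrableI_bounded) (auto simp: less_top)
  qed
qed

text \<open>\<open>nn_integral_P_path\<close> speaks about nonnegative functions, so it is applied
  to the positive and negative parts of \<open>\<theta> \<bullet> x\<close>, which are obtained from
  \<theta> and - \<theta> because \<open>ennreal\<close> cuts off at 0. Both integrals are finite,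
  which permits the subtraction.\<close>

lemma m_projection:
  assumes t: "0 \<le> t" and A: "A \<in> sets (N (clock t))"
  shows "(\<integral>w. indicator A w * (\<theta> \<bullet> m t w) \<partial>P) = (\<integral>w. indicator A w * (\<theta> \<bullet> w 1) \<partial>P)"
proof -
  define X1 where "X1 = (\<lambda>w :: real \<Rightarrow> 'a. w 1)"
  have X1m: "X1 \<in> P \<rightarrow>\<^sub>M borel" unfolding X1_def using component_W[of 1] by simp
  have AP: "A \<in> sets P" using A subalgebra_P[of "clock t"] by (auto simp: subalgebra_def)
  have pm: "path t \<in> P \<rightarrow>\<^sub>M borel" by (rule measurable_from_subalg[OF subalgebra_P path_N[OF t]])
  define E where "E \<eta> w = (\<integral>\<^sup>+x. ennreal (\<eta> \<bullet> x) \<partial>tilted_measure \<pi>0 t (path t w))" for \<eta> w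
  have Em: "E \<eta> \<in> borel_measurable P" for \<eta>
    unfolding E_def by (rule measurable_compose[OF pm measurable_nn_integral_tilted]) measurable
  note [measurable] = X1m AP Em
  have EX: "(\<integral>\<^sup>+w. indicator A w * E \<eta> w \<partial>P) = (\<integral>\<^sup>+w. indicator A w * ennreal (\<eta> \<bullet> X1 w) \<partial>P)" for \<eta>
    unfolding E_def X1_def using A by (intro nn_integral_P_path[OF t, symmetric]) auto
  have Xi: "integrable P (\<lambda>w. indicator A w * (\<eta> \<bullet> X1 w))" for \<eta>
  proof -
    have "integrable P (\<lambda>w. \<eta> \<bullet> X1 w)" using X_integrable by (simp add: X1_def)
    from integrable_mult_indicator[OF AP this] show ?thesis by simp
  qed
  have fin: "(\<integral>\<^sup>+w. indicator A w * ennreal (\<eta> \<bullet> X1 w) \<partial>P) < \<infinity>" for \<eta>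
  proof -
    have "(\<integral>\<^sup>+w. indicator A w * ennreal (\<eta> \<bullet> X1 w) \<partial>P) \<le> (\<integral>\<^sup>+w. ennreal (norm (indicator A w * (\<eta> \<bullet> X1 w))) \<partial>P)"
      by (intro nn_integral_mono) (auto simp: indicator_def intro!: ennreal_leI)
    also have "\<dots> < \<infinity>" using Xi[of \<eta>] by (simp add: integrable_iff_bounded)
    finally show ?thesis .
  qed
  have Xsplit: "(\<integral>w. indicator A w * (\<theta> \<bullet> X1 w) \<partial>P)
     = enn2real (\<integral>\<^sup>+w. indicator A w * ennreal (\<theta> \<bullet> X1 w) \<partial>P) - enn2real (\<integral>\<^sup>+w. indicator A w * ennreal ((- \<theta>) \<bullet> X1 w) \<partial>P)"
    unfolding real_lebesgue_integral_def[OF Xi]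
    by (intro arg_cong2[where f="(-)"] arg_cong[where f=enn2real] nn_integral_cong) (auto simp: indicator_def)
  have AE: "AE w in P. indicator A w * (\<theta> \<bullet> m t w) = enn2real (indicator A w * E \<theta> w) - enn2real (indicator A w * E (- \<theta>) w)"
    using AE_tilted_integrable[OF t]
  proof eventually_elim
    case (elim w)
    have "\<theta> \<bullet> m t w = (\<integral>x. \<theta> \<bullet> x \<partial>tilted_measure \<pi>0 t (path t w))"
      unfolding m_def tilted_mean_def using elim by simp
    also have "\<dots> = enn2real (E \<theta> w) - enn2real (E (- \<theta>) w)"
      using elim unfolding E_def by (subst real_lebesgue_integral_def) auto
    finally show ?case by (auto simp: indicator_def)
  qed
  have Ei: "integrable P (\<lambda>w. enn2real (indicator A w * E \<eta> w))"
    and Eint: "(\<integral>w. enn2real (indicator A w * E \<eta> w) \<partial>P) = enn2real (\<integral>\<^sup>+w. indicator A w * E \<eta> w \<partial>P)" for \<eta>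
  proof -
    have f: "(\<integral>\<^sup>+w. indicator A w * E \<eta> w \<partial>P) < \<infinity>" using fin[of \<eta>] by (simp add: EX)
    have "AE w in P. indicator A w * E \<eta> w \<noteq> \<infinity>"
      by (rule nn_integral_PInf_AE) (use f in auto)
    then have eq: "(\<integral>\<^sup>+w. ennreal (enn2real (indicator A w * E \<eta> w)) \<partial>P) = (\<integral>\<^sup>+w. indicator A w * E \<eta> w \<partial>P)"
      by (intro nn_integral_cong_AE) (auto simp: less_top)
    show "integrable P (\<lambda>w. enn2real (indicator A w * E \<eta> w))"
      using f eq by (intro integrableI_bounded) auto
    show "(\<integral>w. enn2real (indicator A w * E \<eta> w) \<partial>P) = enn2real (\<integral>\<^sup>+w. indicator A w * E \<eta> w \<partial>P)"
      unfolding eq[symmetric] by (rule integral_eq_nn_integral) auto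
  qed
  have "(\<integral>w. indicator A w * (\<theta> \<bullet> m t w) \<partial>P)
      = (\<integral>w. enn2real (indicator A w * E \<theta> w) - enn2real (indicator A w * E (- \<theta>) w) \<partial>P)"
  proof (rule integral_cong_AE[OF _ _ AE])
    have "m t \<in> borel_measurable P"
      unfolding m_def
      using measurable_compose[OF pm measurable_Pair2[OF measurable_tilted_mean[OF \<pi>_meas \<pi>_nonneg], of t]] by simp
    then show "(\<lambda>w. indicator A w * (\<theta> \<bullet> m t w)) \<in> borel_measurable P" using AP by measurable
  qed measurable
  also have "\<dots> = (\<integral>w. indicator A w * (\<theta> \<bullet> X1 w) \<partial>P)"
    using Ei by (simp add: Eint EX Xsplit)
  finally show ?thesis by (simp add: X1_def)
qed

text \<open>The assumptions on \<open>m\<close> express that the tilted measure is the conditional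
  law of the terminal value; the one on increments is \<open>char_increment\<close> at clock times,
  where 1 / (1 - \<tau>) becomes 1 + t and the difference becomes h.\<close>

lemma innovation: "innovation P (\<lambda>t. N (clock t)) path m (\<lambda>w. w 1)"
proof -
  interpret filtration "space P" "\<lambda>t. N (clock t)"
    using filtration.sets_F_mono[OF filtration_N clock_mono] by unfold_locales auto
  show ?thesis
  proof
    show "subalgebra P (N (clock t))" for t by (rule subalgebra_P)
    show "path t \<in> N (clock t) \<rightarrow>\<^sub>M borel" if "0 \<le> t" for t using that by (rule path_N)
    show "(\<lambda>(\<omega>, s). indicator {0..u} s *\<^sub>R m s \<omega>) \<in> N (clock u) \<Otimes>\<^sub>M borel \<rightarrow>\<^sub>M borel" if "0 \<le> u" for u
      unfolding m_def
      by (rule measurable_drift[OF \<pi>_meas \<pi>_nonneg that]) (use path_N' path_continuous' in auto)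
    show "integrable P (\<lambda>w. w 1)" by (rule X_integrable)
    show "(\<integral>w. indicator A w * (\<theta> \<bullet> m t w) \<partial>P) = (\<integral>w. indicator A w * (\<theta> \<bullet> w 1) \<partial>P)"
      if "0 \<le> t" "A \<in> sets (N (clock t))" for t A \<theta> using that by (rule m_projection)
    show "(\<integral>\<^sup>+w. indicator A w * ennreal (norm (m t w)) \<partial>P) \<le> (\<integral>\<^sup>+w. indicator A w * ennreal (norm (w 1)) \<partial>P)"
      if t: "0 \<le> t" and A: "A \<in> sets (N (clock t))" for t A
    proof -
      have "(\<integral>\<^sup>+w. indicator A w * ennreal (norm (m t w)) \<partial>P)
        \<le> (\<integral>\<^sup>+w. indicator A w * (\<integral>\<^sup>+x. ennreal (norm x) \<partial>tilted_measure \<pi>0 t (path t w)) \<partial>P)"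
        unfolding m_def tilted_mean_def by (intro nn_integral_mono mult_left_mono norm_integral_le_nn_integral) auto
      also have "\<dots> = (\<integral>\<^sup>+w. indicator A w * ennreal (norm (w 1)) \<partial>P)"
        by (rule nn_integral_P_path[OF t, symmetric]) (use A in auto)
      finally show ?thesis .
    qed
    show "(\<integral>w. \<Gamma> w * iexp (\<theta> \<bullet> (path (u + h) w - path u w)) \<partial>P)
        = complex_of_real (exp (- (h * (norm \<theta>)\<^sup>2) / 2)) * (\<integral>w. \<Gamma> w * iexp (h * (\<theta> \<bullet> w 1)) \<partial>P)"
      if u: "0 \<le> u" and h: "0 < h" and \<Gamma>: "\<Gamma> \<in> N (clock u) \<rightarrow>\<^sub>M borel" "\<And>w. cmod (\<Gamma> w) \<le> 1"
      for u h \<Gamma> \<theta>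
    proof -
      have c: "clock u < clock (u + h)" using u h by (intro clock_strict_mono) auto
      have "h = 1 / (1 - clock (u + h)) - 1 / (1 - clock u)" using u h by (simp add: clock_inverse)
      from char_increment[OF clock_bounds(1) c clock_bounds(2) \<Gamma> this, of \<theta>]
      show ?thesis using u h by (simp add: clock_inverse path_def)
    qed
  qed
qed

end

text \<open>Uniqueness in law concerns the path space over \<open>{0..}\<close>, the conclusion the
  product space over \<open>{0..<1}\<close>; factoring through the former reduces the second to the
  first.\<close>

lemma distr_time_change:
  fixes M :: "'w measure" and c :: "real \<Rightarrow> 'w \<Rightarrow> 'a::euclidean_space"
  defines "\<Psi> \<equiv> \<lambda>w :: real \<Rightarrow> 'a. \<lambda>\<tau>\<in>{0..<1}. w (\<tau> / (1 - \<tau>))"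
  assumes tp: "tilt_process \<pi>0 M F B c"
  shows "distr M (\<Pi>\<^sub>M \<tau>\<in>{0..<1}. borel) (\<lambda>\<omega>. \<lambda>\<tau>\<in>{0..<1}. c (\<tau> / (1 - \<tau>)) \<omega>)
    = distr (distr M (path_space {0..}) (\<lambda>\<omega>. \<lambda>t\<in>{0..}. c t \<omega>)) (\<Pi>\<^sub>M \<tau>\<in>{0..<1}. borel) \<Psi>"
proof -
  have \<Psi>: "\<Psi> \<in> path_space {0..} \<rightarrow>\<^sub>M (\<Pi>\<^sub>M \<tau>\<in>{0..<1}. borel)"
    unfolding \<Psi>_def by (intro measurable_restrict measurable_path_space_component) auto
  have "c t \<in> M \<rightarrow>\<^sub>M borel" if "0 \<le> t" for t
    using tp that unfolding tilt_process_def wiener_process_def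
    by (intro measurable_from_subalg[of M "F t"]) auto
  then have "(\<lambda>\<omega>. \<lambda>t\<in>{0..}. c t \<omega>) \<in> M \<rightarrow>\<^sub>M path_space {0..}"
    using tp unfolding tilt_process_def by (intro measurable_path_space) auto
  then show ?thesis
    by (subst distr_distr[OF \<Psi>]) (auto intro!: distr_cong simp: \<Psi>_def fun_eq_iff)
qed

context bridge
begin

text \<open>The space of the bridge itself carries a weak solution, with the filtration read at
  clock times and the innovation noise as driver. Integrability of the drift is taken at integer
  times, which leaves countably many null sets.\<close>

lemma tilt_process_path: "\<exists>B. tilt_process \<pi>0 P (\<lambda>t. N (clock t)) B path"
proof -
  interpret I: innovation P "\<lambda>t. N (clock t)" path m "\<lambda>w. w 1" by (rule innovation)
  have int: "AE w in P. \<forall>n::nat. set_integrable lborel {0..real n} (\<lambda>s. m s w)"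
    unfolding AE_all_countable using I.AE_window_integrable[of 0] by simp
  have path0: "AE w in P. path 0 w = 0"
    using AE_P[OF wiener_0[OF wiener]] by eventually_elim (simp add: path_def clock_def)
  have drift0: "I.drift 0 0 w = 0" for w
    unfolding I.drift_def set_lebesgue_integral_def
    by (rule integral_eq_zero_AE, use AE_lborel_singleton[of "0::real"] in eventually_elim) auto
  have "tilt_process \<pi>0 P (\<lambda>t. N (clock t)) I.noise path"
    unfolding tilt_process_def wiener_process_def
  proof (intro conjI ballI allI impI)
    show "prob_space P" by unfold_locales
    show "filtration (space P) (\<lambda>t. N (clock t))" by unfold_locales
    show "subalgebra P (N (clock t))" for t by (rule subalgebra_P)
    show "I.noise t \<in> N (clock t) \<rightarrow>\<^sub>M borel" if "t \<in> {0..}" for t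
      using that by (intro I.noise_adapted) auto
    show "AE w in P. I.noise 0 w = 0"
      using path0 by eventually_elim (simp add: I.noise_def drift0)
    show "AE w in P. continuous_on {0..} (\<lambda>t. I.noise t w)"
      using int AE_space
    proof eventually_elim
      case (elim w)
      then have "continuous_on {0..} (\<lambda>t. LINT s:{0..t}|lborel. m s w)"
        by (intro continuous_on_indefinite_set_integral) auto
      with elim path_continuous[of w] show ?case
        unfolding I.noise_def I.drift_def by (intro continuous_on_diff) auto
    qed
    show "path t \<in> N (clock t) \<rightarrow>\<^sub>M borel" if "0 \<le> t" for t using that by (rule path_N)
    show "continuous_on {0..} (\<lambda>t. path t w)" if "w \<in> space P" for w using that path_continuous by simp
    show "AE w in P. path 0 w = 0" by (rule path0)
    show "AE w in P. \<forall>t\<ge>0. set_integrable lborel {0..t} (\<lambda>s. tilted_mean \<pi>0 s (path s w)) \<and>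
        path t w = (LINT s:{0..t}|lborel. tilted_mean \<pi>0 s (path s w)) + I.noise t w"
      using int
    proof eventually_elim
      case (elim w)
      show ?case
      proof (intro allI impI conjI)
        fix t :: real assume "0 \<le> t"
        obtain n :: nat where "t \<le> real n" using real_arch_simple by blast
        then have "set_integrable lborel {0..t} (\<lambda>s. m s w)"
          by (intro set_integrable_subset[OF elim[rule_format, of n]]) auto
        then show "set_integrable lborel {0..t} (\<lambda>s. tilted_mean \<pi>0 s (path s w))"
          by (simp add: m_def)
        show "path t w = (LINT s:{0..t}|lborel. tilted_mean \<pi>0 s (path s w)) + I.noise t w"
          by (simp add: I.noise_def I.drift_def m_def)
      qed
    qed
  next
    fix s t :: real assume st: "s \<in> {0..}" "t \<in> {0..}" and "s < t"
    note st = st this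
    then have "gaussian_indep P (N (clock s)) (\<lambda>w. I.noise t w - I.noise s w) (sqrt (t - s))"
      by (intro I.noise_gaussian_indep) auto
    then show "distributed P lborel (\<lambda>w. I.noise t w - I.noise s w) (\<lambda>x. ennreal (gaussian_density (sqrt (t - s)) x))"
      and "P.indep_set (sets (N (clock s))) (sets (vimage_algebra (space P) (\<lambda>w. I.noise t w - I.noise s w) borel))"
      using st gaussian_indep_iff[OF P.prob_space_axioms subalgebra_P, of "sqrt (t - s)"] by auto
  qed
  then show ?thesis by blast
qed

lemma distr_tilt_process:
  assumes wp: "tilt_well_posed \<pi>0" and tp: "tilt_process \<pi>0 M F B c"
  shows "distr M (\<Pi>\<^sub>M \<tau>\<in>{0..<1}. borel) (\<lambda>\<omega>. \<lambda>\<tau>\<in>{0..<1}. c (\<tau> / (1 - \<tau>)) \<omega>) =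
         distr P (\<Pi>\<^sub>M \<tau>\<in>{0..<1}. borel) (\<lambda>v. \<lambda>\<tau>\<in>{0..<1}. (1 / (1 - \<tau>)) *\<^sub>R v \<tau>)"
proof -
  obtain B' where tp': "tilt_process \<pi>0 P (\<lambda>t. N (clock t)) B' path"
    using tilt_process_path by blast
  \<comment> \<open>Both laws are laws of weak solutions on the canonical space, and well-posedness
    allows only one.\<close>
  have "distr M (path_space {0..}) (\<lambda>\<omega>. \<lambda>t\<in>{0..}. c t \<omega>) = distr P (path_space {0..}) (\<lambda>w. \<lambda>t\<in>{0..}. path t w)"
    using wp tilt_law_distr[OF \<pi>_meas \<pi>_nonneg tp] tilt_law_distr[OF \<pi>_meas \<pi>_nonneg tp']
    unfolding tilt_well_posed_def by blast
  then have "distr M (\<Pi>\<^sub>M \<tau>\<in>{0..<1}. borel) (\<lambda>\<omega>. \<lambda>\<tau>\<in>{0..<1}. c (\<tau> / (1 - \<tau>)) \<omega>)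
    = distr P (\<Pi>\<^sub>M \<tau>\<in>{0..<1}. borel) (\<lambda>w. \<lambda>\<tau>\<in>{0..<1}. path (\<tau> / (1 - \<tau>)) w)"
    by (simp only: distr_time_change[OF tp] distr_time_change[OF tp'])
  also have "(\<lambda>w. \<lambda>\<tau>\<in>{0..<1}. path (\<tau> / (1 - \<tau>)) w) = (\<lambda>v. \<lambda>\<tau>\<in>{0..<1}. (1 / (1 - \<tau>)) *\<^sub>R v \<tau>)"
  proof (rule ext, rule restrict_ext)
    fix w :: "real \<Rightarrow> 'a" and \<tau> :: real assume \<tau>: "\<tau> \<in> {0..<1}"
    then have "1 + \<tau> / (1 - \<tau>) = 1 / (1 - \<tau>)" by (simp add: field_simps)
    moreover from this have "clock (\<tau> / (1 - \<tau>)) = \<tau>" using \<tau> by (simp add: clock_def max_def)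
    ultimately show "path (\<tau> / (1 - \<tau>)) w = (1 / (1 - \<tau>)) *\<^sub>R w \<tau>" by (simp add: path_def)
  qed
  finally show ?thesis .
qed

end

section \<open>Almost sure uniqueness of conditional laws\<close>

lemma countable_Int_stable_generator_borel:
  obtains E :: "'a::second_countable_topology set set"
  where "countable E" "Int_stable E" "UNIV \<in> E" "sets borel = sigma_sets UNIV E"
proof -
  obtain B :: "'a set set" where B: "countable B" "topological_basis B"
    using ex_countable_basis by blast
  \<comment> \<open>Finite intersections of basic sets remain countably many; the empty family
    contributes \<open>UNIV\<close>.\<close>
  define E where "E = Inter ` {F. finite F \<and> F \<subseteq> B}"
  have "countable E" unfolding E_def using B by (intro countable_image countable_Collect_finite_subset)
  moreover have "Int_stable E"
  proof (rule Int_stableI)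
    fix a b assume "a \<in> E" "b \<in> E"
    then obtain F G where "finite F" "F \<subseteq> B" "a = \<Inter>F" "finite G" "G \<subseteq> B" "b = \<Inter>G" by (auto simp: E_def)
    then show "a \<inter> b \<in> E" unfolding E_def by (intro image_eqI[of _ _ "F \<union> G"]) auto
  qed
  moreover have "UNIV \<in> E" unfolding E_def by (intro image_eqI[of _ _ "{}"]) auto
  moreover have "sets borel = sigma_sets UNIV E"
  proof (rule antisym)
    have "B \<subseteq> E"
    proof
      fix b assume "b \<in> B"
      then show "b \<in> E" unfolding E_def by (intro image_eqI[of _ _ "{b}"]) auto
    qed
    then show "sets borel \<subseteq> sigma_sets UNIV E"
      unfolding borel_eq_countable_basis[OF B] by (simp add: sigma_sets_mono')
    have "E \<subseteq> sets borel"
      using topological_basis_open[OF B(2)] by (auto simp: E_def intro!: borel_open open_Inter)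
    then show "sigma_sets UNIV E \<subseteq> sets borel"
      using sets.sigma_sets_subset[of E borel] by simp
  qed
  ultimately show ?thesis by (rule that)
qed

text \<open>For a fixed set \<open>A\<close>, both kernels are densities of the same finite measure,
  hence equal almost everywhere. The exceptional null set depends on \<open>A\<close>, so a
  countable generator is used; its stability under intersection then gives equality of the
  measures.\<close>

lemma cond_law_unique:
  assumes P: "prob_space P" and X: "X \<in> P \<rightarrow>\<^sub>M borel"
    and \<kappa>: "cond_law P Y X \<kappa>" and \<kappa>': "cond_law P Y X \<kappa>'"
  shows "AE z in distr P borel X. \<kappa> z = \<kappa>' z"
proof -
  interpret prob_space P by fact
  interpret D: prob_space "distr P borel X" by (rule prob_space_distr[OF X])
  obtain E :: "'b set set" where E: "countable E" "Int_stable E" "UNIV \<in> E" "sets borel = sigma_sets UNIV E"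
    by (rule countable_Int_stable_generator_borel)
  have m: "\<kappa> \<in> borel \<rightarrow>\<^sub>M subprob_algebra borel" "\<kappa>' \<in> borel \<rightarrow>\<^sub>M subprob_algebra borel"
    using \<kappa> \<kappa>' by (auto simp: cond_law_def)
  have sets: "sets (\<kappa> z) = sets borel" "sets (\<kappa>' z) = sets borel"
    and sub: "subprob_space (\<kappa> z)" "subprob_space (\<kappa>' z)" for z
    using measurable_space[OF m(1), of z] measurable_space[OF m(2), of z] by (auto simp: space_subprob_algebra)
  have "AE z in distr P borel X. \<forall>A\<in>E. emeasure (\<kappa> z) A = emeasure (\<kappa>' z) A"
  proof (rule AE_ball_countable[OF E(1), THEN iffD2], rule ballI)
    fix A assume "A \<in> E"
    then have A: "A \<in> sets borel" by (auto simp: E(4))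
    show "AE z in distr P borel X. emeasure (\<kappa> z) A = emeasure (\<kappa>' z) A"
    proof (rule D.density_unique_finite_measure)
      show "(\<lambda>z. emeasure (\<kappa> z) A) \<in> borel_measurable (distr P borel X)"
        "(\<lambda>z. emeasure (\<kappa>' z) A) \<in> borel_measurable (distr P borel X)"
        using measurable_emeasure_kernel[OF m(1) A] measurable_emeasure_kernel[OF m(2) A] by auto
      fix C assume "C \<in> sets (distr P borel X)"
      then have "C \<in> sets borel" by simp
      with A \<kappa> \<kappa>' have "emeasure P {w \<in> space P. Y w \<in> A \<and> X w \<in> C} = (\<integral>\<^sup>+z\<in>C. emeasure (\<kappa> z) A \<partial>distr P borel X)"
        "emeasure P {w \<in> space P. Y w \<in> A \<and> X w \<in> C} = (\<integral>\<^sup>+z\<in>C. emeasure (\<kappa>' z) A \<partial>distr P borel X)"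
        unfolding cond_law_def by blast+
      then show "(\<integral>\<^sup>+z. emeasure (\<kappa> z) A * indicator C z \<partial>distr P borel X)
        = (\<integral>\<^sup>+z. emeasure (\<kappa>' z) A * indicator C z \<partial>distr P borel X)"
        by (rule trans[OF sym])
    qed auto
  qed
  then show ?thesis
  proof eventually_elim
    case (elim z)
    show ?case
    proof (rule measure_eqI_generator_eq[where E=E and \<Omega>=UNIV and A="\<lambda>_. UNIV"])
      show "sets (\<kappa> z) = sigma_sets UNIV E" "sets (\<kappa>' z) = sigma_sets UNIV E" by (simp_all add: sets E(4))
      show "emeasure (\<kappa> z) UNIV \<noteq> \<infinity>" for i :: nat
        using subprob_space.subprob_emeasure_le_1[OF sub(1), of z UNIV] by (auto simp: top_unique)
    qed (use E elim in auto)
  qed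
qed

text \<open>A conditional law is determined only up to null sets, so the identification is twofold:
  the tilted measure is one version, and every version agrees with it almost surely. Bridge and tilt
  process live on different probability spaces, hence one almost sure statement for each.\<close>

theorem theorem5:
  fixes \<pi>0 :: "'a::euclidean_space \<Rightarrow> real"
    and W Pstar :: "(real \<Rightarrow> 'a) measure"
    and M :: "'w measure" and F :: "real \<Rightarrow> 'w measure"
    and B c :: "real \<Rightarrow> 'w \<Rightarrow> 'a"
  assumes "\<pi>0 \<in> borel_measurable borel" and "\<And>x. 0 \<le> \<pi>0 x"
    and "prob_space (density lborel (\<lambda>x. ennreal (\<pi>0 x)))"
    and "integrable (density lborel (\<lambda>x. ennreal (\<pi>0 x))) (\<lambda>x. x)"
    and "wiener_measure W"
    and "bridge_optimal W \<pi>0 Pstar"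
    and "tilt_well_posed \<pi>0"
    and "tilt_process \<pi>0 M F B c"
  shows "distr M (\<Pi>\<^sub>M \<tau>\<in>{0..<1}. borel) (\<lambda>\<omega>. \<lambda>\<tau>\<in>{0..<1}. c (\<tau> / (1 - \<tau>)) \<omega>) =
         distr Pstar (\<Pi>\<^sub>M \<tau>\<in>{0..<1}. borel) (\<lambda>v. \<lambda>\<tau>\<in>{0..<1}. (1 / (1 - \<tau>)) *\<^sub>R v \<tau>)
    \<and> (\<forall>\<tau>\<in>{0..<1}.
         cond_law Pstar (\<lambda>v. v 1) (\<lambda>v. v \<tau>)
           (\<lambda>z. tilted_measure \<pi>0 (\<tau> / (1 - \<tau>)) ((1 / (1 - \<tau>)) *\<^sub>R z)) \<and>
         (\<forall>\<kappa>. cond_law Pstar (\<lambda>v. v 1) (\<lambda>v. v \<tau>) \<kappa> \<longrightarrow>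
            (AE v in Pstar. tilted_measure \<pi>0 (\<tau> / (1 - \<tau>)) ((1 / (1 - \<tau>)) *\<^sub>R v \<tau>) = \<kappa> (v \<tau>)) \<and>
            (AE \<omega> in M. tilted_measure \<pi>0 (\<tau> / (1 - \<tau>)) (c (\<tau> / (1 - \<tau>)) \<omega>) =
               \<kappa> ((1 - \<tau>) *\<^sub>R c (\<tau> / (1 - \<tau>)) \<omega>))))"
proof -
  interpret bridge \<pi>0 W Pstar
    by (intro bridge.intro prior.intro bridge_axioms.intro) fact+
  define J where "J = (\<Pi>\<^sub>M \<tau>\<in>{0..<1::real}. (borel :: 'a measure))"
  have law: "distr M J (\<lambda>\<omega>. \<lambda>\<tau>\<in>{0..<1}. c (\<tau> / (1 - \<tau>)) \<omega>) =
         distr Pstar J (\<lambda>v. \<lambda>\<tau>\<in>{0..<1}. (1 / (1 - \<tau>)) *\<^sub>R v \<tau>)"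
    unfolding J_def by (rule distr_tilt_process) fact+
  have cM: "c t \<in> M \<rightarrow>\<^sub>M borel" if "0 \<le> t" for t
    using \<open>tilt_process \<pi>0 M F B c\<close> that unfolding tilt_process_def wiener_process_def
    by (intro measurable_from_subalg[of M "F t"]) auto
  have vP: "(\<lambda>v. v \<tau>) \<in> Pstar \<rightarrow>\<^sub>M borel" if "\<tau> \<in> {0..<1}" for \<tau>
    using component_W[of \<tau>] that by simp
  have Jc: "(\<lambda>\<omega>. \<lambda>\<tau>\<in>{0..<1}. c (\<tau> / (1 - \<tau>)) \<omega>) \<in> M \<rightarrow>\<^sub>M J"
    unfolding J_def using cM by (intro measurable_restrict) auto
  have Jv: "(\<lambda>v. \<lambda>\<tau>\<in>{0..<1}. (1 / (1 - \<tau>)) *\<^sub>R v \<tau>) \<in> Pstar \<rightarrow>\<^sub>M J"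
    unfolding J_def using vP by (intro measurable_restrict) auto
  \<comment> \<open>For the conditional laws, one time at a time is enough; rescaling by 1 - \<tau>
    turns the marginal of the process law into that of the bridge.\<close>
  have marginal: "distr M borel (\<lambda>\<omega>. (1 - \<tau>) *\<^sub>R c (\<tau> / (1 - \<tau>)) \<omega>) = distr Pstar borel (\<lambda>v. v \<tau>)"
    if \<tau>: "\<tau> \<in> {0..<1}" for \<tau>
  proof -
    have eval: "(\<lambda>f. (1 - \<tau>) *\<^sub>R f \<tau>) \<in> J \<rightarrow>\<^sub>M borel"
      unfolding J_def using measurable_component_singleton[OF \<tau>, of "\<lambda>_. borel :: 'a measure"] by simp
    have "distr M borel (\<lambda>\<omega>. (1 - \<tau>) *\<^sub>R c (\<tau> / (1 - \<tau>)) \<omega>)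
      = distr (distr M J (\<lambda>\<omega>. \<lambda>\<tau>\<in>{0..<1}. c (\<tau> / (1 - \<tau>)) \<omega>)) borel (\<lambda>f. (1 - \<tau>) *\<^sub>R f \<tau>)"
      using \<tau> by (subst distr_distr[OF eval Jc]) (simp add: comp_def)
    also have "\<dots> = distr Pstar borel (\<lambda>v. v \<tau>)"
      unfolding law using \<tau> by (subst distr_distr[OF eval Jv]) (simp add: comp_def)
    finally show ?thesis .
  qed
  have "(AE v in Pstar. tilted_measure \<pi>0 (\<tau> / (1 - \<tau>)) ((1 / (1 - \<tau>)) *\<^sub>R v \<tau>) = \<kappa> (v \<tau>)) \<and>
      (AE \<omega> in M. tilted_measure \<pi>0 (\<tau> / (1 - \<tau>)) (c (\<tau> / (1 - \<tau>)) \<omega>) = \<kappa> ((1 - \<tau>) *\<^sub>R c (\<tau> / (1 - \<tau>)) \<omega>))"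
    if \<tau>: "\<tau> \<in> {0..<1}" and \<kappa>: "cond_law Pstar (\<lambda>v. v 1) (\<lambda>v. v \<tau>) \<kappa>" for \<tau> \<kappa>
  proof
    \<comment> \<open>Equality of kernels is a statement about almost every value \<open>z\<close>.
      By \<open>marginal\<close>, the same null set of values serves the bridge on
      \<open>Pstar\<close> and the rescaled tilt process on \<open>M\<close>.\<close>
    have AE: "AE z in distr Pstar borel (\<lambda>v. v \<tau>). tilted_measure \<pi>0 (\<tau> / (1 - \<tau>)) ((1 / (1 - \<tau>)) *\<^sub>R z) = \<kappa> z"
      by (rule cond_law_unique[OF P.prob_space_axioms vP[OF \<tau>] cond_law_tilted \<kappa>]) (use \<tau> in auto)
    show "AE v in Pstar. tilted_measure \<pi>0 (\<tau> / (1 - \<tau>)) ((1 / (1 - \<tau>)) *\<^sub>R v \<tau>) = \<kappa> (v \<tau>)"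
      by (rule AE_distrD[OF vP[OF \<tau>] AE])
    have m: "(\<lambda>\<omega>. (1 - \<tau>) *\<^sub>R c (\<tau> / (1 - \<tau>)) \<omega>) \<in> M \<rightarrow>\<^sub>M borel"
      using cM[of "\<tau> / (1 - \<tau>)"] \<tau> by simp
    show "AE \<omega> in M. tilted_measure \<pi>0 (\<tau> / (1 - \<tau>)) (c (\<tau> / (1 - \<tau>)) \<omega>) = \<kappa> ((1 - \<tau>) *\<^sub>R c (\<tau> / (1 - \<tau>)) \<omega>)"
      using AE_distrD[OF m, unfolded marginal[OF \<tau>], OF AE] \<tau> by simp
  qed
  then show ?thesis
    using law cond_law_tilted unfolding J_def by auto
qed

end
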